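(* Let $a,b,c$ be pairwise relatively prime positive integers satisfying $\frac1a+\frac1b+\frac1c<1$. For positive integers $m,n$ let $X_{n,m}\subset\mathbb{C}^5$ be the affine variety (coordinates $X,Y,Z,U,V$) defined by the equations $$X^a+Y^b+Z^c=0,\qquad X^mU-Y^nV-1=0.$$ Then: (1) for all positive integers $m,n$, the variety $X_{n,m}$ is factorial; (2) for all pairs of positive integers $(m,n)$ and $(m',n')$, $X_{n,m}\times\mathbb{C}\cong X_{n',m'}\times\mathbb{C}$ as complex algebraic varieties; (3) if $X_{n,m}\cong X_{n',m'}$ as complex algebraic varieties, then $(m,n)=(m',n')$.
   Context: An affine variety is called factorial if its coordinate ring is a unique factorization domain. The exponents $a,b,c$ are the same for all the varieties $X_{n,m}$ being compared. *)

theory Defs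
  imports "HOL-Analysis.Finite_Cartesian_Product" "HOL-Library.Numeral_Type"
    "HOL-Algebra.Ring_Divisibility"
begin

inductive_set polynomial_functions :: "(complex ^ 'n \<Rightarrow> complex) set" where
  const: "(\<lambda>x. k) \<in> polynomial_functions"
| coord: "(\<lambda>x. x $ i) \<in> polynomial_functions"
| add: "f \<in> polynomial_functions \<Longrightarrow> g \<in> polynomial_functions \<Longrightarrow>
    (\<lambda>x. f x + g x) \<in> polynomial_functions"
| mult: "f \<in> polynomial_functions \<Longrightarrow> g \<in> polynomial_functions \<Longrightarrow>
    (\<lambda>x. f x * g x) \<in> polynomial_functions"

text \<open>Affine varieties are Zariski closed subsets of some \<open>complex ^ 'n\<close> with their reduced
  structure. A regular function on such a set is the restriction of a polynomial;
  \<^const>\<open>restrict\<close> makes equality of regular functions agree with pointwise equality on the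
  variety.\<close>

definition regular_functions :: "(complex ^ 'n) set \<Rightarrow> (complex ^ 'n \<Rightarrow> complex) set" where
  "regular_functions V = (\<lambda>f. restrict f V) ` polynomial_functions"

definition coordinate_ring :: "(complex ^ 'n) set \<Rightarrow> (complex ^ 'n \<Rightarrow> complex) ring" where
  "coordinate_ring V =
    \<lparr>carrier = regular_functions V,
     mult = (\<lambda>f g. restrict (\<lambda>x. f x * g x) V),
     one = restrict (\<lambda>x. 1) V,
     zero = restrict (\<lambda>x. 0) V,
     add = (\<lambda>f g. restrict (\<lambda>x. f x + g x) V)\<rparr>"

definition factorial_variety :: "(complex ^ 'n) set \<Rightarrow> bool" where
  "factorial_variety V \<longleftrightarrow> factorial_domain (coordinate_ring V)"

definition morphism :: "(complex ^ 'n) set \<Rightarrow> (complex ^ 'm) set \<Rightarrow> (complex ^ 'n \<Rightarrow> complex ^ 'm) \<Rightarrow> bool"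
  where
  "morphism V W \<phi> \<longleftrightarrow>
    \<phi> ` V \<subseteq> W \<and> (\<forall>i. restrict (\<lambda>x. \<phi> x $ i) V \<in> regular_functions V)"

definition isomorphic_varieties :: "(complex ^ 'n) set \<Rightarrow> (complex ^ 'm) set \<Rightarrow> bool"
    (infix \<open>\<cong>\<^sub>v\<^sub>a\<^sub>r\<close> 50) where
  "V \<cong>\<^sub>v\<^sub>a\<^sub>r W \<longleftrightarrow>
    (\<exists>\<phi> \<psi>. morphism V W \<phi> \<and> morphism W V \<psi> \<and>
      (\<forall>x\<in>V. \<psi> (\<phi> x) = x) \<and> (\<forall>y\<in>W. \<phi> (\<psi> y) = y))"

text \<open>The product sits in affine space indexed by the disjoint union of the two index types,
  that is, in \<open>\<complex>\<^sup>n \<times> \<complex>\<^sup>m = \<complex>\<^sup>n\<^sup>+\<^sup>m\<close>.\<close>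

definition variety_prod :: "(complex ^ 'n) set \<Rightarrow> (complex ^ 'm) set \<Rightarrow> (complex ^ ('n + 'm)) set"
    (infixr \<open>\<times>\<^sub>v\<^sub>a\<^sub>r\<close> 80) where
  "V \<times>\<^sub>v\<^sub>a\<^sub>r W = {z. (\<chi> i. z $ Inl i) \<in> V \<and> (\<chi> j. z $ Inr j) \<in> W}"

definition affine_line :: "(complex ^ 1) set" where
  "affine_line = UNIV"

text \<open>The coordinates \<open>X, Y, Z, U, V\<close> are the components \<open>1, 2, 3, 4, 5\<close>, in this order
  (in the index type \<open>5\<close> of integers modulo five these are distinct, with \<open>5 = 0\<close>). The
  index \<open>n\<close> (the exponent of \<open>Y\<close>) precedes \<open>m\<close> (the exponent of \<open>X\<close>).\<close>

definition X_variety :: "nat \<Rightarrow> nat \<Rightarrow> nat \<Rightarrow> nat \<Rightarrow> nat \<Rightarrow> (complex ^ 5) set" where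
  "X_variety a b c n m =
    {p. (p $ 1) ^ a + (p $ 2) ^ b + (p $ 3) ^ c = 0 \<and>
        (p $ 1) ^ m * (p $ 4) - (p $ 2) ^ n * (p $ 5) - 1 = 0}"

lemma coordinate_ring_cring: "cring (coordinate_ring V)"
proof -
  note pf = polynomial_functions.intros
  let ?R = "regular_functions V"
  have reg: "restrict f V \<in> ?R" if "f \<in> polynomial_functions" for f
    using that by (auto simp: regular_functions_def)
  have closed: "restrict (\<lambda>x. f x + g x) V \<in> ?R" "restrict (\<lambda>x. f x * g x) V \<in> ?R"
    if fg_in: "f \<in> ?R" "g \<in> ?R" for f g
  proof -
    obtain f' g' where fg: "f = restrict f' V" "f' \<in> polynomial_functions"
        "g = restrict g' V" "g' \<in> polynomial_functions"
      using fg_in unfolding regular_functions_def by blast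
    have "restrict (\<lambda>x. f x + g x) V = restrict (\<lambda>x. f' x + g' x) V"
      "restrict (\<lambda>x. f x * g x) V = restrict (\<lambda>x. f' x * g' x) V"
      by (auto simp: fg intro: restrict_ext)
    then show "restrict (\<lambda>x. f x + g x) V \<in> ?R" "restrict (\<lambda>x. f x * g x) V \<in> ?R"
      using reg pf(3,4) fg by metis+
  qed
  have ext: "restrict f V = f" if "f \<in> ?R" for f
    using that by (auto simp: regular_functions_def)
  have minus: "\<exists>g\<in>?R. restrict (\<lambda>x. f x + g x) V = restrict (\<lambda>x. 0) V"
    if "f \<in> ?R" for f
    using closed(2)[OF reg[OF pf(1)[of "-1"]] that]
    by (rule bexI[rotated]) (auto intro: restrict_ext)
  have abelian: "abelian_group (coordinate_ring V)"
    by (rule abelian_groupI)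
      (auto simp: coordinate_ring_def closed reg pf minus ext add_ac
        cong: restrict_cong)
  have comm: "comm_monoid (coordinate_ring V)"
    by (rule comm_monoidI)
      (auto simp: coordinate_ring_def closed reg pf ext mult_ac
        cong: restrict_cong)
  show ?thesis
    by (rule cringI[OF abelian comm])
      (auto simp: coordinate_ring_def distrib_right intro!: restrict_ext)
qed

text \<open>The familiar description \<open>\<complex>[x\<^sub>1, \<dots>, x\<^sub>n] / I(V)\<close> is recovered by the first isomorphism
  theorem; polynomials and polynomial functions on all of \<open>\<complex>\<^sup>n\<close> agree as \<open>\<complex>\<close> is infinite.\<close>

lemma coordinate_ring_iso_Quot:
  fixes V :: "(complex ^ 'n) set"
  defines "P \<equiv> coordinate_ring (UNIV :: (complex ^ 'n) set)"
  shows "P Quot {f \<in> carrier P. \<forall>x\<in>V. f x = 0} \<simeq> coordinate_ring V"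
proof -
  let ?h = "\<lambda>f. restrict f V"
  have hom: "ring_hom_ring P (coordinate_ring V) ?h"
    unfolding P_def
    by (intro ring_hom_ringI cring.axioms(1) coordinate_ring_cring)
      (auto simp: coordinate_ring_def regular_functions_def restrict_def fun_eq_iff)
  have "?h ` carrier P = carrier (coordinate_ring V)"
    by (auto simp: P_def coordinate_ring_def regular_functions_def image_image)
  moreover have "a_kernel P (coordinate_ring V) ?h = {f \<in> carrier P. \<forall>x\<in>V. f x = 0}"
    unfolding a_kernel_def'
    by (auto simp: P_def coordinate_ring_def restrict_def fun_eq_iff; metis)
  ultimately show ?thesis
    using ring_hom_ring.FactRing_iso[OF hom] by simp
qed

end

(*
Proof idea. X_{n,m} is a principal bundle with fibre the affine line over the surface
S : x^a + y^b + z^c = 0 without its singular point.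

(1) By Nagata: x, y, z are prime in the coordinate ring A, and A[1/xyz] is a localisation of the
polynomial ring C[w, T, v], where w = y^b / x^a and T is a Laurent monomial of degree one in x, y, z.

(2) The fibre product of X_{n,m} and X_{n',m'} over the punctured surface is a trivial bundle over
each of the two affine factors (Danielewski's argument).

(3) By Mason's theorem the punctured surface contains no polynomial curve, so an isomorphism maps
fibres to fibres and induces an automorphism of S. Mason's theorem for curves with one puncture
makes that automorphism diagonal. On fibres the isomorphism is then affine with constant factor, and
the cocycle 1 / (x^m y^n) of the bundle, whose annihilator is (x^m, y^n), determines m and n.
*)

theory Submission
  imports Defs "HOL-Computational_Algebra.Field_as_Ring" "HOL-Computational_Algebra.Polynomial_Factorial"
    "HOL-Computational_Algebra.Fundamental_Theorem_Algebra"
begin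

section \<open>Mason's theorem\<close>

text \<open>All rings are handled as sets of functions on points. What makes this workable is a
  normal form: the equation of \<open>S\<close> is monic in \<open>z\<close>, so a polynomial
  function on \<open>S\<close> has a representative of degree below \<open>c\<close> in
  \<open>z\<close>, unique because a nonzero number has \<open>c\<close> distinct
  \<open>c\<close>-th roots. Functions on \<open>S\<close> thus form a free module over the
  polynomials in \<open>x\<close> and \<open>y\<close>, and divisibility becomes comparison of
  coefficients. In particular \<open>x^N, y^N\<close> is a regular sequence, so functions regular
  off the singular point extend over it; this is how an isomorphism of threefolds, which only sees
  the punctured surface, induces polynomial maps of \<open>S\<close>. Freeness also keeps
  \<open>x^i y^j\<close> with \<open>i, j < N\<close> outside the ideal \<open>(x^N, y^N)\<close>,
  so that the bundle is nontrivial. Pairwise coprimality gives the curves cut out by the coordinates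
  a monomial parametrisation, hence irreducibility, and leaves the weights \<open>bc, ac, ab\<close>
  of \<open>x, y, z\<close> without a common factor, whence the Laurent monomial of degree
  one.\<close>

lemma coprime_complex_poly:
  fixes p q :: "complex poly"
  assumes "\<And>x. poly p x = 0 \<Longrightarrow> poly q x = 0 \<Longrightarrow> False"
  shows "coprime p q"
proof (rule coprimeI)
  fix r assume r: "r dvd p" "r dvd q"
  have "constant (poly r)"
  proof (rule ccontr)
    assume "\<not> constant (poly r)"
    then obtain x where "poly r x = 0" using fundamental_theorem_of_algebra by blast
    then show False using r assms[of x] by (auto elim!: dvdE)
  qed
  then have "degree r = 0" by (simp add: constant_degree)
  moreover have "r \<noteq> 0" using r assms[of 0] by auto
  ultimately show "is_unit r" by (simp add: is_unit_iff_degree)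
qed

lemma power_pred_dvd_pderiv:
  fixes f :: "complex poly" shows "f ^ (k - 1) dvd pderiv (f ^ k)"
  by (cases k) (simp_all add: pderiv_power_Suc dvd_mult dvd_smult del: power_Suc)

text \<open>By coprimality \<open>F\<close> divides its own derivative, which in characteristic zero
  only happens for constants.\<close>

lemma coprime_wronskian_zero:
  fixes F G :: "complex poly"
  assumes "coprime F G" "pderiv F * G = F * pderiv G"
  shows "degree F = 0"
proof -
  have "F dvd pderiv F * G" using assms(2) by simp
  then have "F dvd pderiv F" using assms(1) by (simp add: coprime_dvd_mult_left_iff)
  then show ?thesis by (rule dvd_pderiv_iff[THEN iffD1])
qed

lemma degree_wronskian:
  fixes F G :: "complex poly"
  assumes "pderiv F * G - F * pderiv G \<noteq> 0"
  shows "degree (pderiv F * G - F * pderiv G) < degree F + degree G"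
proof -
  have *: "pderiv P * Q = 0 \<or> degree (pderiv P * Q) < degree P + degree Q" for P Q :: "complex poly"
  proof (cases "degree P = 0")
    case False
    then show ?thesis
      using degree_mult_le[of "pderiv P" Q] by (simp add: degree_pderiv, linarith)
  qed (simp add: pderiv_eq_0_iff)
  have 1: "pderiv F * G = 0 \<or> degree (pderiv F * G) < degree F + degree G" by (rule *)
  have 2: "F * pderiv G = 0 \<or> degree (F * pderiv G) < degree F + degree G"
    using *[of G F] by (simp add: ac_simps)
  show ?thesis using 1 2 assms
    by (metis degree_0 degree_diff_less degree_minus diff_0 diff_zero)
qed

text \<open>Up to sign, any two of the three summands have the same Wronskian. It is divisible by
  each base to the exponent minus one, yet its degree is less than the sum of the degrees of any two
  summands. The separate factor \<open>monom 1 r\<close> allows one summand a zero of arbitrary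
  order at the origin, as needed for a curve with one puncture.\<close>

lemma mason_core:
  fixes f g h :: "complex poly" and a b c r :: nat
  assumes abc: "0 < a" "0 < b" "0 < c" "1 / real a + 1 / real b + 1 / real c < 1"
    and nz: "f \<noteq> 0" "g \<noteq> 0" "h \<noteq> 0"
    and eq: "f ^ a + g ^ b + monom 1 r * h ^ c = 0"
    and cop: "coprime f g" "coprime f h" "coprime g h"
    and at0: "poly f 0 \<noteq> 0" "poly g 0 \<noteq> 0"
  shows "degree f = 0 \<and> degree g = 0 \<and> degree h = 0 \<and> r = 0"
proof -
  define F G H where "F = f ^ a" and "G = g ^ b" and "H = monom 1 r * h ^ c"
  define W where "W = pderiv F * G - F * pderiv G"
  have Hnz: "H \<noteq> 0" using nz by (simp add: H_def)
  have H: "H = - F - G" using eq by (simp add: F_def G_def H_def algebra_simps eq_neg_iff_add_eq_0)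
  have W2: "W = - (pderiv F * H - F * pderiv H)" and W3: "W = pderiv G * H - G * pderiv H"
    by (simp_all add: W_def H pderiv_diff pderiv_minus algebra_simps)
  have cFG: "coprime F G" using cop by (simp add: F_def G_def)
  have degs: "degree F = a * degree f" "degree G = b * degree g" "degree H = r + c * degree h"
    using nz by (simp_all add: F_def G_def H_def degree_power_eq degree_mult_eq degree_monom_eq)
  show ?thesis
  proof (cases "W = 0")
    \<comment> \<open>A vanishing Wronskian makes \<open>F\<close> and \<open>G\<close> constant,
      and \<open>H\<close> with them, so \<open>r + c * degree h\<close> is zero.\<close>
    case True
    then have e: "pderiv F * G = F * pderiv G" by (simp add: W_def)
    have dF: "degree F = 0" using coprime_wronskian_zero[OF cFG e] .
    have "pderiv G * F = G * pderiv F" using e by (simp add: mult.commute)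
    then have dG: "degree G = 0" using coprime_wronskian_zero[of G F] cFG by (simp add: coprime_commute)
    have "degree H \<le> 0" unfolding H using dF dG by (metis degree_diff_le degree_minus order_refl)
    then show ?thesis using dF dG degs abc by simp
  next
    case False
    have d1: "f ^ (a - 1) dvd W"
      unfolding W_def F_def by (intro dvd_diff dvd_mult2 power_pred_dvd_pderiv le_imp_power_dvd) simp
    have d2: "g ^ (b - 1) dvd W"
      unfolding W_def G_def by (intro dvd_diff dvd_mult power_pred_dvd_pderiv le_imp_power_dvd) simp
    have m: "monom 1 k = [:0, 1::complex:] ^ k" for k by (simp add: monom_altdef)
    have H': "monom 1 (r - 1) * h ^ (c - 1) dvd pderiv H"
    proof -
      have "monom 1 (r - 1) dvd pderiv (monom (1::complex) r)" "monom 1 (r - 1) dvd monom (1::complex) r"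
        unfolding m by (rule power_pred_dvd_pderiv) (simp add: le_imp_power_dvd)
      moreover have "h ^ (c - 1) dvd pderiv (h ^ c)" "h ^ (c - 1) dvd h ^ c"
        by (rule power_pred_dvd_pderiv) (simp add: le_imp_power_dvd)
      ultimately show ?thesis
        unfolding H_def pderiv_mult
        by (metis dvd_add mult.commute mult_dvd_mono)
    qed
    have H'': "monom 1 (r - 1) * h ^ (c - 1) dvd H"
      unfolding H_def m by (intro mult_dvd_mono le_imp_power_dvd) auto
    have d3: "monom 1 (r - 1) * h ^ (c - 1) dvd W"
      unfolding W3 using H' H'' by (intro dvd_diff dvd_mult) 
    have cm: "coprime p (monom 1 (r - 1))" if "poly p 0 \<noteq> 0" for p :: "complex poly"
      using that by (intro coprime_complex_poly) (auto simp: poly_monom power_0_left split: if_splits)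
    have "f ^ (a - 1) * g ^ (b - 1) dvd W"
      by (rule divides_mult[OF d1 d2]) (use cop in simp)
    then have "f ^ (a - 1) * g ^ (b - 1) * (monom 1 (r - 1) * h ^ (c - 1)) dvd W"
      by (rule divides_mult[OF _ d3]) (use cop cm at0 in auto)
    then have "degree (f ^ (a - 1) * g ^ (b - 1) * (monom 1 (r - 1) * h ^ (c - 1))) \<le> degree W"
      using False by (rule dvd_imp_degree_le)
    then have dD: "(a - 1) * degree f + (b - 1) * degree g + (r - 1 + (c - 1) * degree h) \<le> degree W"
      using nz by (simp add: degree_mult_eq degree_power_eq degree_monom_eq)
    have b1: "degree W < degree F + degree G" using degree_wronskian False by (auto simp: W_def)
    have b2: "degree W < degree F + degree H"
      using degree_wronskian[of F H] False W2 by (metis degree_minus neg_equal_0_iff_equal)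
    have b3: "degree W < degree G + degree H"
      using degree_wronskian[of G H] False by (simp add: W3)
    obtain a' b' c' where [simp]: "a = Suc a'" "b = Suc b'" "c = Suc c'"
      using abc by (meson gr0_implies_Suc)
    let ?d = "degree f + degree g + degree h"
    \<comment> \<open>Only the bound for \<open>h\<close> stays strict: the degree of
      \<open>H\<close> counts \<open>r\<close>, but the known divisor of \<open>W\<close>
      contributes only \<open>r - 1\<close>, which costs one in the other two. A single strict
      inequality is enough below.\<close>
    have "c * degree h < ?d" "b * degree g \<le> ?d" "a * degree f \<le> ?d"
      using dD b1 b2 b3 unfolding degs by simp_all
    then have r: "real c * real (degree h) < real ?d" "real b * real (degree g) \<le> real ?d"
        "real a * real (degree f) \<le> real ?d"
      by (metis of_nat_less_iff of_nat_le_iff of_nat_mult)+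
    have "real (degree h) < real ?d * (1 / real c)" "real (degree g) \<le> real ?d * (1 / real b)"
        "real (degree f) \<le> real ?d * (1 / real a)"
      using r abc by (simp_all add: field_simps)
    then have "real ?d < real ?d * (1 / real a + 1 / real b + 1 / real c)"
      by (simp add: algebra_simps)
    also have "\<dots> \<le> real ?d * 1" using abc(4) by (intro mult_left_mono) auto
    finally show ?thesis by simp
  qed
qed

lemma monomial_of_power:
  fixes f :: "complex poly"
  assumes "f = monom 1 i * p" "degree p = 0"
  shows "\<exists>\<alpha>. f ^ k = monom \<alpha> (i * k)"
proof -
  obtain \<beta> where "p = [:\<beta>:]" using assms(2) degree_eq_zeroE by blast
  then have "f = monom \<beta> i" using assms(1) by (simp add: mult_monom flip: monom_0)
  then show ?thesis using monom_power by metis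
qed

lemma monom_factor:
  fixes f :: "complex poly"
  assumes "f \<noteq> 0"
  obtains i p where "f = monom 1 i * p" "poly p 0 \<noteq> 0"
  using order_decomp[OF assms, of 0] by (auto simp: monom_altdef poly_eq_0_iff_dvd)

lemma monom_mult_cancel:
  fixes p q :: "complex poly"
  assumes "monom 1 i * p + monom 1 i * q + monom 1 j * r = 0" "i \<le> j"
  shows "p + q + monom 1 (j - i) * r = 0"
proof -
  have "monom 1 j = monom 1 i * monom (1::complex) (j - i)"
    using assms(2) by (simp add: mult_monom)
  then have "monom 1 i * (p + q + monom 1 (j - i) * r) = 0"
    using assms(1) by (simp add: algebra_simps)
  then show ?thesis by simp
qed

text \<open>The common zeros of \<open>f, g, h\<close> are only constrained away from \<open>0\<close>. Dividing by the
  smallest of the three orders at \<open>0\<close> leaves at most one summand vanishing there, since the sum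
  is zero.\<close>

lemma mason_monomial:
  fixes f g h :: "complex poly" and a b c :: nat
  assumes abc: "0 < a" "0 < b" "0 < c" "1 / real a + 1 / real b + 1 / real c < 1"
    and eq: "f ^ a + g ^ b + h ^ c = 0"
    and nocom: "\<And>s. s \<noteq> 0 \<Longrightarrow> poly f s = 0 \<Longrightarrow> poly g s = 0 \<Longrightarrow> poly h s = 0 \<Longrightarrow> False"
  shows "\<exists>M \<alpha> \<beta> \<gamma>. f ^ a = monom \<alpha> M \<and> g ^ b = monom \<beta> M \<and> h ^ c = monom \<gamma> M"
proof -
  note peq = arg_cong[OF eq, of "\<lambda>p. poly p s" for s, simplified]
  \<comment> \<open>The case of one identically zero summand: the other two have the same zeros,
    hence none off the origin.\<close>
  have zero: "\<exists>M \<alpha>. F ^ a' = monom \<alpha> M \<and> G ^ b' = monom (- \<alpha>) M"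
    if "F ^ a' + G ^ b' = 0" "0 < a'" "0 < b'"
      and no: "\<And>s. s \<noteq> 0 \<Longrightarrow> poly F s = 0 \<Longrightarrow> poly G s = 0 \<Longrightarrow> False" for F G :: "complex poly" and a' b'
  proof (cases "F = 0")
    case True
    then have "G = 0" using that by (auto simp: power_0_left)
    then show ?thesis using True no[of 1] by auto
  next
    case False
    then obtain i p where p: "F = monom 1 i * p" "poly p 0 \<noteq> 0" using monom_factor by blast
    have "poly p s \<noteq> 0" for s
    proof
      assume s: "poly p s = 0"
      then have "s \<noteq> 0" using p by auto
      moreover have "poly F s = 0" using s p by simp
      moreover have "poly F s ^ a' + poly G s ^ b' = 0"
        using arg_cong[OF that(1), of "\<lambda>p. poly p s"] by simp
      ultimately show False using no that(2,3) by (auto simp: power_0_left)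
    qed
    then have "constant (poly p)" using fundamental_theorem_of_algebra by blast
    then have "degree p = 0" by (simp add: constant_degree)
    then obtain \<alpha> where "F ^ a' = monom \<alpha> (i * a')" using monomial_of_power[OF p(1)] by blast
    moreover have "G ^ b' = - (F ^ a')" using that(1) by (simp add: eq_neg_iff_add_eq_0 add.commute)
    ultimately show ?thesis by (metis minus_monom)
  qed
  have main: "\<exists>M \<alpha> \<beta> \<gamma>. F ^ a' = monom \<alpha> M \<and> G ^ b' = monom \<beta> M \<and> H ^ c' = monom \<gamma> M"
    if abc': "0 < a'" "0 < b'" "0 < c'" "1 / real a' + 1 / real b' + 1 / real c' < 1"
      and F: "F = monom 1 i * p" "poly p 0 \<noteq> 0" and G: "G = monom 1 j * q" "poly q 0 \<noteq> 0"
      and H: "H = monom 1 k * t" "poly t 0 \<noteq> 0"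
      and eq': "F ^ a' + G ^ b' + H ^ c' = 0"
      and no: "\<And>s. s \<noteq> 0 \<Longrightarrow> poly F s = 0 \<Longrightarrow> poly G s = 0 \<Longrightarrow> poly H s = 0 \<Longrightarrow> False"
      and ord: "i * a' = j * b'" "i * a' \<le> k * c'"
    for F G H p q t :: "complex poly" and a' b' c' i j k
  proof -
    have pw: "F ^ a' = monom 1 (i * a') * p ^ a'" "G ^ b' = monom 1 (i * a') * q ^ b'"
        "H ^ c' = monom 1 (k * c') * t ^ c'"
      using F G H ord(1) by (simp_all add: power_mult_distrib monom_power)
    define r where "r = k * c' - i * a'"
    have e: "p ^ a' + q ^ b' + monom 1 r * t ^ c' = 0"
      using monom_mult_cancel[OF _ ord(2)] eq' unfolding pw r_def by blast
    have pe: "poly p s ^ a' + poly q s ^ b' + s ^ r * poly t s ^ c' = 0" for s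
      using arg_cong[OF e, of "\<lambda>p. poly p s"] by (simp add: poly_monom)
    have no': "\<not> (poly p s = 0 \<and> poly q s = 0)" "\<not> (poly p s = 0 \<and> poly t s = 0)"
        "\<not> (poly q s = 0 \<and> poly t s = 0)" for s
      using pe[of s] no[of s] F G H abc' by (cases "s = 0"; auto simp: power_0_left)+
    have "degree p = 0 \<and> degree q = 0 \<and> degree t = 0 \<and> r = 0"
      using F G H no' abc' e by (intro mason_core coprime_complex_poly) auto
    then have *: "degree p = 0" "degree q = 0" "degree t = 0" "k * c' = i * a'"
      using ord by (auto simp: r_def)
    show ?thesis
      using monomial_of_power[OF F(1) *(1), of a'] monomial_of_power[OF G(1) *(2), of b']
        monomial_of_power[OF H(1) *(3), of c'] *(4) ord(1) by metis
  qed
  consider "f = 0" | "g = 0" | "h = 0" | "f \<noteq> 0" "g \<noteq> 0" "h \<noteq> 0" by blast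
  then show ?thesis
  proof cases
    case 1
    then show ?thesis using zero[of g b h c] eq nocom abc by (simp add: power_0_left) (metis monom_0)
  next
    case 2
    then show ?thesis using zero[of f a h c] eq nocom abc by (simp add: power_0_left) (metis monom_0)
  next
    case 3
    then show ?thesis using zero[of f a g b] eq nocom abc by (simp add: power_0_left) (metis monom_0)
  next
    case 4
    obtain i p where F: "f = monom 1 i * p" "poly p 0 \<noteq> 0" using monom_factor[OF 4(1)] by blast
    obtain j q where G: "g = monom 1 j * q" "poly q 0 \<noteq> 0" using monom_factor[OF 4(2)] by blast
    obtain k t where H: "h = monom 1 k * t" "poly t 0 \<noteq> 0" using monom_factor[OF 4(3)] by blast
    let ?A = "i * a" and ?B = "j * b" and ?C = "k * c"
    have pw: "f ^ a = monom 1 ?A * p ^ a" "g ^ b = monom 1 ?B * q ^ b" "h ^ c = monom 1 ?C * t ^ c"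
      using F G H by (simp_all add: power_mult_distrib monom_power)
    have single: False if s: "monom 1 A * P + monom 1 B * Q + monom 1 C * R = 0" "poly P 0 \<noteq> 0" "A < B" "A < C"
      for A B C and P Q R :: "complex poly"
    proof -
      obtain B' C' where "B = A + Suc B'" "C = A + Suc C'" using s(3,4) less_iff_Suc_add by (metis add_Suc_right)
      then have "monom 1 B = monom 1 A * monom (1::complex) (Suc B')"
          "monom 1 C = monom 1 A * monom (1::complex) (Suc C')"
        by (simp_all add: mult_monom)
      then have "monom 1 A * (P + monom 1 (Suc B') * Q + monom 1 (Suc C') * R) = 0"
        using s(1) by (simp add: algebra_simps)
      then have "P + monom 1 (Suc B') * Q + monom 1 (Suc C') * R = 0" by simp
      from arg_cong[OF this, of "\<lambda>p. poly p 0"] show False using s(2) by (simp add: poly_monom)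
    qed
    have at0: "poly (p ^ a) 0 \<noteq> 0" "poly (q ^ b) 0 \<noteq> 0" "poly (t ^ c) 0 \<noteq> 0"
      using F G H by simp_all
    have e: "monom 1 ?A * p ^ a + monom 1 ?B * q ^ b + monom 1 ?C * t ^ c = 0"
      using eq unfolding pw .
    have "\<not> (?A < ?B \<and> ?A < ?C)" "\<not> (?B < ?A \<and> ?B < ?C)" "\<not> (?C < ?A \<and> ?C < ?B)"
      using single[OF e at0(1)] single[of ?B "q ^ b" ?A "p ^ a" ?C "t ^ c"]
        single[of ?C "t ^ c" ?A "p ^ a" ?B "q ^ b"] e at0 by (auto simp: algebra_simps)
    then consider "?A = ?B" "?A \<le> ?C" | "?A = ?C" "?A \<le> ?B" | "?B = ?C" "?B \<le> ?A" by linarith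
    then show ?thesis
    proof cases
      case 1
      then show ?thesis using abc eq nocom by (intro main[OF _ _ _ _ F G H]) auto
    next
      case 2
      have "\<exists>M \<alpha> \<beta> \<gamma>. f ^ a = monom \<alpha> M \<and> h ^ c = monom \<beta> M \<and> g ^ b = monom \<gamma> M"
        using 2 abc eq nocom by (intro main[OF _ _ _ _ F H G]) (auto simp: algebra_simps)
      then show ?thesis by blast
    next
      case 3
      have "\<exists>M \<alpha> \<beta> \<gamma>. g ^ b = monom \<alpha> M \<and> h ^ c = monom \<beta> M \<and> f ^ a = monom \<gamma> M"
        using 3 abc eq nocom by (intro main[OF _ _ _ _ G H F]) (auto simp: algebra_simps)
      then show ?thesis by blast
    qed
  qed
qed

section \<open>Rings of polynomial functions\<close>

text \<open>A common closure principle for polynomial functions on the various affine spaces, for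
  nested polynomials along curves and charts, and for localisations: a polynomial expression in
  members of \<open>K\<close> is again in \<open>K\<close>.\<close>

definition function_ring :: "('a \<Rightarrow> complex) set \<Rightarrow> bool" where
  "function_ring K \<longleftrightarrow> (\<forall>k. (\<lambda>p. k) \<in> K) \<and>
    (\<forall>f\<in>K. \<forall>g\<in>K. (\<lambda>p. f p + g p) \<in> K \<and> (\<lambda>p. f p * g p) \<in> K)"

lemma function_ringI:
  assumes "\<And>k. (\<lambda>p. k) \<in> K" "\<And>f g. f \<in> K \<Longrightarrow> g \<in> K \<Longrightarrow> (\<lambda>p. f p + g p) \<in> K"
    "\<And>f g. f \<in> K \<Longrightarrow> g \<in> K \<Longrightarrow> (\<lambda>p. f p * g p) \<in> K"
  shows "function_ring K"
  using assms by (simp add: function_ring_def)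

lemma function_ring_const: "function_ring K \<Longrightarrow> (\<lambda>p. k) \<in> K"
  and function_ring_add: "function_ring K \<Longrightarrow> f \<in> K \<Longrightarrow> g \<in> K \<Longrightarrow> (\<lambda>p. f p + g p) \<in> K"
  and function_ring_mult: "function_ring K \<Longrightarrow> f \<in> K \<Longrightarrow> g \<in> K \<Longrightarrow> (\<lambda>p. f p * g p) \<in> K"
  by (auto simp: function_ring_def)

lemma function_ring_uminus: "function_ring K \<Longrightarrow> f \<in> K \<Longrightarrow> (\<lambda>p. - f p) \<in> K"
  using function_ring_mult[OF _ function_ring_const[of K "-1"], of f] by simp

lemma function_ring_diff: "function_ring K \<Longrightarrow> f \<in> K \<Longrightarrow> g \<in> K \<Longrightarrow> (\<lambda>p. f p - g p) \<in> K"
  using function_ring_add[of K f "\<lambda>p. - g p"] function_ring_uminus by auto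

lemma function_ring_power: "function_ring K \<Longrightarrow> f \<in> K \<Longrightarrow> (\<lambda>p. f p ^ k) \<in> K"
  by (induction k) (auto intro: function_ring_const function_ring_mult)

lemma function_ring_sum:
  "function_ring K \<Longrightarrow> (\<And>i. i \<in> I \<Longrightarrow> f i \<in> K) \<Longrightarrow> (\<lambda>p. \<Sum>i\<in>I. f i p) \<in> K"
  by (induction I rule: infinite_finite_induct) (auto intro: function_ring_const function_ring_add)

lemmas function_ring_intros = function_ring_const function_ring_add function_ring_mult
  function_ring_uminus function_ring_diff function_ring_power function_ring_sum

text \<open>The localisation of \<open>K\<close> at \<open>g\<close>, realised by functions instead
  of fractions. Only values on \<open>V\<close> are compared, so \<open>h\<close> may be arbitrary
  elsewhere.\<close>

definition localised :: "('a \<Rightarrow> complex) set \<Rightarrow> ('a \<Rightarrow> complex) \<Rightarrow> 'a set \<Rightarrow> ('a \<Rightarrow> complex) set" where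
  "localised K g V = {h. \<exists>N. \<exists>f\<in>K. \<forall>p\<in>V. g p ^ N * h p = f p}"

lemma localisedI: "f \<in> K \<Longrightarrow> (\<And>p. p \<in> V \<Longrightarrow> g p ^ N * h p = f p) \<Longrightarrow> h \<in> localised K g V"
  unfolding localised_def by blast

lemma localisedE:
  assumes "h \<in> localised K g V"
  obtains N f where "f \<in> K" "\<And>p. p \<in> V \<Longrightarrow> g p ^ N * h p = f p"
  using assms unfolding localised_def by blast

lemma localised_superset: "f \<in> K \<Longrightarrow> f \<in> localised K g V"
  by (rule localisedI[of f _ _ _ 0]) auto

lemma function_ring_localised:
  assumes "function_ring K" "g \<in> K"
  shows "function_ring (localised K g V)"
proof (rule function_ringI)
  show "(\<lambda>p. k) \<in> localised K g V" for k
    using assms by (intro localised_superset function_ring_intros)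
  fix h h' assume h: "h \<in> localised K g V" "h' \<in> localised K g V"
  obtain N f where f: "f \<in> K" "\<And>p. p \<in> V \<Longrightarrow> g p ^ N * h p = f p"
    using localisedE[OF h(1)] by blast
  obtain N' f' where f': "f' \<in> K" "\<And>p. p \<in> V \<Longrightarrow> g p ^ N' * h' p = f' p"
    using localisedE[OF h(2)] by blast
  have "(\<lambda>p. g p ^ N' * f p + g p ^ N * f' p) \<in> K"
    by (intro function_ring_intros assms f(1) f'(1))
  then show "(\<lambda>p. h p + h' p) \<in> localised K g V"
    by (rule localisedI[where N = "N + N'"])
      (simp add: power_add algebra_simps flip: f(2) f'(2))
  have "(\<lambda>p. f p * f' p) \<in> K"
    by (intro function_ring_intros assms f(1) f'(1))
  then show "(\<lambda>p. h p * h' p) \<in> localised K g V"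
    by (rule localisedI[where N = "N + N'"])
      (simp add: power_add algebra_simps flip: f(2) f'(2))
qed

lemma localised_inverse:
  assumes "function_ring K" "e \<in> K" "\<And>p. p \<in> V \<Longrightarrow> d p \<noteq> 0" "\<And>p. p \<in> V \<Longrightarrow> g p ^ N = d p * e p"
  shows "(\<lambda>p. 1 / d p) \<in> localised K g V"
  by (rule localisedI[of e _ _ _ N]) (use assms in auto)

section \<open>Polynomial functions and the evaluation of nested polynomials\<close>

lemma function_ring_polynomial_functions: "function_ring polynomial_functions"
  by (intro function_ringI polynomial_functions.intros)

lemma polynomial_functions_comp:
  fixes G :: "'a \<Rightarrow> complex ^ 'n"
  assumes "function_ring K" "\<And>i. (\<lambda>p. G p $ i) \<in> K" "f \<in> polynomial_functions"
  shows "(\<lambda>p. f (G p)) \<in> K"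
  using assms(3) by induction (auto intro: assms function_ring_intros)

text \<open>The innermost variable is \<open>x\<close> and the outermost the last one. In
  \<open>ev3\<close> the main variable is therefore \<open>z\<close>, with respect to which the
  equation of the surface is monic.\<close>

definition ev2 :: "complex poly poly \<Rightarrow> complex \<Rightarrow> complex \<Rightarrow> complex" where
  "ev2 P x y = poly (poly P [:y:]) x"

definition ev3 :: "complex poly poly poly \<Rightarrow> complex \<Rightarrow> complex \<Rightarrow> complex \<Rightarrow> complex" where
  "ev3 P x y z = ev2 (poly P [:[:z:]:]) x y"

lemma ev2_simps [simp]:
  "ev2 0 x y = 0" "ev2 1 x y = 1" "ev2 (P + Q) x y = ev2 P x y + ev2 Q x y"
  "ev2 (P - Q) x y = ev2 P x y - ev2 Q x y" "ev2 (- P) x y = - ev2 P x y"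
  "ev2 (P * Q) x y = ev2 P x y * ev2 Q x y" "ev2 (P ^ k) x y = ev2 P x y ^ k"
  "ev2 (pCons q P) x y = poly q x + y * ev2 P x y" "ev2 (monom q k) x y = poly q x * y ^ k"
  "ev2 (smult q P) x y = poly q x * ev2 P x y"
  by (simp_all add: ev2_def poly_monom flip: poly_const_pow)

lemma ev3_simps [simp]:
  "ev3 0 x y z = 0" "ev3 1 x y z = 1" "ev3 (P + Q) x y z = ev3 P x y z + ev3 Q x y z"
  "ev3 (P - Q) x y z = ev3 P x y z - ev3 Q x y z" "ev3 (- P) x y z = - ev3 P x y z"
  "ev3 (P * Q) x y z = ev3 P x y z * ev3 Q x y z" "ev3 (P ^ k) x y z = ev3 P x y z ^ k"
  "ev3 (pCons q P) x y z = ev2 q x y + z * ev3 P x y z" "ev3 (monom q k) x y z = ev2 q x y * z ^ k"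
  "ev3 (smult q P) x y z = ev2 q x y * ev3 P x y z"
  by (simp_all add: ev3_def poly_monom flip: poly_const_pow)

lemma ev2_altdef: "ev2 P x y = poly (map_poly (\<lambda>q. poly q x) P) y"
  by (induction P) (simp_all add: map_poly_pCons)

lemma ev3_altdef: "ev3 P x y z = poly (map_poly (\<lambda>q. ev2 q x y) P) z"
  by (induction P) (simp_all add: map_poly_pCons)

lemma poly_zero_infinite:
  fixes p :: "complex poly"
  assumes "infinite A" "\<And>x. x \<in> A \<Longrightarrow> poly p x = 0"
  shows "p = 0"
  using assms by (metis (mono_tags, lifting) infinite_super mem_Collect_eq poly_roots_finite subsetI)

lemma ev2_zero_fiber:
  assumes "infinite B" "\<And>y. y \<in> B \<Longrightarrow> ev2 P x y = 0"
  shows "poly (coeff P k) x = 0"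
proof -
  have "map_poly (\<lambda>q. poly q x) P = 0"
    by (rule poly_zero_infinite[OF assms(1)]) (use assms(2) in \<open>simp add: ev2_altdef\<close>)
  then show ?thesis by (metis coeff_0 coeff_map_poly poly_0)
qed

lemma ev2_zero:
  assumes "infinite A" "\<And>x. x \<in> A \<Longrightarrow> infinite (B x)" "\<And>x y. x \<in> A \<Longrightarrow> y \<in> B x \<Longrightarrow> ev2 P x y = 0"
  shows "P = 0"
proof (rule poly_eqI)
  fix k
  have "poly (coeff P k) x = 0" if "x \<in> A" for x
    using ev2_zero_fiber[of "B x" P x] assms that by blast
  then show "coeff P k = coeff 0 k" using poly_zero_infinite[OF assms(1)] by simp
qed

text \<open>For fixed \<open>x\<close> and \<open>y\<close> this is a polynomial in \<open>z\<close>
  of degree below \<open>c\<close> that vanishes at all \<open>c\<close> distinct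
  \<open>c\<close>-th roots of \<open>w\<close>.\<close>

lemma ev3_zero_root:
  assumes "\<And>k. k \<ge> c \<Longrightarrow> coeff P k = 0" "0 < c" "w \<noteq> 0" "\<And>z. z ^ c = w \<Longrightarrow> ev3 P x y z = 0"
  shows "ev2 (coeff P k) x y = 0"
proof -
  let ?p = "map_poly (\<lambda>q. ev2 q x y) P"
  have "?p = 0"
  proof (rule ccontr)
    assume nz: "?p \<noteq> 0"
    have "coeff ?p k = 0" if "k \<ge> c" for k using assms(1)[OF that] by (simp add: coeff_map_poly)
    then have "degree ?p < c" using nz by (metis leading_coeff_neq_0 not_le)
    moreover have "{z. z ^ c = w} \<subseteq> {z. poly ?p z = 0}" using assms(4) by (auto simp: ev3_altdef)
    then have "card {z. z ^ c = w} \<le> card {z. poly ?p z = 0}"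
      by (intro card_mono poly_roots_finite nz)
    moreover have "card {z. poly ?p z = 0} \<le> degree ?p" using nz by (rule card_poly_roots_bound)
    ultimately show False using card_nth_roots[of w c] assms(2,3) by simp
  qed
  then show ?thesis by (metis coeff_0 coeff_map_poly ev2_simps(1))
qed

definition pol3 :: "(complex \<times> complex \<times> complex \<Rightarrow> complex) set" where
  "pol3 = range (\<lambda>P (x, y, z). ev3 P x y z)"

lemma pol3I: "(\<And>x y z. f (x, y, z) = ev3 P x y z) \<Longrightarrow> f \<in> pol3"
  unfolding pol3_def by (intro image_eqI[of _ _ P]) auto

lemma pol3E:
  assumes "f \<in> pol3" obtains P where "\<And>x y z. f (x, y, z) = ev3 P x y z"
  using assms unfolding pol3_def by auto

lemma function_ring_pol3: "function_ring pol3"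
proof (rule function_ringI)
  show "(\<lambda>p. k) \<in> pol3" for k by (rule pol3I[of _ "[:[:[:k:]:]:]"]) simp
  fix f g assume fg: "f \<in> pol3" "g \<in> pol3"
  obtain P where "\<And>x y z. f (x, y, z) = ev3 P x y z" using pol3E[OF fg(1)] by blast
  moreover obtain Q where "\<And>x y z. g (x, y, z) = ev3 Q x y z" using pol3E[OF fg(2)] by blast
  ultimately show "(\<lambda>p. f p + g p) \<in> pol3" "(\<lambda>p. f p * g p) \<in> pol3"
    by - (rule pol3I[of _ "P + Q"], simp, rule pol3I[of _ "P * Q"], simp)
qed

lemma pol3_fst: "fst \<in> pol3" and pol3_snd: "(\<lambda>p. fst (snd p)) \<in> pol3" and pol3_thd: "(\<lambda>p. snd (snd p)) \<in> pol3"
  by (rule pol3I[of _ "[:[:[:0, 1:]:]:]"], simp) (rule pol3I[of _ "[:[:0, 1:]:]"], simp,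
    rule pol3I[of _ "[:0, 1:]"], simp)

lemmas pol3_intros = pol3_fst pol3_snd pol3_thd function_ring_intros[OF function_ring_pol3]

lemma poly_comp:
  assumes "function_ring K" "X \<in> K" shows "(\<lambda>p. poly q (X p)) \<in> K"
  using assms by (induction q) (auto intro!: function_ring_intros)

lemma ev2_comp:
  assumes "function_ring K" "X \<in> K" "Y \<in> K" shows "(\<lambda>p. ev2 q (X p) (Y p)) \<in> K"
  using assms by (induction q) (auto intro!: function_ring_intros poly_comp)

lemma ev3_comp:
  assumes "function_ring K" "X \<in> K" "Y \<in> K" "Z \<in> K" shows "(\<lambda>p. ev3 q (X p) (Y p) (Z p)) \<in> K"
  using assms by (induction q) (auto intro!: function_ring_intros ev2_comp)

lemma pol3_comp:
  assumes "function_ring K" "X \<in> K" "Y \<in> K" "Z \<in> K" "f \<in> pol3"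
  shows "(\<lambda>p. f (X p, Y p, Z p)) \<in> K"
proof -
  obtain P where "\<And>x y z. f (x, y, z) = ev3 P x y z" using pol3E[OF assms(5)] by blast
  then show ?thesis using ev3_comp[OF assms(1-4)] by simp
qed

section \<open>Normal forms on the Brieskorn--Pham surface\<close>

definition bp_surface :: "nat \<Rightarrow> nat \<Rightarrow> nat \<Rightarrow> (complex \<times> complex \<times> complex) set" where
  "bp_surface a b c = {(x, y, z). x ^ a + y ^ b + z ^ c = 0}"

text \<open>The divisor \<open>M\<close> is monic in \<open>z\<close>, so pseudo-division by it is
  true division with remainder.\<close>

lemma bp_reduce:
  assumes "f \<in> pol3" "0 < c"
  obtains P where "\<And>k. k \<ge> c \<Longrightarrow> coeff P k = 0"
    "\<And>x y z. (x, y, z) \<in> bp_surface a b c \<Longrightarrow> f (x, y, z) = ev3 P x y z"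
proof -
  obtain P where P: "\<And>x y z. f (x, y, z) = ev3 P x y z" using pol3E[OF assms(1)] by blast
  define M :: "complex poly poly poly" where "M = monom 1 c + [:[:monom 1 a:] + monom 1 b:]"
  have deg: "degree M = c" unfolding M_def
    using assms(2) by (subst degree_add_eq_left) (simp_all add: degree_monom_eq)
  have lc: "lead_coeff M = 1"
    unfolding deg using assms(2) by (simp add: M_def coeff_pCons split: nat.split)
  then have "M \<noteq> 0" by auto
  obtain q r where qr: "pseudo_divmod P M = (q, r)" by fastforce
  have q: "P = M * q + r" "r = 0 \<or> degree r < c"
    using pseudo_divmod[OF \<open>M \<noteq> 0\<close> qr] lc deg by auto
  have "coeff r k = 0" if "k \<ge> c" for k
    using that q(2) by (auto intro: coeff_eq_0)
  moreover have "f (x, y, z) = ev3 r x y z" if "(x, y, z) \<in> bp_surface a b c" for x y z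
  proof -
    have "ev3 M x y z = 0" using that by (simp add: M_def bp_surface_def poly_monom algebra_simps)
    then show ?thesis unfolding P by (simp add: q(1))
  qed
  ultimately show ?thesis using that by blast
qed

lemma infinite_power_neq:
  assumes "0 < b" shows "infinite {y :: complex. y \<noteq> 0 \<and> w + y ^ b \<noteq> 0}"
proof -
  have "coeff ([:w:] + monom 1 b) b = 1" using assms by (cases b) auto
  then have "[:w:] + monom 1 b \<noteq> 0" by (metis coeff_0 zero_neq_one)
  then have "finite {y. poly ([:w:] + monom 1 b) y = 0}" by (rule poly_roots_finite)
  then have "finite ({0} \<union> {y :: complex. w + y ^ b = 0})" by (simp add: poly_monom)
  moreover have "{y :: complex. y \<noteq> 0 \<and> w + y ^ b \<noteq> 0} = UNIV - ({0} \<union> {y :: complex. w + y ^ b = 0})" by auto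
  ultimately show ?thesis by (simp add: infinite_UNIV_char_0 Diff_infinite_finite)
qed

lemma infinite_nonzero_complex: "infinite {x :: complex. x \<noteq> 0}"
  using infinite_power_neq[of 1 0] by (auto elim: rev_finite_subset)

text \<open>Uniqueness of the normal form, tested only where no coordinate vanishes: for most
  \<open>(x, y)\<close> there are \<open>c\<close> points above, all with \<open>z\<close> nonzero,
  and \<open>ev3_zero_root\<close> kills every coefficient.\<close>

lemma bp_reduced_zero:
  assumes "0 < b" "0 < c" "\<And>k. k \<ge> c \<Longrightarrow> coeff P k = 0"
    "\<And>x y z. (x, y, z) \<in> bp_surface a b c \<Longrightarrow> x \<noteq> 0 \<Longrightarrow> y \<noteq> 0 \<Longrightarrow> z \<noteq> 0 \<Longrightarrow> ev3 P x y z = 0"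
  shows "P = 0"
proof (rule poly_eqI)
  fix k
  have "ev2 (coeff P k) x y = 0" if xy: "x \<noteq> 0" "y \<noteq> 0" "x ^ a + y ^ b \<noteq> 0" for x y
  proof (rule ev3_zero_root[of c P "- (x ^ a + y ^ b)"])
    fix z assume z: "z ^ c = - (x ^ a + y ^ b)"
    then have "z \<noteq> 0" using xy(3) assms(2) by (metis neg_equal_0_iff_equal zero_power)
    then show "ev3 P x y z = 0" using z xy by (intro assms(4)) (auto simp: bp_surface_def)
  qed (use assms xy in \<open>auto simp only: neg_equal_0_iff_equal\<close>)
  then show "coeff P k = coeff 0 k"
    using ev2_zero[of "{x. x \<noteq> 0}" "\<lambda>x. {y. y \<noteq> 0 \<and> x ^ a + y ^ b \<noteq> 0}" "coeff P k"]
      infinite_nonzero_complex infinite_power_neq[OF assms(1)] by simp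
qed

text \<open>Density of the locus without vanishing coordinates; it will be lifted to the threefold
  through the charts.\<close>

lemma bp_dense:
  assumes "0 < b" "0 < c" "f \<in> pol3"
    "\<And>x y z. (x, y, z) \<in> bp_surface a b c \<Longrightarrow> x \<noteq> 0 \<Longrightarrow> y \<noteq> 0 \<Longrightarrow> z \<noteq> 0 \<Longrightarrow> f (x, y, z) = 0"
    "p \<in> bp_surface a b c"
  shows "f p = 0"
proof -
  obtain P where P: "\<And>k. k \<ge> c \<Longrightarrow> coeff P k = 0"
    "\<And>x y z. (x, y, z) \<in> bp_surface a b c \<Longrightarrow> f (x, y, z) = ev3 P x y z"
    using bp_reduce[OF assms(3,2)] by blast
  have "P = 0" using assms P by (intro bp_reduced_zero[of b c P a]) auto
  then show ?thesis using P(2) assms(5) by (cases p) auto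
qed

lemma poly_shift_monom_mult:
  assumes "\<And>j. j < N \<Longrightarrow> coeff p j = 0"
  shows "p = monom (1 :: 'a :: comm_semiring_1) N * poly_shift N p"
proof (rule poly_eqI)
  fix j show "coeff p j = coeff (monom 1 N * poly_shift N p) j"
    using assms[of j] by (auto simp: coeff_monom_mult coeff_poly_shift)
qed

text \<open>Setting \<open>x = 0\<close> keeps the normal form reduced, now relative to
  \<open>z^c + y^b\<close>. Its coefficients therefore vanish at \<open>x = 0\<close>, and
  \<open>x\<close> can be divided out of each of them. This is the statement that \<open>x\<close>
  generates the full ideal of the curve it cuts out.\<close>

lemma bp_divide_coordinate:
  assumes "0 < b" "0 < c" "f \<in> pol3"
    "\<And>y z. (0, y, z) \<in> bp_surface a b c \<Longrightarrow> y \<noteq> 0 \<Longrightarrow> f (0, y, z) = 0" "0 < a"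
  obtains g where "g \<in> pol3" "\<And>x y z. (x, y, z) \<in> bp_surface a b c \<Longrightarrow> f (x, y, z) = x * g (x, y, z)"
proof -
  obtain P where P: "\<And>k. k \<ge> c \<Longrightarrow> coeff P k = 0"
    "\<And>x y z. (x, y, z) \<in> bp_surface a b c \<Longrightarrow> f (x, y, z) = ev3 P x y z"
    using bp_reduce[OF assms(3,2)] by blast
  define Q where "Q = map_poly (map_poly (poly_shift 1)) P"
  have "ev2 (coeff P k) 0 y = 0" if "y \<noteq> 0" for y k
  proof (rule ev3_zero_root[of c P "- (y ^ b)"])
    fix z assume "z ^ c = - (y ^ b)"
    then have "(0, y, z) \<in> bp_surface a b c" using assms(5) by (simp add: bp_surface_def)
    then show "ev3 P 0 y z = 0" using P(2) assms(4) that by metis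
  qed (use P assms that in auto)
  then have "poly (coeff (coeff P k) j) 0 = 0" for k j
    using ev2_zero_fiber[of "{y. y \<noteq> 0}" "coeff P k" 0 j] infinite_nonzero_complex by simp
  then have *: "coeff (coeff P k) j = monom 1 1 * poly_shift 1 (coeff (coeff P k) j)" for k j
    by - (rule poly_shift_monom_mult, auto simp: poly_0_coeff_0)
  have "P = smult [:monom 1 1:] Q"
  proof (rule poly_eqI, rule poly_eqI)
    fix k j
    have "coeff (coeff (smult [:monom 1 1:] Q) k) j = monom 1 1 * poly_shift 1 (coeff (coeff P k) j)"
      by (simp add: Q_def coeff_map_poly)
    then show "coeff (coeff P k) j = coeff (coeff (smult [:monom 1 1:] Q) k) j"
      by (rule trans[OF * sym])
  qed
  then have "ev3 P x y z = x * ev3 Q x y z" for x y z by (simp add: poly_monom)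
  then show ?thesis using P(2) by (intro that[of "\<lambda>(x, y, z). ev3 Q x y z"]) (auto intro: pol3I)
qed

text \<open>Multiplication by a polynomial in \<open>x\<close> and \<open>y\<close> alone preserves
  reducedness, so a linear relation with such coefficients lifts from functions to their normal
  forms.\<close>

lemma bp_reduced_eq:
  assumes "0 < b" "0 < c" "f \<in> pol3" "g \<in> pol3"
    "\<And>x y z. (x, y, z) \<in> bp_surface a b c \<Longrightarrow> x \<noteq> 0 \<Longrightarrow> y \<noteq> 0 \<Longrightarrow> z \<noteq> 0 \<Longrightarrow>
      ev2 p x y * f (x, y, z) - ev2 q x y * g (x, y, z) = ev2 r x y"
  obtains P Q where "\<And>x y z. (x, y, z) \<in> bp_surface a b c \<Longrightarrow> f (x, y, z) = ev3 P x y z"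
    "\<And>x y z. (x, y, z) \<in> bp_surface a b c \<Longrightarrow> g (x, y, z) = ev3 Q x y z"
    "smult p P - smult q Q = [:r:]"
proof -
  obtain P where P: "\<And>k. k \<ge> c \<Longrightarrow> coeff P k = 0"
    "\<And>x y z. (x, y, z) \<in> bp_surface a b c \<Longrightarrow> f (x, y, z) = ev3 P x y z"
    using bp_reduce[OF assms(3,2)] by blast
  obtain Q where Q: "\<And>k. k \<ge> c \<Longrightarrow> coeff Q k = 0"
    "\<And>x y z. (x, y, z) \<in> bp_surface a b c \<Longrightarrow> g (x, y, z) = ev3 Q x y z"
    using bp_reduce[OF assms(4,2)] by blast
  have "smult p P - smult q Q - [:r:] = 0"
  proof (rule bp_reduced_zero[OF assms(1,2)])
    show "coeff (smult p P - smult q Q - [:r:]) k = 0" if "c \<le> k" for k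
      using P(1) Q(1) that assms(2) by (cases k) auto
    show "ev3 (smult p P - smult q Q - [:r:]) x y z = 0"
      if "(x, y, z) \<in> bp_surface a b c" "x \<noteq> 0" "y \<noteq> 0" "z \<noteq> 0" for x y z
      using assms(5)[OF that] P(2)[OF that(1)] Q(2)[OF that(1)] by simp
  qed
  then show ?thesis using that P(2) Q(2) by auto
qed

text \<open>The regular sequence \<open>x^N, y^N\<close> in action: \<open>f / x^N\<close> and
  \<open>g / y^N\<close> agree where both are defined, and the function they glue to extends over
  the singular point.\<close>

lemma bp_saturated:
  assumes "0 < b" "0 < c" "f \<in> pol3" "g \<in> pol3"
    "\<And>x y z. (x, y, z) \<in> bp_surface a b c \<Longrightarrow> x \<noteq> 0 \<Longrightarrow> y \<noteq> 0 \<Longrightarrow> z \<noteq> 0 \<Longrightarrow> y ^ N * f (x, y, z) = x ^ N * g (x, y, z)"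
  obtains h where "h \<in> pol3" "\<And>x y z. (x, y, z) \<in> bp_surface a b c \<Longrightarrow> f (x, y, z) = x ^ N * h (x, y, z)"
    "\<And>x y z. (x, y, z) \<in> bp_surface a b c \<Longrightarrow> g (x, y, z) = y ^ N * h (x, y, z)"
proof -
  obtain P Q where PQ: "\<And>x y z. (x, y, z) \<in> bp_surface a b c \<Longrightarrow> f (x, y, z) = ev3 P x y z"
    "\<And>x y z. (x, y, z) \<in> bp_surface a b c \<Longrightarrow> g (x, y, z) = ev3 Q x y z"
    "smult (monom 1 N) P - smult [:monom 1 N:] Q = [:0:]"
    by (rule bp_reduced_eq[OF assms(1-4), of a "monom 1 N" "[:monom 1 N:]" 0])
      (use assms(5) in \<open>simp_all add: poly_monom\<close>)
  define R where "R = map_poly (poly_shift N) Q"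
  have eq: "monom 1 N * coeff P k = smult (monom 1 N) (coeff Q k)" for k
    using arg_cong[OF PQ(3), of "\<lambda>p. coeff p k"] by simp
  have eq': "(if j < N then 0 else coeff (coeff P k) (j - N)) = monom 1 N * coeff (coeff Q k) j" for k j
    using arg_cong[OF eq[of k], of "\<lambda>p. coeff p j"] by (simp add: coeff_monom_mult not_less split: if_splits)
  \<comment> \<open>In \<open>y^N P = x^N Q\<close> the left side has no terms below
    \<open>y^N\<close>, so \<open>Q\<close> has none either. Dividing \<open>Q\<close> by
    \<open>y^N\<close> gives the common quotient \<open>R\<close>.\<close>
  have 0: "coeff (coeff Q k) j = 0" if "j < N" for k j using eq'[of j k] that by simp
  have "Q = smult (monom 1 N) R"
  proof (rule poly_eqI)
    fix k
    have "coeff (smult (monom 1 N) R) k = monom 1 N * poly_shift N (coeff Q k)"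
      by (simp add: R_def coeff_map_poly)
    then show "coeff Q k = coeff (smult (monom 1 N) R) k"
      by (metis 0 poly_shift_monom_mult)
  qed
  moreover have "P = smult [:monom 1 N:] R"
  proof (rule poly_eqI, rule poly_eqI)
    fix k j
    have "coeff (coeff P k) j = monom 1 N * coeff (coeff Q k) (j + N)" using eq'[of "j + N" k] by simp
    then show "coeff (coeff P k) j = coeff (coeff (smult [:monom 1 N:] R) k) j"
      by (simp add: R_def coeff_map_poly coeff_poly_shift)
  qed
  ultimately show ?thesis using PQ(1,2)
    by (intro that[of "\<lambda>(x, y, z). ev3 R x y z"]) (auto intro: pol3I simp: poly_monom)
qed

text \<open>In the normal form of the left side, every monomial is divisible by \<open>x^N\<close>
  or by \<open>y^N\<close>, which \<open>x^i y^j\<close> is not. This is the source of nontriviality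
  of the bundle.\<close>

lemma bp_monomial_not_in:
  assumes "0 < b" "0 < c" "f \<in> pol3" "g \<in> pol3" "i < N" "j < N"
    "\<And>x y z. (x, y, z) \<in> bp_surface a b c \<Longrightarrow> x \<noteq> 0 \<Longrightarrow> y \<noteq> 0 \<Longrightarrow> z \<noteq> 0 \<Longrightarrow>
      y ^ N * f (x, y, z) - x ^ N * g (x, y, z) = k * x ^ i * y ^ j"
  shows "k = 0"
proof -
  obtain P Q where PQ: "smult (monom 1 N) P - smult [:monom 1 N:] Q = [:monom (monom k i) j:]"
    by (rule bp_reduced_eq[OF assms(1-4), of a "monom 1 N" "[:monom 1 N:]" "monom (monom k i) j"])
      (use assms(7) in \<open>simp_all add: poly_monom\<close>)
  have "coeff (coeff (coeff (smult (monom 1 N) P - smult [:monom 1 N:] Q) 0) j) i = k"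
    unfolding PQ by simp
  then show ?thesis using assms(5,6) by (simp add: coeff_monom_mult)
qed

text \<open>Taking \<open>k = j + 1\<close> shows that the normal form has no term in
  \<open>y^j\<close>. The factor \<open>x^N\<close> accommodates the denominators of a chart and is
  harmless, as it only shifts exponents of \<open>x\<close>.\<close>

lemma bp_infinitely_divisible:
  assumes "0 < b" "0 < c" "f \<in> pol3"
    "\<And>k. \<exists>N. \<exists>g\<in>pol3. \<forall>x y z. (x, y, z) \<in> bp_surface a b c \<longrightarrow> x \<noteq> 0 \<longrightarrow> y \<noteq> 0 \<longrightarrow> z \<noteq> 0 \<longrightarrow>
      x ^ N * f (x, y, z) = y ^ k * g (x, y, z)"
    "p \<in> bp_surface a b c"
  shows "f p = 0"
proof -
  obtain P where P: "\<And>k. k \<ge> c \<Longrightarrow> coeff P k = 0"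
    "\<And>x y z. (x, y, z) \<in> bp_surface a b c \<Longrightarrow> f (x, y, z) = ev3 P x y z"
    using bp_reduce[OF assms(3,2)] by blast
  have "coeff (coeff P i) j = 0" for i j
  proof -
    obtain N g where g: "g \<in> pol3" "\<And>x y z. (x, y, z) \<in> bp_surface a b c \<Longrightarrow> x \<noteq> 0 \<Longrightarrow> y \<noteq> 0 \<Longrightarrow> z \<noteq> 0 \<Longrightarrow>
        x ^ N * f (x, y, z) = y ^ Suc j * g (x, y, z)"
      using assms(4)[of "Suc j"] by blast
    obtain Q where Q: "\<And>k. k \<ge> c \<Longrightarrow> coeff Q k = 0"
      "\<And>x y z. (x, y, z) \<in> bp_surface a b c \<Longrightarrow> g (x, y, z) = ev3 Q x y z"
      using bp_reduce[OF g(1) assms(2)] by blast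
    have "smult [:monom 1 N:] P - smult (monom 1 (Suc j)) Q = 0"
      using P Q g(2) by (intro bp_reduced_zero[OF assms(1,2), of _ a]) (auto simp: poly_monom)
    then have "coeff (coeff (smult [:monom 1 N:] P - smult (monom 1 (Suc j)) Q) i) j = 0" by simp
    then show ?thesis by (simp add: coeff_monom_mult)
  qed
  then have "P = 0" by (simp add: poly_eq_iff)
  then show ?thesis using P(2) assms(5) by (cases p) auto
qed

section \<open>Charts of the threefold\<close>

text \<open>A polynomial in the fibre coordinate \<open>t\<close> whose coefficients are polynomial
  functions on the base, that is, a function on a trivialised piece of the bundle.\<close>

definition ev4 :: "complex poly poly poly poly \<Rightarrow> complex \<times> complex \<times> complex \<Rightarrow> complex \<Rightarrow> complex" where
  "ev4 P q t = (case q of (x, y, z) \<Rightarrow> ev3 (poly P [:[:[:t:]:]:]) x y z)"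

lemma ev4_simps [simp]:
  "ev4 0 q t = 0" "ev4 (P + Q) q t = ev4 P q t + ev4 Q q t" "ev4 (P * Q) q t = ev4 P q t * ev4 Q q t"
  "ev4 (pCons r P) q t = ev3 r (fst q) (fst (snd q)) (snd (snd q)) + t * ev4 P q t"
  by (simp_all add: ev4_def split: prod.split)

lemma ev4_altdef: "ev4 P q t = poly (map_poly (\<lambda>r. ev3 r (fst q) (fst (snd q)) (snd (snd q))) P) t"
  by (induction P) (simp_all add: map_poly_pCons)

lemma ev4_sum:
  "ev4 P q t = (\<Sum>i\<le>degree P. ev3 (coeff P i) (fst q) (fst (snd q)) (snd (snd q)) * t ^ i)"
proof -
  let ?f = "\<lambda>r. ev3 r (fst q) (fst (snd q)) (snd (snd q))"
  have "(\<Sum>i\<le>degree (map_poly ?f P). coeff (map_poly ?f P) i * t ^ i) = (\<Sum>i\<le>degree P. coeff (map_poly ?f P) i * t ^ i)"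
    by (rule sum.mono_neutral_left) (auto intro: coeff_eq_0 order_trans[OF _ map_poly_degree_leq])
  then show ?thesis by (simp add: ev4_altdef poly_altdef coeff_map_poly)
qed

lemma ev4_coeff_zero:
  assumes "\<And>t. ev4 P q t = 0" shows "ev3 (coeff P i) (fst q) (fst (snd q)) (snd (snd q)) = 0"
proof -
  have "map_poly (\<lambda>r. ev3 r (fst q) (fst (snd q)) (snd (snd q))) P = 0"
    using assms by (simp add: ev4_altdef flip: poly_all_0_iff_0)
  then show ?thesis by (metis coeff_0 coeff_map_poly ev3_simps(1))
qed

lemma ev4_comp:
  assumes "function_ring K" "\<And>f. f \<in> pol3 \<Longrightarrow> (\<lambda>p. f (Q p)) \<in> K" "T \<in> K"
  shows "(\<lambda>p. ev4 P (Q p) (T p)) \<in> K"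
proof (induction P)
  case (pCons r P)
  have "(\<lambda>q. ev3 r (fst q) (fst (snd q)) (snd (snd q))) \<in> pol3" by (rule pol3I[of _ r]) simp
  then show ?case using pCons assms by (auto intro!: function_ring_intros)
qed (auto intro: function_ring_intros assms)

lemma function_ring_ev4: "function_ring (range (\<lambda>P (q, t). ev4 P q t))"
proof (rule function_ringI)
  show "(\<lambda>p. k) \<in> range (\<lambda>P (q, t). ev4 P q t)" for k
    by (rule range_eqI[of _ _ "[:[:[:[:k:]:]:]:]"]) auto
  fix f g assume "f \<in> range (\<lambda>P (q, t). ev4 P q t)" "g \<in> range (\<lambda>P (q, t). ev4 P q t)"
  then obtain P Q where f: "f = (\<lambda>(q, t). ev4 P q t)" and g: "g = (\<lambda>(q, t). ev4 Q q t)" by blast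
  show "(\<lambda>p. f p + g p) \<in> range (\<lambda>P (q, t). ev4 P q t)"
    unfolding f g by (rule range_eqI[of _ _ "P + Q"]) auto
  show "(\<lambda>p. f p * g p) \<in> range (\<lambda>P (q, t). ev4 P q t)"
    unfolding f g by (rule range_eqI[of _ _ "P * Q"]) auto
qed

lemma ev4_pol3: "f \<in> pol3 \<Longrightarrow> (\<lambda>(q, t). f q) \<in> range (\<lambda>P (q, t). ev4 P q t)"
  by (erule pol3E, rule_tac x = "[:P:]" in range_eqI) auto

lemma ev4_snd: "(\<lambda>(q, t). t) \<in> range (\<lambda>P (q, t). ev4 P q t)"
  by (rule range_eqI[of _ _ "[:0, 1:]"]) (auto simp: one_pCons)

text \<open>The last branch is component \<open>5\<close>, which is the element zero of the index
  type.\<close>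

definition mk5 :: "complex \<Rightarrow> complex \<Rightarrow> complex \<Rightarrow> complex \<Rightarrow> complex \<Rightarrow> complex ^ 5" where
  "mk5 x y z u v = (\<chi> i. if i = 1 then x else if i = 2 then y else if i = 3 then z else if i = 4 then u else v)"

lemma mk5_nth [simp]:
  "mk5 x y z u v $ 1 = x" "mk5 x y z u v $ 2 = y" "mk5 x y z u v $ 3 = z" "mk5 x y z u v $ 4 = u"
  "mk5 x y z u v $ 5 = v"
  by (simp_all add: mk5_def)

lemma exhaust_5: "(i :: 5) = 1 \<or> i = 2 \<or> i = 3 \<or> i = 4 \<or> i = 5"
proof (induct i)
  case (of_int z)
  then have "z = 0 \<or> z = 1 \<or> z = 2 \<or> z = 3 \<or> z = 4" by fastforce
  then show ?case by auto
qed

lemma mk5_eta [simp]: "mk5 (p $ 1) (p $ 2) (p $ 3) (p $ 4) (p $ 5) = p"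
proof (rule vec_eq_iff[THEN iffD2, rule_format])
  fix i show "mk5 (p $ 1) (p $ 2) (p $ 3) (p $ 4) (p $ 5) $ i = p $ i" using exhaust_5[of i] by auto
qed

abbreviation (input) PF5 :: "(complex ^ 5 \<Rightarrow> complex) set" where "PF5 \<equiv> polynomial_functions"

lemmas PF_intros = polynomial_functions.coord function_ring_intros[OF function_ring_polynomial_functions]

lemma mk5_comp:
  assumes "function_ring K" "X \<in> K" "Y \<in> K" "Z \<in> K" "U \<in> K" "V \<in> K" "f \<in> PF5"
  shows "(\<lambda>p. f (mk5 (X p) (Y p) (Z p) (U p) (V p))) \<in> K"
proof (rule polynomial_functions_comp[OF assms(1) _ assms(7)])
  show "(\<lambda>p. mk5 (X p) (Y p) (Z p) (U p) (V p) $ i) \<in> K" for i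
    using exhaust_5[of i] assms by auto
qed

definition proj3 :: "complex ^ 5 \<Rightarrow> complex \<times> complex \<times> complex" where
  "proj3 p = (p $ 1, p $ 2, p $ 3)"

lemma proj3_mk5 [simp]: "proj3 (mk5 x y z u v) = (x, y, z)"
  by (simp add: proj3_def)

lemma pol3_proj3: "f \<in> pol3 \<Longrightarrow> (\<lambda>p. f (proj3 p)) \<in> PF5"
  unfolding proj3_def by (intro pol3_comp PF_intros function_ring_polynomial_functions)

lemma X_variety_iff:
  "p \<in> X_variety a b c n m \<longleftrightarrow> proj3 p \<in> bp_surface a b c \<and> (p $ 1) ^ m * p $ 4 - (p $ 2) ^ n * p $ 5 = 1"
  by (auto simp: X_variety_def bp_surface_def proj3_def)

section \<open>Divisibility, primality and comaximality on a variety\<close>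

definition dvd_on :: "(complex ^ 'n) set \<Rightarrow> (complex ^ 'n \<Rightarrow> complex) \<Rightarrow> (complex ^ 'n \<Rightarrow> complex) \<Rightarrow> bool" where
  "dvd_on V f g \<longleftrightarrow> (\<exists>h\<in>polynomial_functions. \<forall>p\<in>V. g p = f p * h p)"

text \<open>Polynomial representatives on the ambient space are compared on \<open>V\<close> only.
  Ring elements proper are postponed to \<open>factorial_variety_if_prime_products\<close>.\<close>

definition prime_on :: "(complex ^ 'n) set \<Rightarrow> (complex ^ 'n \<Rightarrow> complex) \<Rightarrow> bool" where
  "prime_on V \<pi> \<longleftrightarrow> (\<forall>f\<in>polynomial_functions. \<forall>g\<in>polynomial_functions.
    dvd_on V \<pi> (\<lambda>p. f p * g p) \<longrightarrow> dvd_on V \<pi> f \<or> dvd_on V \<pi> g)"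

definition comaximal_on :: "(complex ^ 'n) set \<Rightarrow> (complex ^ 'n \<Rightarrow> complex) \<Rightarrow> (complex ^ 'n \<Rightarrow> complex) \<Rightarrow> bool" where
  "comaximal_on V f g \<longleftrightarrow> (\<exists>e\<in>polynomial_functions. \<exists>e'\<in>polynomial_functions. \<forall>p\<in>V. f p * e p + g p * e' p = 1)"

lemma comaximal_on_commute: "comaximal_on V f g \<Longrightarrow> comaximal_on V g f"
  unfolding comaximal_on_def by (metis add.commute)

lemma comaximal_on_power:
  assumes "f \<in> polynomial_functions" "g \<in> polynomial_functions" "comaximal_on V f g"
  shows "comaximal_on V (\<lambda>p. f p ^ k) g"
proof (induction k)
  case 0
  have "(\<lambda>p. 1) \<in> polynomial_functions" "(\<lambda>p. 0) \<in> polynomial_functions" by (intro PF_intros)+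
  then show ?case unfolding comaximal_on_def by force
next
  case (Suc k)
  obtain d d' where d: "d \<in> polynomial_functions" "d' \<in> polynomial_functions"
      "\<And>p. p \<in> V \<Longrightarrow> f p ^ k * d p + g p * d' p = 1"
    using Suc unfolding comaximal_on_def by blast
  obtain e e' where e: "e \<in> polynomial_functions" "e' \<in> polynomial_functions"
      "\<And>p. p \<in> V \<Longrightarrow> f p * e p + g p * e' p = 1"
    using assms(3) unfolding comaximal_on_def by blast
  \<comment> \<open>The new coefficients come from expanding the product of the two Bezout
    identities and collecting the multiples of \<open>f^(k+1)\<close> and of
    \<open>g\<close>.\<close>
  have "(\<lambda>p. d p * e p) \<in> polynomial_functions"
    "(\<lambda>p. f p ^ k * d p * e' p + d' p * (f p * e p + g p * e' p)) \<in> polynomial_functions"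
    by (intro PF_intros assms d(1,2) e(1,2))+
  moreover have "f p ^ Suc k * (d p * e p) + g p * (f p ^ k * d p * e' p + d' p * (f p * e p + g p * e' p)) = 1"
    if "p \<in> V" for p
  proof -
    have "(f p ^ k * d p + g p * d' p) * (f p * e p + g p * e' p) = 1" using d(3) e(3) that by simp
    then show ?thesis by (simp add: algebra_simps)
  qed
  ultimately show ?case unfolding comaximal_on_def by (intro bexI ballI)
qed

lemma comaximal_on_powers:
  assumes "f \<in> polynomial_functions" "g \<in> polynomial_functions" "comaximal_on V f g"
  shows "comaximal_on V (\<lambda>p. f p ^ k) (\<lambda>p. g p ^ l)"
proof -
  have "(\<lambda>p. f p ^ k) \<in> polynomial_functions" by (intro PF_intros assms)
  moreover have "comaximal_on V g (\<lambda>p. f p ^ k)"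
    using comaximal_on_power[OF assms] by (rule comaximal_on_commute)
  ultimately show ?thesis
    using comaximal_on_power[OF assms(2)] comaximal_on_commute by blast
qed

text \<open>A trivialisation of the bundle over the open set \<open>\<eta> \<noteq> 0\<close>:
  \<open>ch\<close> is inverse to \<open>p \<mapsto> (proj3 p, p $ j)\<close>, and functions pulled
  back along it have powers of \<open>\<eta>\<close> as denominators. Keeping \<open>\<eta>\<close>
  abstract treats two charts at once: \<open>x \<noteq> 0\<close> with fibre coordinate
  \<open>v\<close>, and \<open>y \<noteq> 0\<close> with fibre coordinate \<open>u\<close>.\<close>

locale X_chart =
  fixes a b c n m :: nat and \<eta> :: "complex \<times> complex \<times> complex \<Rightarrow> complex"
    and j :: 5 and ch :: "complex \<times> complex \<times> complex \<Rightarrow> complex \<Rightarrow> complex ^ 5"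
  assumes \<eta>_pol3: "\<eta> \<in> pol3" and pos: "0 < b" "0 < c"
    and \<eta>_nonzero: "x \<noteq> 0 \<Longrightarrow> y \<noteq> 0 \<Longrightarrow> \<eta> (x, y, z) \<noteq> 0"
    and ch_exists: "f \<in> PF5 \<Longrightarrow> \<exists>N P. \<forall>q t. \<eta> q \<noteq> 0 \<longrightarrow> \<eta> q ^ N * f (ch q t) = ev4 P q t"
    and ch_surj: "p \<in> X_variety a b c n m \<Longrightarrow> \<eta> (proj3 p) \<noteq> 0 \<Longrightarrow> ch (proj3 p) (p $ j) = p"
    and ch_in: "q \<in> bp_surface a b c \<Longrightarrow> \<eta> q \<noteq> 0 \<Longrightarrow> ch q t \<in> X_variety a b c n m"
    and ch_proj: "\<eta> q \<noteq> 0 \<Longrightarrow> proj3 (ch q t) = q"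
begin

abbreviation X where "X \<equiv> X_variety a b c n m"
abbreviation S where "S \<equiv> bp_surface a b c"

lemma chE:
  assumes "f \<in> PF5"
  obtains N P where "\<And>q t. \<eta> q \<noteq> 0 \<Longrightarrow> \<eta> q ^ N * f (ch q t) = ev4 P q t"
  using ch_exists[OF assms] by blast

lemma proj_in: "p \<in> X \<Longrightarrow> proj3 p \<in> S"
  by (simp add: X_variety_iff)

lemma chart_dense:
  assumes "f \<in> PF5" "\<And>p. p \<in> X \<Longrightarrow> p $ 1 \<noteq> 0 \<Longrightarrow> p $ 2 \<noteq> 0 \<Longrightarrow> p $ 3 \<noteq> 0 \<Longrightarrow> f p = 0"
    "p \<in> X" "\<eta> (proj3 p) \<noteq> 0"
  shows "f p = 0"
proof -
  obtain N P where P: "\<And>q t. \<eta> q \<noteq> 0 \<Longrightarrow> \<eta> q ^ N * f (ch q t) = ev4 P q t" using chE[OF assms(1)] by blast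
  have "ev3 (coeff P i) x y z = 0" if "(x, y, z) \<in> S" "x \<noteq> 0" "y \<noteq> 0" "z \<noteq> 0" for x y z i
  proof -
    have "ev4 P (x, y, z) t = 0" for t
    proof -
      have "f (ch (x, y, z) t) = 0"
        using ch_in[OF that(1) \<eta>_nonzero[OF that(2,3)], of t] ch_proj[OF \<eta>_nonzero[OF that(2,3)], of z t] that
        by (intro assms(2)) (auto simp: proj3_def)
      then show ?thesis using P[OF \<eta>_nonzero[OF that(2,3)], of z t] by simp
    qed
    then show ?thesis using ev4_coeff_zero[of P "(x, y, z)" i] by simp
  qed
  then have "ev3 (coeff P i) (fst q) (fst (snd q)) (snd (snd q)) = 0" if "q \<in> S" for q i
    by - (rule bp_dense[of b c "\<lambda>q. ev3 (coeff P i) (fst q) (fst (snd q)) (snd (snd q))" a, OF pos _ _ that],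
      auto intro: pol3I[of _ "coeff P i"])
  then have "ev4 P (proj3 p) (p $ j) = 0" using proj_in[OF assms(3)] by (simp add: ev4_sum)
  then show ?thesis using P[OF assms(4), of "p $ j"] ch_surj[OF assms(3,4)] assms(4) by simp
qed

text \<open>On the chart, \<open>f\<close> is a polynomial in the fibre coordinate whose
  coefficients vanish where \<open>\<pi>\<close> does, so \<open>DIV\<close> divides each of them by
  \<open>\<pi>\<close>. The remaining power of \<open>\<eta>\<close> is removed by comaximality,
  which makes one chart sufficient for a global statement.\<close>

lemma chart_divide:
  assumes "f \<in> PF5" "\<pi> \<in> pol3"
    and DIV: "\<And>G. G \<in> pol3 \<Longrightarrow> (\<And>q. q \<in> S \<Longrightarrow> \<pi> q = 0 \<Longrightarrow> \<eta> q \<noteq> 0 \<Longrightarrow> G q = 0) \<Longrightarrow>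
      \<exists>H\<in>pol3. \<forall>q\<in>S. G q = \<pi> q * H q"
    and com: "comaximal_on X (\<lambda>p. \<eta> (proj3 p)) (\<lambda>p. \<pi> (proj3 p))"
    and van: "\<And>p. p \<in> X \<Longrightarrow> \<pi> (proj3 p) = 0 \<Longrightarrow> f p = 0"
  shows "dvd_on X (\<lambda>p. \<pi> (proj3 p)) f"
proof -
  obtain N P where P: "\<And>q t. \<eta> q \<noteq> 0 \<Longrightarrow> \<eta> q ^ N * f (ch q t) = ev4 P q t" using chE[OF assms(1)] by blast
  have "\<exists>H\<in>pol3. \<forall>q\<in>S. ev3 (coeff P i) (fst q) (fst (snd q)) (snd (snd q)) = \<pi> q * H q" for i
  proof (rule DIV)
    show "(\<lambda>q. ev3 (coeff P i) (fst q) (fst (snd q)) (snd (snd q))) \<in> pol3" by (rule pol3I[of _ "coeff P i"]) simp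
    fix q assume q: "q \<in> S" "\<pi> q = 0" "\<eta> q \<noteq> 0"
    have "ev4 P q t = 0" for t
      using P[OF q(3), of t] van[OF ch_in[OF q(1,3)], of t] q ch_proj by simp
    then show "ev3 (coeff P i) (fst q) (fst (snd q)) (snd (snd q)) = 0" by (rule ev4_coeff_zero)
  qed
  then obtain H where H: "\<And>i. H i \<in> pol3"
    "\<And>i q. q \<in> S \<Longrightarrow> ev3 (coeff P i) (fst q) (fst (snd q)) (snd (snd q)) = \<pi> q * H i q" by metis
  define h where "h p = (\<Sum>i\<le>degree P. H i (proj3 p) * (p $ j) ^ i)" for p
  have h: "h \<in> PF5" unfolding h_def by (intro PF_intros pol3_proj3 H(1))
  \<comment> \<open>The exponent is raised by one so that both sides vanish where
    \<open>\<eta>\<close> does; with \<open>N = 0\<close> the equation could fail there.\<close>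
  have eq: "\<eta> (proj3 p) ^ Suc N * f p = \<pi> (proj3 p) * (\<eta> (proj3 p) * h p)" if "p \<in> X" for p
  proof (cases "\<eta> (proj3 p) = 0")
    case False
    then have "\<eta> (proj3 p) ^ N * f p = ev4 P (proj3 p) (p $ j)"
      using P[OF False, of "p $ j"] ch_surj[OF that False] by simp
    also have "\<dots> = \<pi> (proj3 p) * h p"
      using proj_in[OF that] by (simp add: ev4_sum h_def H(2) sum_distrib_left mult.assoc)
    finally show ?thesis by simp
  qed simp
  obtain e e' where e: "e \<in> PF5" "e' \<in> PF5" "\<And>p. p \<in> X \<Longrightarrow> \<eta> (proj3 p) ^ Suc N * e p + \<pi> (proj3 p) * e' p = 1"
    using comaximal_on_power[OF pol3_proj3[OF \<eta>_pol3] pol3_proj3[OF assms(2)] com, of "Suc N"]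
    unfolding comaximal_on_def by blast
  \<comment> \<open>The quotient arises by multiplying the Bezout identity for
    \<open>\<eta>^(N+1)\<close> and \<open>\<pi>\<close> by \<open>f\<close>.\<close>
  have "f p = \<pi> (proj3 p) * (\<eta> (proj3 p) * h p * e p + e' p * f p)" if "p \<in> X" for p
  proof -
    have "f p = (\<eta> (proj3 p) ^ Suc N * e p + \<pi> (proj3 p) * e' p) * f p" using e(3)[OF that] by simp
    also have "\<dots> = (\<eta> (proj3 p) ^ Suc N * f p) * e p + \<pi> (proj3 p) * e' p * f p" by (simp add: algebra_simps)
    finally show ?thesis unfolding eq[OF that] by (simp add: algebra_simps)
  qed
  moreover have "(\<lambda>p. \<eta> (proj3 p) * h p * e p + e' p * f p) \<in> PF5"
    by (intro PF_intros pol3_proj3[OF \<eta>_pol3] h e(1,2) assms(1))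
  ultimately show ?thesis unfolding dvd_on_def by (intro bexI ballI)
qed

text \<open>The locus \<open>\<pi> = 0\<close> in the threefold is irreducible: it lies in the chart
  and is parametrised by \<open>s \<noteq> 0\<close> and the fibre coordinate \<open>t\<close>. Up
  to powers of \<open>\<eta>\<close>, both factors become polynomials in \<open>s\<close> and
  \<open>t\<close>, which form a domain.\<close>

lemma chart_vanish:
  assumes fg: "f \<in> PF5" "g \<in> PF5" "\<And>p. p \<in> X \<Longrightarrow> \<pi> (proj3 p) = 0 \<Longrightarrow> f p * g p = 0"
    and \<gamma>: "\<And>s. s \<noteq> 0 \<Longrightarrow> \<gamma> s \<in> S \<and> \<pi> (\<gamma> s) = 0 \<and> \<eta> (\<gamma> s) \<noteq> 0"
      "\<And>q. q \<in> S \<Longrightarrow> \<pi> q = 0 \<Longrightarrow> \<eta> q \<noteq> 0 \<Longrightarrow> \<exists>s. s \<noteq> 0 \<and> q = \<gamma> s"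
      "\<And>f. f \<in> pol3 \<Longrightarrow> \<exists>p. \<forall>s. f (\<gamma> s) = poly p s"
    and \<eta>0: "\<And>p. p \<in> X \<Longrightarrow> \<pi> (proj3 p) = 0 \<Longrightarrow> \<eta> (proj3 p) \<noteq> 0"
  shows "(\<forall>p\<in>X. \<pi> (proj3 p) = 0 \<longrightarrow> f p = 0) \<or> (\<forall>p\<in>X. \<pi> (proj3 p) = 0 \<longrightarrow> g p = 0)"
proof -
  have ex: "\<exists>P N. \<forall>s t. s \<noteq> 0 \<longrightarrow> \<eta> (\<gamma> s) ^ N * f (ch (\<gamma> s) t) = ev2 P s t" if f: "f \<in> PF5" for f
  proof -
    obtain N P where P: "\<And>q t. \<eta> q \<noteq> 0 \<Longrightarrow> \<eta> q ^ N * f (ch q t) = ev4 P q t" using chE[OF f] by blast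
    have "\<exists>Q. \<forall>s t. ev4 P (\<gamma> s) t = ev2 Q s t"
    proof (induction P)
      case 0
      show ?case by (rule exI[of _ 0]) simp
    next
      case (pCons r P)
      obtain Q where Q: "\<And>s t. ev4 P (\<gamma> s) t = ev2 Q s t" using pCons by blast
      have "(\<lambda>q. ev3 r (fst q) (fst (snd q)) (snd (snd q))) \<in> pol3" by (rule pol3I[of _ r]) simp
      then obtain p where "\<And>s. ev3 r (fst (\<gamma> s)) (fst (snd (\<gamma> s))) (snd (snd (\<gamma> s))) = poly p s"
        using \<gamma>(3) by blast
      then show ?case using Q by (intro exI[of _ "pCons p Q"]) simp
    qed
    then show ?thesis using P \<gamma>(1) by metis
  qed
  obtain P N where P: "\<And>s t. s \<noteq> 0 \<Longrightarrow> \<eta> (\<gamma> s) ^ N * f (ch (\<gamma> s) t) = ev2 P s t" using ex[OF fg(1)] by blast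
  obtain Q M where Q: "\<And>s t. s \<noteq> 0 \<Longrightarrow> \<eta> (\<gamma> s) ^ M * g (ch (\<gamma> s) t) = ev2 Q s t" using ex[OF fg(2)] by blast
  have "ev2 (P * Q) s t = 0" if "s \<noteq> 0" for s t
  proof -
    have "f (ch (\<gamma> s) t) * g (ch (\<gamma> s) t) = 0"
      using \<gamma>(1)[OF that] ch_in[of "\<gamma> s" t] ch_proj[of "\<gamma> s" t] by (intro fg(3)) auto
    then show ?thesis using P[OF that, of t] Q[OF that, of t] by auto
  qed
  then have "P * Q = 0"
    using ev2_zero[of "{s. s \<noteq> 0}" "\<lambda>_. UNIV" "P * Q"] infinite_nonzero_complex infinite_UNIV_char_0 by blast
  then have PQ: "P = 0 \<or> Q = 0" by simp
  have fin: "h p = 0" if h: "\<And>s t. s \<noteq> 0 \<Longrightarrow> \<eta> (\<gamma> s) ^ K * h (ch (\<gamma> s) t) = 0"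
    and p: "p \<in> X" "\<pi> (proj3 p) = 0" for h K p
  proof -
    obtain s where s: "s \<noteq> 0" "proj3 p = \<gamma> s" using \<gamma>(2)[OF proj_in] p \<eta>0 by blast
    have "\<eta> (\<gamma> s) ^ K * h p = 0"
      using h[OF s(1), of "p $ j"] ch_surj[OF p(1) \<eta>0[OF p]] s by simp
    then show ?thesis using \<gamma>(1)[OF s(1)] by simp
  qed
  show ?thesis using PQ fin[of N f] fin[of M g] P Q by auto
qed

text \<open>Freezing the fibre coordinate reduces divisibility by all powers of \<open>\<pi>\<close>
  on the threefold to the same question on the surface, up to powers of
  \<open>\<eta>\<close>.\<close>

lemma chart_infinitely_divisible:
  assumes f: "f \<in> PF5" "\<And>k. dvd_on X (\<lambda>p. \<pi> (proj3 p) ^ k) f"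
    and INF: "\<And>G. G \<in> pol3 \<Longrightarrow> (\<And>k. \<exists>N. \<exists>H\<in>pol3. \<forall>q\<in>S. \<eta> q \<noteq> 0 \<longrightarrow> \<eta> q ^ N * G q = \<pi> q ^ k * H q) \<Longrightarrow>
      \<forall>q\<in>S. G q = 0"
    and p: "p \<in> X" "\<eta> (proj3 p) \<noteq> 0"
  shows "f p = 0"
proof -
  obtain N P where P: "\<And>q t. \<eta> q \<noteq> 0 \<Longrightarrow> \<eta> q ^ N * f (ch q t) = ev4 P q t" using chE[OF f(1)] by blast
  have pol: "(\<lambda>q. ev4 Q q t) \<in> pol3" for Q t
    by (rule ev4_comp) (auto intro: pol3_intros function_ring_pol3)
  have "\<forall>q\<in>S. ev4 P q (p $ j) = 0"
  proof (rule INF[OF pol])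
    fix k
    obtain h where h: "h \<in> PF5" "\<And>p. p \<in> X \<Longrightarrow> f p = \<pi> (proj3 p) ^ k * h p"
      using f(2)[of k] unfolding dvd_on_def by blast
    obtain M Q where Q: "\<And>q t. \<eta> q \<noteq> 0 \<Longrightarrow> \<eta> q ^ M * h (ch q t) = ev4 Q q t" using chE[OF h(1)] by blast
    have "\<eta> q ^ M * ev4 P q t = \<pi> q ^ k * (\<eta> q ^ N * ev4 Q q t)" if "q \<in> S" "\<eta> q \<noteq> 0" for q t
    proof -
      have "f (ch q t) = \<pi> q ^ k * h (ch q t)"
        using h(2)[OF ch_in[OF that], of t] ch_proj[OF that(2)] by simp
      then show ?thesis unfolding P[OF that(2), symmetric] Q[OF that(2), symmetric] by simp
    qed
    moreover have "(\<lambda>q. \<eta> q ^ N * ev4 Q q (p $ j)) \<in> pol3"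
      by (intro function_ring_intros[OF function_ring_pol3] \<eta>_pol3 pol)
    ultimately show "\<exists>N. \<exists>H\<in>pol3. \<forall>q\<in>S. \<eta> q \<noteq> 0 \<longrightarrow> \<eta> q ^ N * ev4 P q (p $ j) = \<pi> q ^ k * H q"
      by (intro exI[of _ M] bexI[of _ "\<lambda>q. \<eta> q ^ N * ev4 Q q (p $ j)"]) auto
  qed
  then have "\<eta> (proj3 p) ^ N * f p = 0"
    using P[OF p(2), of "p $ j"] ch_surj[OF p] proj_in[OF p(1)] by simp
  then show ?thesis using p(2) by simp
qed

end

section \<open>The coordinates as prime elements\<close>

lemma vec5_eq_iff: "(p :: 'a ^ 5) = q \<longleftrightarrow> p $ 1 = q $ 1 \<and> p $ 2 = q $ 2 \<and> p $ 3 = q $ 3 \<and> p $ 4 = q $ 4 \<and> p $ 5 = q $ 5"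
  unfolding vec_eq_iff using exhaust_5 by metis

text \<open>With the Bezout relation \<open>a * i = c * k + 1\<close>, the parameter is
  \<open>z^i / x^k\<close>.\<close>

lemma power_eq_power_param:
  fixes x z :: complex
  assumes "coprime a c" "0 < a" "x ^ a = z ^ c" "x \<noteq> 0" "z \<noteq> 0"
  obtains s where "s \<noteq> 0" "x = s ^ c" "z = s ^ a"
proof -
  obtain i k where ik: "a * i = c * k + 1" using bezout_nat[of a c] assms(1,2) by auto
  have "(z ^ i / x ^ k) ^ c = x"
  proof -
    have "(z ^ i / x ^ k) ^ c = (z ^ c) ^ i / x ^ (c * k)" by (simp add: power_divide mult.commute flip: power_mult)
    also have "(z ^ c) ^ i = x ^ (c * k) * x" by (simp add: ik flip: assms(3) power_mult)
    finally show ?thesis using assms by simp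
  qed
  moreover have "(z ^ i / x ^ k) ^ a = z"
  proof -
    have "(z ^ i / x ^ k) ^ a = z ^ (a * i) / (x ^ a) ^ k" by (simp add: power_divide mult.commute flip: power_mult)
    also have "(x ^ a) ^ k = z ^ (c * k)" by (simp add: assms(3) flip: power_mult)
    finally show ?thesis using assms ik by simp
  qed
  ultimately show ?thesis using that[of "z ^ i / x ^ k"] assms by simp
qed

text \<open>A \<open>c\<close>-th root \<open>\<omega>\<close> of \<open>-1\<close> absorbs the
  sign: \<open>z / \<omega>\<close> satisfies the equation with a difference.\<close>

lemma power_sum_zero_param:
  fixes x z \<omega> :: complex
  assumes "coprime a c" "0 < a" "0 < c" "\<omega> ^ c = - 1" "x \<noteq> 0" "x ^ a + z ^ c = 0"
  obtains s where "s \<noteq> 0" "x = s ^ c" "z = \<omega> * s ^ a"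
proof -
  have \<omega>0: "\<omega> \<noteq> 0" using assms(3,4) by (auto simp: power_0_left)
  have e: "x ^ a = (z / \<omega>) ^ c" using assms(6) by (simp add: power_divide assms(4) eq_neg_iff_add_eq_0)
  then have "z / \<omega> \<noteq> 0" using assms(3,5) by (auto simp: power_0_left)
  then obtain s where "s \<noteq> 0" "x = s ^ c" "z / \<omega> = s ^ a"
    using power_eq_power_param[OF assms(1,2) e assms(5)] by metis
  then show ?thesis using that[of s] \<omega>0 by (simp add: field_simps)
qed

lemma power_neg_one_exists:
  assumes "0 < c" obtains \<omega> :: complex where "\<omega> ^ c = - 1"
proof -
  have "{z :: complex. z ^ c = -1} \<noteq> {}" using card_nth_roots[of "-1" c] assms by force
  then show ?thesis using that by blast
qed

section \<open>The line bundle torsor over the punctured surface and its two charts\<close>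

locale bp_torsor =
  fixes a b c n m :: nat
  assumes pos: "0 < a" "0 < b" "0 < c" "0 < n" "0 < m"
begin

abbreviation (input) X where "X \<equiv> X_variety a b c n m"
abbreviation (input) S where "S \<equiv> bp_surface a b c"

definition chart_x :: "complex \<times> complex \<times> complex \<Rightarrow> complex \<Rightarrow> complex ^ 5" where
  "chart_x q v = (case q of (x, y, z) \<Rightarrow> mk5 x y z ((1 + y ^ n * v) / x ^ m) v)"

definition chart_y :: "complex \<times> complex \<times> complex \<Rightarrow> complex \<Rightarrow> complex ^ 5" where
  "chart_y q u = (case q of (x, y, z) \<Rightarrow> mk5 x y z u ((x ^ m * u - 1) / y ^ n))"

text \<open>The last assumption is applied to the localisation at \<open>\<eta>\<close> of the
  polynomials in the fibre coordinate; membership there is precisely the existence of a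
  denominator.\<close>

lemma chart_exists:
  assumes "f \<in> PF5" "\<eta> \<in> pol3"
    and "\<And>K. function_ring K \<Longrightarrow> (\<And>g. g \<in> pol3 \<Longrightarrow> (\<lambda>(q, t). g q) \<in> K) \<Longrightarrow> (\<lambda>(q, t). t) \<in> K \<Longrightarrow>
      (\<lambda>(q, t). 1 / \<eta> q) \<in> K \<Longrightarrow> (\<lambda>(q, t). f (ch q t)) \<in> K"
  shows "\<exists>N P. \<forall>q t. \<eta> q \<noteq> 0 \<longrightarrow> \<eta> q ^ N * f (ch q t) = ev4 P q t"
proof -
  let ?K = "range (\<lambda>P (q, t). ev4 P q t)" and ?V = "{(q, t). \<eta> q \<noteq> 0} :: ((complex \<times> complex \<times> complex) \<times> complex) set"
  have \<eta>: "(\<lambda>(q, t). \<eta> q) \<in> ?K" using ev4_pol3[OF assms(2)] .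
  have "(\<lambda>(q, t). f (ch q t)) \<in> localised ?K (\<lambda>(q, t). \<eta> q) ?V"
  proof (rule assms(3))
    show "function_ring (localised ?K (\<lambda>(q, t). \<eta> q) ?V)"
      by (rule function_ring_localised[OF function_ring_ev4 \<eta>])
    show "(\<lambda>(q, t). g q) \<in> localised ?K (\<lambda>(q, t). \<eta> q) ?V" if "g \<in> pol3" for g
      by (rule localised_superset[OF ev4_pol3[OF that]])
    show "(\<lambda>(q, t). t) \<in> localised ?K (\<lambda>(q, t). \<eta> q) ?V"
      by (rule localised_superset[OF ev4_snd])
    have one: "(\<lambda>p. 1) \<in> ?K" by (rule function_ring_const[OF function_ring_ev4])
    show "(\<lambda>(q, t). 1 / \<eta> q) \<in> localised ?K (\<lambda>(q, t). \<eta> q) ?V"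
      by (rule localisedI[OF one, of _ _ 1]) auto
  qed
  then obtain N f' where f': "f' \<in> ?K" "\<And>p. p \<in> ?V \<Longrightarrow> (case p of (q, t) \<Rightarrow> \<eta> q) ^ N * (case p of (q, t) \<Rightarrow> f (ch q t)) = f' p"
    by (rule localisedE) blast
  then obtain P where "f' = (\<lambda>(q, t). ev4 P q t)" by blast
  then show ?thesis using f'(2)[of "(_, _)"] by (intro exI[of _ N] exI[of _ P]) auto
qed

sublocale cx: X_chart a b c n m fst 5 chart_x
proof
  show "\<exists>N P. \<forall>q t. fst q \<noteq> 0 \<longrightarrow> fst q ^ N * f (chart_x q t) = ev4 P q t" if "f \<in> PF5" for f
  proof (rule chart_exists[OF that pol3_fst])
    fix K :: "((complex \<times> complex \<times> complex) \<times> complex \<Rightarrow> complex) set"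
    assume K: "function_ring K" "\<And>g. g \<in> pol3 \<Longrightarrow> (\<lambda>(q, t). g q) \<in> K" "(\<lambda>(q, t). t) \<in> K"
      "(\<lambda>(q, t). 1 / fst q) \<in> K"
    have K': "\<And>g. g \<in> pol3 \<Longrightarrow> (\<lambda>p. g (fst p)) \<in> K" "(\<lambda>p. snd p) \<in> K" "(\<lambda>p. 1 / fst (fst p)) \<in> K"
      using K(2-4) by (simp_all add: case_prod_unfold)
    have "(\<lambda>p. (1 + fst (snd (fst p)) ^ n * snd p) * (1 / fst (fst p)) ^ m) \<in> K"
      by (intro function_ring_intros[OF K(1)] K'(1)[OF pol3_snd] K'(2,3))
    then show "(\<lambda>(q, t). f (chart_x q t)) \<in> K"
      unfolding chart_x_def case_prod_unfold
      by (intro mk5_comp[OF K(1)] that K'(1)[OF pol3_fst] K'(1)[OF pol3_snd] K'(1)[OF pol3_thd] K'(2))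
        (simp_all add: power_divide)
  qed
qed (use pos in \<open>auto simp: pol3_fst X_variety_iff chart_x_def proj3_def vec5_eq_iff field_simps split: prod.splits\<close>)

sublocale cy: X_chart a b c n m "\<lambda>q. fst (snd q)" 4 chart_y
proof
  show "\<exists>N P. \<forall>q t. fst (snd q) \<noteq> 0 \<longrightarrow> fst (snd q) ^ N * f (chart_y q t) = ev4 P q t" if "f \<in> PF5" for f
  proof (rule chart_exists[OF that pol3_snd])
    fix K :: "((complex \<times> complex \<times> complex) \<times> complex \<Rightarrow> complex) set"
    assume K: "function_ring K" "\<And>g. g \<in> pol3 \<Longrightarrow> (\<lambda>(q, t). g q) \<in> K" "(\<lambda>(q, t). t) \<in> K"
      "(\<lambda>(q, t). 1 / fst (snd q)) \<in> K"
    have K': "\<And>g. g \<in> pol3 \<Longrightarrow> (\<lambda>p. g (fst p)) \<in> K" "(\<lambda>p. snd p) \<in> K" "(\<lambda>p. 1 / fst (snd (fst p))) \<in> K"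
      using K(2-4) by (simp_all add: case_prod_unfold)
    have "(\<lambda>p. (fst (fst p) ^ m * snd p - 1) * (1 / fst (snd (fst p))) ^ n) \<in> K"
      by (intro function_ring_intros[OF K(1)] K'(1)[OF pol3_fst] K'(2,3))
    then show "(\<lambda>(q, t). f (chart_y q t)) \<in> K"
      unfolding chart_y_def case_prod_unfold
      by (intro mk5_comp[OF K(1)] that K'(1)[OF pol3_fst] K'(1)[OF pol3_snd] K'(1)[OF pol3_thd] K'(2))
        (simp_all add: power_divide)
  qed
qed (use pos in \<open>auto simp: pol3_snd X_variety_iff chart_y_def proj3_def vec5_eq_iff field_simps split: prod.splits\<close>)

lemma xy_nonzero: "p \<in> X \<Longrightarrow> p $ 1 \<noteq> 0 \<or> p $ 2 \<noteq> 0"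
  using pos by (auto simp: X_variety_iff power_0_left)

lemma X_dense:
  assumes "f \<in> PF5" "\<And>p. p \<in> X \<Longrightarrow> p $ 1 \<noteq> 0 \<Longrightarrow> p $ 2 \<noteq> 0 \<Longrightarrow> p $ 3 \<noteq> 0 \<Longrightarrow> f p = 0" "p \<in> X"
  shows "f p = 0"
  using xy_nonzero[OF assms(3)] cx.chart_dense[OF assms] cy.chart_dense[OF assms] by (auto simp: proj3_def)

lemma X_dense_eq:
  assumes "f \<in> PF5" "g \<in> PF5" "\<And>p. p \<in> X \<Longrightarrow> p $ 1 \<noteq> 0 \<Longrightarrow> p $ 2 \<noteq> 0 \<Longrightarrow> p $ 3 \<noteq> 0 \<Longrightarrow> f p = g p" "p \<in> X"
  shows "f p = g p"
  using X_dense[of "\<lambda>p. f p - g p" p] assms function_ring_diff[OF function_ring_polynomial_functions assms(1,2)] by auto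

text \<open>The action of the additive group along the fibres: \<open>(y^n, x^m)\<close> spans the
  kernel of the linear form \<open>x^m u - y^n v\<close> in \<open>(u, v)\<close>.\<close>

definition shift :: "complex ^ 5 \<Rightarrow> complex \<Rightarrow> complex ^ 5" where
  "shift p t = mk5 (p $ 1) (p $ 2) (p $ 3) (p $ 4 + (p $ 2) ^ n * t) (p $ 5 + (p $ 1) ^ m * t)"

lemma shift_in: "p \<in> X \<Longrightarrow> shift p t \<in> X"
  by (auto simp: X_variety_iff shift_def proj3_def algebra_simps)

lemma chart_x_shift:
  assumes "p \<in> X" "p $ 1 \<noteq> 0"
  shows "p = shift (chart_x (proj3 p) 0) (p $ 5 / (p $ 1) ^ m)"
proof -
  have "p $ 4 = 1 / p $ 1 ^ m + p $ 2 ^ n * (p $ 5 / p $ 1 ^ m)"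
    using assms by (simp add: X_variety_iff field_simps)
  then show ?thesis using assms by (simp add: shift_def chart_x_def proj3_def vec5_eq_iff)
qed

lemma chart_y_shift:
  assumes "p \<in> X" "p $ 2 \<noteq> 0"
  shows "p = shift (chart_y (proj3 p) 0) (p $ 4 / (p $ 2) ^ n)"
proof -
  have "p $ 1 ^ m * p $ 4 - p $ 2 ^ n * p $ 5 = 1" using assms(1) by (simp add: X_variety_iff)
  then have "p $ 2 ^ n * p $ 5 = p $ 1 ^ m * p $ 4 - 1" by (simp add: algebra_simps)
  then have "p $ 5 = (p $ 1 ^ m * p $ 4 - 1) / p $ 2 ^ n" using assms(2) by (simp add: eq_divide_eq mult.commute)
  then have "p $ 5 = - 1 / p $ 2 ^ n + p $ 1 ^ m * (p $ 4 / p $ 2 ^ n)" by (simp add: diff_divide_distrib)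
  then show ?thesis using assms by (simp add: shift_def chart_y_def proj3_def vec5_eq_iff)
qed

text \<open>The zero sections of the two charts are \<open>(u, v) = (1 / x^m, 0)\<close> and
  \<open>(0, - 1 / y^n)\<close>. Their displacement is the cocycle of the torsor.\<close>

lemma chart_x_chart_y:
  assumes "(x, y, z) \<in> S" "x \<noteq> 0" "y \<noteq> 0"
  shows "chart_x (x, y, z) 0 = shift (chart_y (x, y, z) 0) (1 / (x ^ m * y ^ n))"
  using chart_y_shift[OF cx.ch_in[of "(x, y, z)" 0]] assms by (simp add: chart_x_def proj3_def)

lemma chart_pol3:
  shows "(\<lambda>q. ev4 P q t) \<in> pol3"
  by (rule ev4_comp) (auto intro: pol3_intros function_ring_pol3)

text \<open>An invariant function is determined by its values on the two zero sections, where it has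
  only powers of \<open>x\<close>, respectively \<open>y\<close>, as denominators. The values agree
  on the overlap, so \<open>bp_saturated\<close> glues them across the singular point.\<close>

lemma shift_invariant:
  assumes "f \<in> PF5" "\<And>p t. p \<in> X \<Longrightarrow> f (shift p t) = f p"
  obtains F where "F \<in> pol3" "\<And>p. p \<in> X \<Longrightarrow> f p = F (proj3 p)"
proof -
  obtain N1 P where P: "\<And>q t. fst q \<noteq> 0 \<Longrightarrow> fst q ^ N1 * f (chart_x q t) = ev4 P q t"
    using cx.chE[OF assms(1)] by blast
  obtain N2 Q where Q: "\<And>q t. fst (snd q) \<noteq> 0 \<Longrightarrow> fst (snd q) ^ N2 * f (chart_y q t) = ev4 Q q t"
    using cy.chE[OF assms(1)] by blast
  define N where "N = N1 + N2"
  define G where "G q = fst q ^ N2 * ev4 P q 0" for q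
  define H where "H q = fst (snd q) ^ N1 * ev4 Q q 0" for q
  have GH: "G \<in> pol3" "H \<in> pol3"
    unfolding G_def H_def by (intro pol3_intros chart_pol3)+
  have G: "G q = fst q ^ N * f (chart_x q 0)" if "fst q \<noteq> 0" for q
    using P[OF that, of 0] by (simp add: G_def N_def power_add)
  have H: "H q = fst (snd q) ^ N * f (chart_y q 0)" if "fst (snd q) \<noteq> 0" for q
    using Q[OF that, of 0] by (simp add: H_def N_def power_add)
  have "y ^ N * G (x, y, z) = x ^ N * H (x, y, z)" if "(x, y, z) \<in> S" "x \<noteq> 0" "y \<noteq> 0" for x y z
    using assms(2)[OF cy.ch_in[of "(x, y, z)" 0]] chart_x_chart_y[OF that] that by (simp add: G H)
  then obtain h where h: "h \<in> pol3" "\<And>x y z. (x, y, z) \<in> S \<Longrightarrow> G (x, y, z) = x ^ N * h (x, y, z)"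
      "\<And>x y z. (x, y, z) \<in> S \<Longrightarrow> H (x, y, z) = y ^ N * h (x, y, z)"
    using bp_saturated[OF pos(2,3) GH, of a N] by blast
  have "f p = h (proj3 p)" if p: "p \<in> X" for p
  proof (cases "p $ 1 = 0")
    case False
    have S: "(p $ 1, p $ 2, p $ 3) \<in> S" using p by (simp add: X_variety_iff proj3_def)
    have "f (chart_x (proj3 p) 0) = h (proj3 p)"
      using G[of "proj3 p"] h(2)[OF S] False by (simp add: proj3_def)
    moreover have "f p = f (chart_x (proj3 p) 0)"
      using chart_x_shift[OF p False] assms(2)[OF cx.ch_in[of "proj3 p" 0]] S False by (metis fst_conv proj3_def)
    ultimately show ?thesis by simp
  next
    case True
    then have y: "p $ 2 \<noteq> 0" using xy_nonzero[OF p] by simp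
    have S: "(p $ 1, p $ 2, p $ 3) \<in> S" using p by (simp add: X_variety_iff proj3_def)
    have "f (chart_y (proj3 p) 0) = h (proj3 p)"
      using H[of "proj3 p"] h(3)[OF S] y by (simp add: proj3_def)
    moreover have "f p = f (chart_y (proj3 p) 0)"
      using chart_y_shift[OF p y] assms(2)[OF cy.ch_in[of "proj3 p" 0]] S y by (metis fst_conv snd_conv proj3_def)
    ultimately show ?thesis by simp
  qed
  then show ?thesis using h(1) that by blast
qed

lemma comaximal_xy: "comaximal_on X (\<lambda>p. p $ 1) (\<lambda>p. p $ 2)"
proof -
  obtain m' n' where [simp]: "m = Suc m'" "n = Suc n'" using pos by (meson gr0_implies_Suc)
  have "(\<lambda>p. p $ 1 ^ m' * p $ 4) \<in> PF5" "(\<lambda>p. - (p $ 2 ^ n' * p $ 5)) \<in> PF5" by (intro PF_intros)+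
  moreover have "p $ 1 * (p $ 1 ^ m' * p $ 4) + p $ 2 * (- (p $ 2 ^ n' * p $ 5)) = 1" if "p \<in> X" for p
    using that by (simp add: X_variety_iff mult.assoc)
  ultimately show ?thesis unfolding comaximal_on_def by (intro bexI ballI)
qed

text \<open>In a Bezout identity for \<open>x\<close> and \<open>y^b\<close>, the surface equation
  lets \<open>y^b\<close> be replaced by \<open>- x^a - z^c\<close>.\<close>

lemma comaximal_xz: "comaximal_on X (\<lambda>p. p $ 1) (\<lambda>p. p $ 3)"
proof -
  obtain a' c' where ac: "a = Suc a'" "c = Suc c'" using pos by (meson gr0_implies_Suc)
  obtain e e' where e: "e \<in> PF5" "e' \<in> PF5" "\<And>p. p \<in> X \<Longrightarrow> p $ 2 ^ b * e p + p $ 1 * e' p = 1"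
    using comaximal_on_power[OF _ _ comaximal_on_commute[OF comaximal_xy], of b] polynomial_functions.coord
    unfolding comaximal_on_def by blast
  have "(\<lambda>p. e' p - p $ 1 ^ a' * e p) \<in> PF5" "(\<lambda>p. - (p $ 3 ^ c' * e p)) \<in> PF5" by (intro PF_intros e(1,2))+
  moreover have "p $ 1 * (e' p - p $ 1 ^ a' * e p) + p $ 3 * (- (p $ 3 ^ c' * e p)) = 1" if "p \<in> X" for p
  proof -
    have y: "p $ 2 ^ b = - (p $ 1 ^ a) - p $ 3 ^ c"
      using that by (simp add: X_variety_iff bp_surface_def proj3_def algebra_simps eq_neg_iff_add_eq_0)
    show ?thesis using e(3)[OF that] unfolding y ac by (simp add: algebra_simps)
  qed
  ultimately show ?thesis unfolding comaximal_on_def by (intro bexI ballI)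
qed

end

lemma function_ring_poly: "function_ring (range (poly :: complex poly \<Rightarrow> complex \<Rightarrow> complex))"
proof (rule function_ringI)
  show "(\<lambda>p. k) \<in> range poly" for k :: complex by (rule range_eqI[of _ _ "[:k:]"]) auto
  fix f g :: "complex \<Rightarrow> complex" assume "f \<in> range poly" "g \<in> range poly"
  then obtain P Q where f: "f = poly P" and g: "g = poly Q" by blast
  show "(\<lambda>p. f p + g p) \<in> range poly" unfolding f g by (rule range_eqI[of _ _ "P + Q"]) auto
  show "(\<lambda>p. f p * g p) \<in> range poly" unfolding f g by (rule range_eqI[of _ _ "P * Q"]) auto
qed

lemma pol3_param:
  assumes "f \<in> pol3" "\<And>s. \<gamma> s = (poly p1 s, poly p2 s, poly p3 s)"
  shows "\<exists>p. \<forall>s. f (\<gamma> s) = poly p s"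
proof -
  from pol3_comp[OF function_ring_poly rangeI rangeI rangeI assms(1), of p1 p2 p3]
  show ?thesis unfolding assms(2) by (auto simp: fun_eq_iff)
qed

text \<open>If \<open>\<pi>\<close> divides a product, one factor vanishes on the irreducible locus
  \<open>\<pi> = 0\<close>, and vanishing there already implies divisibility.\<close>

lemma (in X_chart) chart_prime:
  assumes "\<pi> \<in> pol3"
    and DIV: "\<And>G. G \<in> pol3 \<Longrightarrow> (\<And>q. q \<in> S \<Longrightarrow> \<pi> q = 0 \<Longrightarrow> \<eta> q \<noteq> 0 \<Longrightarrow> G q = 0) \<Longrightarrow>
      \<exists>H\<in>pol3. \<forall>q\<in>S. G q = \<pi> q * H q"
    and com: "comaximal_on X (\<lambda>p. \<eta> (proj3 p)) (\<lambda>p. \<pi> (proj3 p))"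
    and \<gamma>: "\<And>s. s \<noteq> 0 \<Longrightarrow> \<gamma> s \<in> S \<and> \<pi> (\<gamma> s) = 0 \<and> \<eta> (\<gamma> s) \<noteq> 0"
      "\<And>q. q \<in> S \<Longrightarrow> \<pi> q = 0 \<Longrightarrow> \<eta> q \<noteq> 0 \<Longrightarrow> \<exists>s. s \<noteq> 0 \<and> q = \<gamma> s"
      "\<And>s. \<gamma> s = (poly p1 s, poly p2 s, poly p3 s)"
  shows "prime_on X (\<lambda>p. \<pi> (proj3 p))"
  unfolding prime_on_def
proof (intro ballI impI)
  fix f g :: "complex ^ 5 \<Rightarrow> complex"
  assume fg: "f \<in> PF5" "g \<in> PF5" "dvd_on X (\<lambda>p. \<pi> (proj3 p)) (\<lambda>p. f p * g p)"
  have \<eta>0: "\<eta> (proj3 p) \<noteq> 0" if "p \<in> X" "\<pi> (proj3 p) = 0" for p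
    using com that unfolding comaximal_on_def by force
  have "f p * g p = 0" if "p \<in> X" "\<pi> (proj3 p) = 0" for p
    using fg(3) that unfolding dvd_on_def by force
  from chart_vanish[OF fg(1,2) this \<gamma>(1,2) pol3_param[OF _ \<gamma>(3)] \<eta>0]
  have "(\<forall>p\<in>X. \<pi> (proj3 p) = 0 \<longrightarrow> f p = 0) \<or> (\<forall>p\<in>X. \<pi> (proj3 p) = 0 \<longrightarrow> g p = 0)" .
  then show "dvd_on X (\<lambda>p. \<pi> (proj3 p)) f \<or> dvd_on X (\<lambda>p. \<pi> (proj3 p)) g"
    using chart_divide[OF fg(1) assms(1) DIV com] chart_divide[OF fg(2) assms(1) DIV com] by blast
qed

lemma pol3_permute:
  assumes "f \<in> pol3"
  shows "(\<lambda>(y, x, z). f (x, y, z)) \<in> pol3" "(\<lambda>(z, x, y). f (x, y, z)) \<in> pol3" "(\<lambda>(x, z, y). f (x, y, z)) \<in> pol3"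
    "(\<lambda>(x, y, z). f (z, x, y)) \<in> pol3"
  unfolding case_prod_unfold by (intro pol3_comp[OF function_ring_pol3 _ _ _ assms] pol3_intros)+

lemma bp_permute:
  "(y, x, z) \<in> bp_surface b a c \<longleftrightarrow> (x, y, z) \<in> bp_surface a b c"
  "(z, x, y) \<in> bp_surface c a b \<longleftrightarrow> (x, y, z) \<in> bp_surface a b c"
  "(x, z, y) \<in> bp_surface a c b \<longleftrightarrow> (x, y, z) \<in> bp_surface a b c"
  by (auto simp: bp_surface_def algebra_simps)

section \<open>Primality of the coordinates and boundedness of their powers\<close>

context bp_torsor
begin

text \<open>The curve \<open>y = 0\<close> on the surface is \<open>x^a + z^c = 0\<close>,
  rationally parametrised because \<open>a\<close> and \<open>c\<close> are coprime. On the
  threefold \<open>y = 0\<close> forces \<open>x \<noteq> 0\<close>, so the first chart contains the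
  whole locus. Exchanging \<open>x\<close> and \<open>y\<close> makes
  \<open>bp_divide_coordinate\<close> applicable.\<close>

lemma prime_y:
  assumes "coprime a c" shows "prime_on X (\<lambda>p. p $ 2)"
proof -
  obtain \<omega> :: complex where \<omega>: "\<omega> ^ c = - 1" using power_neg_one_exists[OF pos(3)] by blast
  have "prime_on X (\<lambda>p. fst (snd (proj3 p)))"
  proof (rule cx.chart_prime[OF pol3_snd, where \<gamma> = "\<lambda>s. (s ^ c, 0, \<omega> * s ^ a)" and ?p1.0 = "monom 1 c"
        and ?p2.0 = 0 and ?p3.0 = "monom \<omega> a"])
    fix G :: "complex \<times> complex \<times> complex \<Rightarrow> complex"
    assume G: "G \<in> pol3" "\<And>q. q \<in> S \<Longrightarrow> fst (snd q) = 0 \<Longrightarrow> fst q \<noteq> 0 \<Longrightarrow> G q = 0"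
    obtain H where "H \<in> pol3" "\<And>y x z. (y, x, z) \<in> bp_surface b a c \<Longrightarrow> G (x, y, z) = y * H (y, x, z)"
      by (rule bp_divide_coordinate[OF pos(1,3) pol3_permute(1)[OF G(1)], of b])
        (use G(2) pos in \<open>auto simp: bp_permute\<close>)
    then show "\<exists>H\<in>pol3. \<forall>q\<in>S. G q = fst (snd q) * H q"
      by (intro bexI[of _ "\<lambda>(x, y, z). H (y, x, z)"] pol3_permute) (auto simp: bp_permute)
  next
    show "comaximal_on X (\<lambda>p. fst (proj3 p)) (\<lambda>p. fst (snd (proj3 p)))"
      using comaximal_xy by (simp add: proj3_def)
    show "(s ^ c, 0, \<omega> * s ^ a) \<in> S \<and> fst (snd (s ^ c, 0, \<omega> * s ^ a)) = 0 \<and> fst (s ^ c, 0, \<omega> * s ^ a) \<noteq> 0"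
      if "s \<noteq> 0" for s
      using that pos \<omega> by (simp add: bp_surface_def power_mult_distrib power_0_left mult.commute flip: power_mult)
    fix q assume q: "q \<in> S" "fst (snd q) = 0" "fst q \<noteq> 0"
    obtain x z where xz: "q = (x, 0, z)" "x \<noteq> 0" using q by (cases q) auto
    have "x ^ a + z ^ c = 0" using q(1) pos by (simp add: xz bp_surface_def power_0_left)
    then show "\<exists>s. s \<noteq> 0 \<and> q = (s ^ c, 0, \<omega> * s ^ a)"
      using power_sum_zero_param[OF assms pos(1) pos(3) \<omega> xz(2)] xz(1) by metis
  qed (simp_all add: poly_monom)
  then show ?thesis by (simp add: proj3_def)
qed

text \<open>Here \<open>y\<close> is invertible on the locus, so the second chart is the right
  one.\<close>

lemma prime_x:
  assumes "coprime b c" shows "prime_on X (\<lambda>p. p $ 1)"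
proof -
  obtain \<omega> :: complex where \<omega>: "\<omega> ^ c = - 1" using power_neg_one_exists[OF pos(3)] by blast
  have "prime_on X (\<lambda>p. fst (proj3 p))"
  proof (rule cy.chart_prime[OF pol3_fst, where \<gamma> = "\<lambda>s. (0, s ^ c, \<omega> * s ^ b)" and ?p1.0 = 0
        and ?p2.0 = "monom 1 c" and ?p3.0 = "monom \<omega> b"])
    fix G :: "complex \<times> complex \<times> complex \<Rightarrow> complex"
    assume G: "G \<in> pol3" "\<And>q. q \<in> S \<Longrightarrow> fst q = 0 \<Longrightarrow> fst (snd q) \<noteq> 0 \<Longrightarrow> G q = 0"
    obtain H where "H \<in> pol3" "\<And>x y z. (x, y, z) \<in> S \<Longrightarrow> G (x, y, z) = x * H (x, y, z)"
      by (rule bp_divide_coordinate[OF pos(2,3) G(1), of a]) (use G(2) pos in auto)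
    then show "\<exists>H\<in>pol3. \<forall>q\<in>S. G q = fst q * H q" by auto
  next
    show "comaximal_on X (\<lambda>p. fst (snd (proj3 p))) (\<lambda>p. fst (proj3 p))"
      using comaximal_on_commute[OF comaximal_xy] by (simp add: proj3_def)
    show "(0, s ^ c, \<omega> * s ^ b) \<in> S \<and> fst (0, s ^ c, \<omega> * s ^ b) = 0 \<and> fst (snd (0, s ^ c, \<omega> * s ^ b)) \<noteq> 0"
      if "s \<noteq> 0" for s
      using that pos \<omega> by (simp add: bp_surface_def power_mult_distrib power_0_left mult.commute flip: power_mult)
    fix q assume q: "q \<in> S" "fst q = 0" "fst (snd q) \<noteq> 0"
    obtain x z where xz: "q = (0, x, z)" "x \<noteq> 0" using q by (cases q) auto
    have "x ^ b + z ^ c = 0" using q(1) pos by (simp add: xz bp_surface_def power_0_left)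
    then show "\<exists>s. s \<noteq> 0 \<and> q = (0, s ^ c, \<omega> * s ^ b)"
      using power_sum_zero_param[OF assms pos(2) pos(3) \<omega> xz(2)] xz(1) by metis
  qed (simp_all add: poly_monom)
  then show ?thesis by (simp add: proj3_def)
qed

text \<open>The locus \<open>z = 0\<close> lies in the first chart because \<open>x\<close> and
  \<open>z\<close> are comaximal on the threefold.\<close>

lemma prime_z:
  assumes "coprime a b" shows "prime_on X (\<lambda>p. p $ 3)"
proof -
  obtain \<omega> :: complex where \<omega>: "\<omega> ^ b = - 1" using power_neg_one_exists[OF pos(2)] by blast
  have "prime_on X (\<lambda>p. snd (snd (proj3 p)))"
  proof (rule cx.chart_prime[OF pol3_thd, where \<gamma> = "\<lambda>s. (s ^ b, \<omega> * s ^ a, 0)" and ?p1.0 = "monom 1 b"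
        and ?p2.0 = "monom \<omega> a" and ?p3.0 = 0])
    fix G :: "complex \<times> complex \<times> complex \<Rightarrow> complex"
    assume G: "G \<in> pol3" "\<And>q. q \<in> S \<Longrightarrow> snd (snd q) = 0 \<Longrightarrow> fst q \<noteq> 0 \<Longrightarrow> G q = 0"
    obtain H where "H \<in> pol3" "\<And>z x y. (z, x, y) \<in> bp_surface c a b \<Longrightarrow> G (x, y, z) = z * H (z, x, y)"
      by (rule bp_divide_coordinate[OF pos(1,2) pol3_permute(2)[OF G(1)], of c])
        (use G(2) pos in \<open>auto simp: bp_permute\<close>)
    then show "\<exists>H\<in>pol3. \<forall>q\<in>S. G q = snd (snd q) * H q"
      by (intro bexI[of _ "\<lambda>(x, y, z). H (z, x, y)"] pol3_permute(4)) (auto simp: bp_permute)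
  next
    show "comaximal_on X (\<lambda>p. fst (proj3 p)) (\<lambda>p. snd (snd (proj3 p)))"
      using comaximal_xz by (simp add: proj3_def)
    show "(s ^ b, \<omega> * s ^ a, 0) \<in> S \<and> snd (snd (s ^ b, \<omega> * s ^ a, 0)) = 0 \<and> fst (s ^ b, \<omega> * s ^ a, 0) \<noteq> 0"
      if "s \<noteq> 0" for s
      using that pos \<omega> by (simp add: bp_surface_def power_mult_distrib power_0_left mult.commute flip: power_mult)
    fix q assume q: "q \<in> S" "snd (snd q) = 0" "fst q \<noteq> 0"
    obtain x z where xz: "q = (x, z, 0)" "x \<noteq> 0" using q by (cases q) auto
    have "x ^ a + z ^ b = 0" using q(1) pos by (simp add: xz bp_surface_def power_0_left)
    then show "\<exists>s. s \<noteq> 0 \<and> q = (s ^ b, \<omega> * s ^ a, 0)"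
      using power_sum_zero_param[OF assms pos(1) pos(2) \<omega> xz(2)] xz(1) by metis
  qed (simp_all add: poly_monom)
  then show ?thesis by (simp add: proj3_def)
qed

text \<open>This and its two analogues ensure that extracting a coordinate from a nonzero function
  terminates; they stand in for a chain condition.\<close>

lemma bounded_x:
  assumes "f \<in> PF5" "\<And>k. dvd_on X (\<lambda>p. p $ 1 ^ k) f" "p \<in> X"
  shows "f p = 0"
proof (rule X_dense[OF assms(1) _ assms(3)])
  fix p assume p: "p \<in> X" "p $ 2 \<noteq> 0"
  show "f p = 0"
  proof (rule cy.chart_infinitely_divisible[where \<pi> = fst, OF assms(1) _ _ p(1)])
    show "dvd_on X (\<lambda>p. fst (proj3 p) ^ k) f" for k using assms(2) by (simp add: proj3_def)
    fix G :: "complex \<times> complex \<times> complex \<Rightarrow> complex"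
    assume G: "G \<in> pol3" "\<And>k. \<exists>N. \<exists>H\<in>pol3. \<forall>q\<in>S. fst (snd q) \<noteq> 0 \<longrightarrow> fst (snd q) ^ N * G q = fst q ^ k * H q"
    have "G (x, y, z) = 0" if xyz: "(x, y, z) \<in> S" for x y z
    proof -
      \<comment> \<open>The coordinates are exchanged because \<open>bp_infinitely_divisible\<close>
        has the denominator in the first coordinate and the divisor in the second.\<close>
      have "(\<lambda>(y, x, z). G (x, y, z)) (y, x, z) = 0"
      proof (rule bp_infinitely_divisible[OF pos(1,3) pol3_permute(1)[OF G(1)], of b])
        fix k
        obtain N H where H: "H \<in> pol3" "\<forall>q\<in>S. fst (snd q) \<noteq> 0 \<longrightarrow> fst (snd q) ^ N * G q = fst q ^ k * H q"
          using G(2)[of k] by blast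
        show "\<exists>N. \<exists>g\<in>pol3. \<forall>y x z. (y, x, z) \<in> bp_surface b a c \<longrightarrow> y \<noteq> 0 \<longrightarrow> x \<noteq> 0 \<longrightarrow> z \<noteq> 0 \<longrightarrow>
          y ^ N * (case (y, x, z) of (y, x, z) \<Rightarrow> G (x, y, z)) = x ^ k * g (y, x, z)"
          by (rule exI[of _ N], rule bexI[OF _ pol3_permute(1)[OF H(1)]]) (use H(2) in \<open>auto simp: bp_surface_def add_ac\<close>)
      qed (use xyz in \<open>simp add: bp_permute\<close>)
      then show ?thesis by simp
    qed
    then show "\<forall>q\<in>S. G q = 0" by auto
  qed (use p in \<open>simp add: proj3_def\<close>)
qed

lemma bounded_y:
  assumes "f \<in> PF5" "\<And>k. dvd_on X (\<lambda>p. p $ 2 ^ k) f" "p \<in> X"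
  shows "f p = 0"
proof (rule X_dense[OF assms(1) _ assms(3)])
  fix p assume p: "p \<in> X" "p $ 1 \<noteq> 0"
  show "f p = 0"
  proof (rule cx.chart_infinitely_divisible[where \<pi> = "\<lambda>q. fst (snd q)", OF assms(1) _ _ p(1)])
    show "dvd_on X (\<lambda>p. fst (snd (proj3 p)) ^ k) f" for k using assms(2) by (simp add: proj3_def)
    fix G :: "complex \<times> complex \<times> complex \<Rightarrow> complex"
    assume G: "G \<in> pol3" "\<And>k. \<exists>N. \<exists>H\<in>pol3. \<forall>q\<in>S. fst q \<noteq> 0 \<longrightarrow> fst q ^ N * G q = fst (snd q) ^ k * H q"
    show "\<forall>q\<in>S. G q = 0"
    proof
      fix q assume "q \<in> S"
      show "G q = 0"
      proof (rule bp_infinitely_divisible[OF pos(2,3) G(1) _ \<open>q \<in> S\<close>])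
        fix k
        obtain N H where H: "H \<in> pol3" "\<forall>q\<in>S. fst q \<noteq> 0 \<longrightarrow> fst q ^ N * G q = fst (snd q) ^ k * H q"
          using G(2)[of k] by blast
        show "\<exists>N. \<exists>g\<in>pol3. \<forall>x y z. (x, y, z) \<in> S \<longrightarrow> x \<noteq> 0 \<longrightarrow> y \<noteq> 0 \<longrightarrow> z \<noteq> 0 \<longrightarrow>
          x ^ N * G (x, y, z) = y ^ k * g (x, y, z)"
          by (rule exI[of _ N], rule bexI[OF _ H(1)]) (use H(2) in auto)
      qed
    qed
  qed (use p in \<open>simp add: proj3_def\<close>)
qed

lemma bounded_z:
  assumes "f \<in> PF5" "\<And>k. dvd_on X (\<lambda>p. p $ 3 ^ k) f" "p \<in> X"
  shows "f p = 0"
proof (rule X_dense[OF assms(1) _ assms(3)])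
  fix p assume p: "p \<in> X" "p $ 1 \<noteq> 0"
  show "f p = 0"
  proof (rule cx.chart_infinitely_divisible[where \<pi> = "\<lambda>q. snd (snd q)", OF assms(1) _ _ p(1)])
    show "dvd_on X (\<lambda>p. snd (snd (proj3 p)) ^ k) f" for k using assms(2) by (simp add: proj3_def)
    fix G :: "complex \<times> complex \<times> complex \<Rightarrow> complex"
    assume G: "G \<in> pol3" "\<And>k. \<exists>N. \<exists>H\<in>pol3. \<forall>q\<in>S. fst q \<noteq> 0 \<longrightarrow> fst q ^ N * G q = snd (snd q) ^ k * H q"
    have "G (x, y, z) = 0" if xyz: "(x, y, z) \<in> S" for x y z
    proof -
      have "(\<lambda>(x, z, y). G (x, y, z)) (x, z, y) = 0"
      proof (rule bp_infinitely_divisible[OF pos(3,2) pol3_permute(3)[OF G(1)], of a])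
        fix k
        obtain N H where H: "H \<in> pol3" "\<forall>q\<in>S. fst q \<noteq> 0 \<longrightarrow> fst q ^ N * G q = snd (snd q) ^ k * H q"
          using G(2)[of k] by blast
        show "\<exists>N. \<exists>g\<in>pol3. \<forall>x z y. (x, z, y) \<in> bp_surface a c b \<longrightarrow> x \<noteq> 0 \<longrightarrow> z \<noteq> 0 \<longrightarrow> y \<noteq> 0 \<longrightarrow>
          x ^ N * (case (x, z, y) of (x, z, y) \<Rightarrow> G (x, y, z)) = z ^ k * g (x, z, y)"
          by (rule exI[of _ N], rule bexI[OF _ pol3_permute(3)[OF H(1)]]) (use H(2) in \<open>auto simp: bp_surface_def add_ac\<close>)
      qed (use xyz in \<open>simp add: bp_permute\<close>)
      then show ?thesis by simp
    qed
    then show "\<forall>q\<in>S. G q = 0" by auto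
  qed (use p in \<open>simp add: proj3_def\<close>)
qed

end

section \<open>Factoriality\<close>

text \<open>Units satisfy \<^const>\<open>prime_on\<close>, so they may occur among the factors.\<close>

inductive prime_product_on :: "(complex ^ 'n) set \<Rightarrow> (complex ^ 'n \<Rightarrow> complex) \<Rightarrow> bool" for V where
  unit: "f \<in> polynomial_functions \<Longrightarrow> dvd_on V f (\<lambda>p. 1) \<Longrightarrow> prime_product_on V f"
| factor: "\<pi> \<in> polynomial_functions \<Longrightarrow> prime_on V \<pi> \<Longrightarrow> prime_product_on V g \<Longrightarrow>
    f \<in> polynomial_functions \<Longrightarrow> (\<And>p. p \<in> V \<Longrightarrow> f p = \<pi> p * g p) \<Longrightarrow> prime_product_on V f"

lemma dvd_onI: "h \<in> polynomial_functions \<Longrightarrow> (\<And>p. p \<in> V \<Longrightarrow> g p = f p * h p) \<Longrightarrow> dvd_on V f g"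
  unfolding dvd_on_def by blast

lemma dvd_onE:
  assumes "dvd_on V f g" obtains h where "h \<in> polynomial_functions" "\<And>p. p \<in> V \<Longrightarrow> g p = f p * h p"
  using assms unfolding dvd_on_def by blast

text \<open>The multiplicative set generated by the three prime coordinates, at which Nagata's
  criterion localises.\<close>

inductive_set coord_monomials :: "(complex ^ 5 \<Rightarrow> complex) set" where
  one: "(\<lambda>p. 1) \<in> coord_monomials"
| x: "\<mu> \<in> coord_monomials \<Longrightarrow> (\<lambda>p. p $ 1 * \<mu> p) \<in> coord_monomials"
| y: "\<mu> \<in> coord_monomials \<Longrightarrow> (\<lambda>p. p $ 2 * \<mu> p) \<in> coord_monomials"
| z: "\<mu> \<in> coord_monomials \<Longrightarrow> (\<lambda>p. p $ 3 * \<mu> p) \<in> coord_monomials"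

lemma coord_monomials_mult:
  "\<mu> \<in> coord_monomials \<Longrightarrow> \<nu> \<in> coord_monomials \<Longrightarrow> (\<lambda>p. \<mu> p * \<nu> p) \<in> coord_monomials"
  by (induction rule: coord_monomials.induct) (auto simp: mult.assoc intro: coord_monomials.intros)

lemma coord_monomials_power:
  "\<mu> \<in> coord_monomials \<Longrightarrow> (\<lambda>p. \<mu> p ^ k) \<in> coord_monomials"
  by (induction k) (auto intro: coord_monomials.one coord_monomials_mult)

lemma coord_monomials_coord: "(\<lambda>p. p $ 1) \<in> coord_monomials" "(\<lambda>p. p $ 2) \<in> coord_monomials" "(\<lambda>p. p $ 3) \<in> coord_monomials"
  using coord_monomials.x[OF coord_monomials.one] coord_monomials.y[OF coord_monomials.one]
    coord_monomials.z[OF coord_monomials.one] by simp_all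

lemma coord_monomials_PF: "\<mu> \<in> coord_monomials \<Longrightarrow> \<mu> \<in> PF5"
  by (induction rule: coord_monomials.induct) (auto intro: PF_intros)

lemma coord_monomials_nonzero:
  "\<mu> \<in> coord_monomials \<Longrightarrow> p $ 1 \<noteq> 0 \<Longrightarrow> p $ 2 \<noteq> 0 \<Longrightarrow> p $ 3 \<noteq> 0 \<Longrightarrow> \<mu> p \<noteq> 0"
  by (induction rule: coord_monomials.induct) auto

text \<open>The excluded values are those that \<open>(w, T)\<close> misses: \<open>w = 0\<close>
  belongs to \<open>y = 0\<close>, and \<open>w = -1\<close> to \<open>z = 0\<close>.\<close>

lemma ev3_zero:
  assumes "\<And>x y z. x \<noteq> 0 \<Longrightarrow> x \<noteq> - 1 \<Longrightarrow> y \<noteq> 0 \<Longrightarrow> ev3 P x y z = 0"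
  shows "P = 0"
proof (rule poly_eqI)
  fix k
  have inf: "infinite (UNIV - {0, -1 :: complex})" "infinite {y :: complex. y \<noteq> 0}"
    using infinite_nonzero_complex by (simp_all add: Diff_infinite_finite infinite_UNIV_char_0)
  have "ev2 (coeff P k) x y = 0" if "x \<in> UNIV - {0, -1}" "y \<in> {y. y \<noteq> 0}" for x y
  proof -
    have "map_poly (\<lambda>q. ev2 q x y) P = 0"
      using assms that by (simp add: ev3_altdef flip: poly_all_0_iff_0)
    then show ?thesis by (metis coeff_0 coeff_map_poly ev2_simps(1))
  qed
  then have "coeff P k = 0" using ev2_zero[OF inf(1), of "\<lambda>_. {y. y \<noteq> 0}"] inf(2) by blast
  then show "coeff P k = coeff 0 k" by simp
qed

lemma function_ring_power_int:
  assumes "function_ring K" "f \<in> K" "(\<lambda>p. 1 / f p) \<in> K"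
  shows "(\<lambda>p. f p powi i) \<in> K"
proof (cases "i \<ge> 0")
  case True
  then show ?thesis using function_ring_power[OF assms(1,2)] by (simp add: power_int_def)
next
  case False
  then show ?thesis using function_ring_power[OF assms(1,3), of "nat (- i)"] by (simp add: power_int_def inverse_eq_divide)
qed

section \<open>Parametrisation of the locus where all three coordinates are invertible\<close>

locale bp_torsor_coprime = bp_torsor +
  assumes coprime: "coprime a b" "coprime a c" "coprime b c"
begin

definition Xs :: "(complex ^ 5) set" where "Xs = {p \<in> X. p $ 1 \<noteq> 0 \<and> p $ 2 \<noteq> 0 \<and> p $ 3 \<noteq> 0}"

lemma XsD: "p \<in> Xs \<Longrightarrow> p \<in> X" "p \<in> Xs \<Longrightarrow> p $ 1 \<noteq> 0" "p \<in> Xs \<Longrightarrow> p $ 2 \<noteq> 0" "p \<in> Xs \<Longrightarrow> p $ 3 \<noteq> 0"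
  by (simp_all add: Xs_def)

text \<open>The degree of \<open>x, y, z\<close> being \<open>bc, ac, ab\<close>, the functions \<open>x\<^sup>a\<close>, \<open>y\<^sup>b\<close>, \<open>z\<^sup>c\<close> have the same degree
  and some Laurent monomial \<open>T\<close> in \<open>x, y, z\<close> has degree one. The exponents below make
  \<open>x = T\<^sup>b\<^sup>c w\<^sup>p\<^sup>1 (- 1 - w)\<^sup>q\<^sup>1\<close> and its analogues parametrise the surface by \<open>w = y\<^sup>b / x\<^sup>a\<close> and \<open>T\<close>.\<close>

lemma exponents:
  obtains p1 p2 p3 q1 q2 q3 :: nat where "b * p2 = a * p1 + 1" "c * p3 = a * p1" "b * q2 = a * q1" "c * q3 = a * q1 + 1"
proof -
  have "coprime b (a * c)" "coprime c (a * b)" using coprime by (simp_all add: coprime_commute)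
  then obtain p2 p' q3 q' where "b * p2 = a * c * p' + 1" "c * q3 = a * b * q' + 1"
    using bezout_nat[of b "a * c"] bezout_nat[of c "a * b"] pos by auto
  then show ?thesis using that[of p2 "c * p'" "a * p'" "a * q'" "b * q'" q3] by (simp add: mult_ac)
qed

lemma degree_one_monomial:
  obtains i j k :: int where "int (b * c) * i + int (a * c) * j + int (a * b) * k = 1"
proof -
  have "coprime (int (b * c)) (int a)" "coprime (int b) (int c)" using coprime by (simp_all add: coprime_commute)
  then obtain u v s r where "u * int (b * c) + v * int a = 1" "s * int b + r * int c = 1"
    using bezout_int[of "int (b * c)" "int a"] bezout_int[of "int b" "int c"] by auto
  \<comment> \<open>The relation for \<open>b\<close> and \<open>c\<close> is inserted as a factor
    one behind \<open>v * a\<close>, which splits that term into multiples of \<open>ac\<close> and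
    \<open>ab\<close>.\<close>
  moreover have "int (b * c) * u + int (a * c) * (v * r) + int (a * b) * (v * s) =
      u * int (b * c) + v * int a * (s * int b + r * int c)"
    by (simp add: algebra_simps)
  ultimately show ?thesis using that[of u "v * r" "v * s"] by simp
qed

lemma torus_chart:
  obtains w T :: "complex ^ 5 \<Rightarrow> complex" and Xp Yp Zp :: "complex poly poly poly" where
    "w \<in> localised PF5 (\<lambda>p. p $ 1 * p $ 2 * p $ 3) Xs" "T \<in> localised PF5 (\<lambda>p. p $ 1 * p $ 2 * p $ 3) Xs"
    "\<And>p. p \<in> Xs \<Longrightarrow> ev3 Xp (w p) (T p) (p $ 5) = p $ 1"
    "\<And>p. p \<in> Xs \<Longrightarrow> ev3 Yp (w p) (T p) (p $ 5) = p $ 2"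
    "\<And>p. p \<in> Xs \<Longrightarrow> ev3 Zp (w p) (T p) (p $ 5) = p $ 3"
    "\<And>w' T' v. w' \<noteq> 0 \<Longrightarrow> w' \<noteq> - 1 \<Longrightarrow> T' \<noteq> 0 \<Longrightarrow> \<exists>p\<in>Xs. w p = w' \<and> T p = T' \<and> p $ 5 = v"
proof -
  obtain p1 p2 p3 q1 q2 q3 where ex: "b * p2 = a * p1 + 1" "c * p3 = a * p1" "b * q2 = a * q1" "c * q3 = a * q1 + 1"
    by (rule exponents)
  obtain i j k :: int where ijk: "int (b * c) * i + int (a * c) * j + int (a * b) * k = 1"
    by (rule degree_one_monomial)
  define w where "w p = p $ 2 ^ b / p $ 1 ^ a" for p :: "complex ^ 5"
  \<comment> \<open>On the surface \<open>w2\<close> is \<open>- 1 - w\<close>, so it is a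
    polynomial in \<open>w\<close> although it introduces \<open>z\<close>.\<close>
  define w2 where "w2 p = p $ 3 ^ c / p $ 1 ^ a" for p :: "complex ^ 5"
  \<comment> \<open>Both \<open>w\<close> and \<open>w2\<close> have weight zero, so the weights of
    \<open>x, y, z\<close> are kept. The exponents make \<open>X0^a = Y0^b = Z0^c\<close>: the extra
    factor \<open>w\<close> of \<open>y^b\<close> and the extra factor \<open>w2\<close> of
    \<open>z^c\<close> cancel.\<close>
  define X0 where "X0 p = p $ 1 / (w p ^ p1 * w2 p ^ q1)" for p
  define Y0 where "Y0 p = p $ 2 / (w p ^ p2 * w2 p ^ q2)" for p
  define Z0 where "Z0 p = p $ 3 / (w p ^ p3 * w2 p ^ q3)" for p
  define T where "T p = X0 p powi i * Y0 p powi j * Z0 p powi k" for p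
  define Wp :: "complex poly poly poly" where "Wp = [:[:[:0, 1:]:]:]"
  define Tp :: "complex poly poly poly" where "Tp = [:[:0, 1:]:]"
  define Xp where "Xp = Tp ^ (b * c) * Wp ^ p1 * (- 1 - Wp) ^ q1"
  define Yp where "Yp = Tp ^ (a * c) * Wp ^ p2 * (- 1 - Wp) ^ q2"
  define Zp where "Zp = Tp ^ (a * b) * Wp ^ p3 * (- 1 - Wp) ^ q3"
  have ev: "ev3 Wp w' T' v = w'" "ev3 Tp w' T' v = T'" for w' T' v
    by (simp_all add: Wp_def Tp_def)
  have w2: "w2 p = - 1 - w p" if "p \<in> Xs" for p
  proof -
    have "p $ 3 ^ c = - (p $ 1 ^ a) - p $ 2 ^ b"
      using XsD(1)[OF that] by (simp add: X_variety_iff bp_surface_def proj3_def algebra_simps eq_neg_iff_add_eq_0)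
    then show ?thesis using XsD[OF that] by (simp add: w_def w2_def diff_divide_distrib)
  qed
  have nz: "w p \<noteq> 0" "w2 p \<noteq> 0" "X0 p \<noteq> 0" "Y0 p \<noteq> 0" "Z0 p \<noteq> 0" if "p \<in> Xs" for p
    using XsD[OF that] by (simp_all add: w_def w2_def X0_def Y0_def Z0_def)
  let ?K = "localised PF5 (\<lambda>p. p $ 1 * p $ 2 * p $ 3) Xs"
  have PF3: "(\<lambda>p. p $ 1 * p $ 2 * p $ 3) \<in> PF5" by (intro PF_intros)
  note K = function_ring_localised[OF function_ring_polynomial_functions PF3, of Xs]
  have co: "(\<lambda>p. p $ i) \<in> ?K" for i by (intro localised_superset PF_intros)
  have pf: "(\<lambda>p. p $ 2 * p $ 3) \<in> PF5" "(\<lambda>p. p $ 1 * p $ 3) \<in> PF5" "(\<lambda>p. p $ 1 * p $ 2) \<in> PF5" by (intro PF_intros)+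
  have inv: "(\<lambda>p. 1 / p $ 1) \<in> ?K" "(\<lambda>p. 1 / p $ 2) \<in> ?K" "(\<lambda>p. 1 / p $ 3) \<in> ?K"
    by (rule localised_inverse[OF function_ring_polynomial_functions pf(1), where N = 1], simp_all add: XsD)
      (rule localised_inverse[OF function_ring_polynomial_functions pf(2), where N = 1], simp_all add: XsD,
        rule localised_inverse[OF function_ring_polynomial_functions pf(3), where N = 1], simp_all add: XsD)
  have "(\<lambda>p. p $ 2 ^ b * (1 / p $ 1) ^ a) \<in> ?K" "(\<lambda>p. p $ 3 ^ c * (1 / p $ 1) ^ a) \<in> ?K"
    "(\<lambda>p. p $ 1 ^ a * (1 / p $ 2) ^ b) \<in> ?K" "(\<lambda>p. p $ 1 ^ a * (1 / p $ 3) ^ c) \<in> ?K"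
    by (intro function_ring_intros[OF K] co inv)+
  then have W: "w \<in> ?K" "w2 \<in> ?K" "(\<lambda>p. 1 / w p) \<in> ?K" "(\<lambda>p. 1 / w2 p) \<in> ?K"
    by (simp_all add: w_def[abs_def] w2_def[abs_def] power_divide)
  have "(\<lambda>p. p $ 1 * ((1 / w p) ^ p1 * (1 / w2 p) ^ q1)) \<in> ?K" "(\<lambda>p. 1 / p $ 1 * (w p ^ p1 * w2 p ^ q1)) \<in> ?K"
    "(\<lambda>p. p $ 2 * ((1 / w p) ^ p2 * (1 / w2 p) ^ q2)) \<in> ?K" "(\<lambda>p. 1 / p $ 2 * (w p ^ p2 * w2 p ^ q2)) \<in> ?K"
    "(\<lambda>p. p $ 3 * ((1 / w p) ^ p3 * (1 / w2 p) ^ q3)) \<in> ?K" "(\<lambda>p. 1 / p $ 3 * (w p ^ p3 * w2 p ^ q3)) \<in> ?K"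
    by (intro function_ring_intros[OF K] co inv W)+
  then have XYZ: "X0 \<in> ?K" "(\<lambda>p. 1 / X0 p) \<in> ?K" "Y0 \<in> ?K" "(\<lambda>p. 1 / Y0 p) \<in> ?K" "Z0 \<in> ?K" "(\<lambda>p. 1 / Z0 p) \<in> ?K"
    by (simp_all add: X0_def[abs_def] Y0_def[abs_def] Z0_def[abs_def] power_divide)
  have TK: "T \<in> ?K"
    unfolding T_def[abs_def]
    by (intro function_ring_mult[OF K] function_ring_power_int[OF K] XYZ)
  have pw: "X0 p = T p ^ (b * c) \<and> Y0 p = T p ^ (a * c) \<and> Z0 p = T p ^ (a * b)" if p: "p \<in> Xs" for p
  proof -
    have xs: "p $ 2 ^ b = w p * p $ 1 ^ a" "p $ 3 ^ c = w2 p * p $ 1 ^ a"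
      using XsD[OF p] by (simp_all add: w_def w2_def)
    define E where "E = p $ 1 ^ a / (w p ^ (a * p1) * w2 p ^ (a * q1))"
    have E: "X0 p ^ a = E" "Y0 p ^ b = E" "Z0 p ^ c = E"
      unfolding X0_def Y0_def Z0_def E_def power_divide power_mult_distrib
      using nz[OF p] by (simp_all add: xs mult.commute[of _ a] mult.commute[of _ b] mult.commute[of _ c] ex flip: power_mult)
    \<comment> \<open>For \<open>R\<close> of weight \<open>d\<close>, the \<open>d\<close>-th
      powers of \<open>X0, Y0, Z0\<close> are powers of \<open>R\<close> with the weights as
      exponents. The Bezout relation among the weights then collapses \<open>T^d\<close> to
      \<open>R\<close>.\<close>
    have gen: "R = T p ^ d" if R: "R \<noteq> 0" and Rk: "X0 p ^ d = R ^ (b * c)" "Y0 p ^ d = R ^ (a * c)" "Z0 p ^ d = R ^ (a * b)" for R d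
    proof -
      have "T p ^ d = (X0 p ^ d) powi i * (Y0 p ^ d) powi j * (Z0 p ^ d) powi k"
      proof -
        have "(u powi l) ^ d = (u ^ d) powi l" for u :: complex and l
          by (metis power_int_mult power_int_of_nat mult.commute)
        then show ?thesis by (simp add: T_def power_mult_distrib)
      qed
      also have "\<dots> = R powi (int (b * c) * i) * R powi (int (a * c) * j) * R powi (int (a * b) * k)"
        unfolding Rk by (simp only: power_int_mult power_int_of_nat)
      also have "\<dots> = R powi (int (b * c) * i + int (a * c) * j + int (a * b) * k)"
        using R by (simp add: power_int_add)
      finally show ?thesis using ijk by simp
    qed
    have e: "X0 p ^ (a * l) = E ^ l" "Y0 p ^ (b * l) = E ^ l" "Z0 p ^ (c * l) = E ^ l" for l
      by (simp_all add: power_mult E)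
    have "X0 p = T p ^ (b * c)"
      using nz[OF p] e(1)[of c] e(2)[of c] e(1)[of b] e(3)[of b]
      by (intro gen) (simp_all add: mult_ac)
    moreover have "Y0 p = T p ^ (a * c)"
      using nz[OF p] e(1)[of c] e(2)[of c] e(2)[of a] e(3)[of a]
      by (intro gen) (simp_all add: mult_ac)
    moreover have "Z0 p = T p ^ (a * b)"
      using nz[OF p] e(1)[of b] e(3)[of b] e(2)[of a] e(3)[of a]
      by (intro gen) (simp_all add: mult_ac)
    ultimately show ?thesis by blast
  qed
  have xyz: "ev3 Xp (w p) (T p) (p $ 5) = p $ 1" "ev3 Yp (w p) (T p) (p $ 5) = p $ 2" "ev3 Zp (w p) (T p) (p $ 5) = p $ 3"
    if p: "p \<in> Xs" for p
  proof -
    have e: "p $ 1 = X0 p * w p ^ p1 * w2 p ^ q1" "p $ 2 = Y0 p * w p ^ p2 * w2 p ^ q2" "p $ 3 = Z0 p * w p ^ p3 * w2 p ^ q3"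
      using nz[OF p] by (simp_all add: X0_def Y0_def Z0_def)
    show "ev3 Xp (w p) (T p) (p $ 5) = p $ 1" "ev3 Yp (w p) (T p) (p $ 5) = p $ 2" "ev3 Zp (w p) (T p) (p $ 5) = p $ 3"
      unfolding e Xp_def Yp_def Zp_def ev3_simps ev pw[OF p, THEN conjunct1] pw[OF p, THEN conjunct2, THEN conjunct1]
        pw[OF p, THEN conjunct2, THEN conjunct2] w2[OF p] by simp_all
  qed
  have surj: "\<exists>p\<in>Xs. w p = w' \<and> T p = T' \<and> p $ 5 = v" if d: "w' \<noteq> 0" "w' \<noteq> - 1" "T' \<noteq> 0" for w' T' v
  proof -
    \<comment> \<open>Surjectivity reads the parametrisation backwards; \<open>v\<close> is free
      because it is the fibre coordinate of the first chart.\<close>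
    define w2' where "w2' = - 1 - w'"
    have w2': "w2' \<noteq> 0" using d by (auto simp: w2'_def)
    define x where "x = T' ^ (b * c) * w' ^ p1 * w2' ^ q1"
    define y where "y = T' ^ (a * c) * w' ^ p2 * w2' ^ q2"
    define z where "z = T' ^ (a * b) * w' ^ p3 * w2' ^ q3"
    have nz': "x \<noteq> 0" "y \<noteq> 0" "z \<noteq> 0" using d w2' by (simp_all add: x_def y_def z_def)
    define E where "E = T' ^ (a * b * c) * w' ^ (a * p1) * w2' ^ (a * q1)"
    have E: "x ^ a = E" "y ^ b = w' * E" "z ^ c = w2' * E"
    proof -
      have i: "b * c * a = a * b * c" "a * c * b = a * b * c" "p1 * a = a * p1" "q1 * a = a * q1"
          "p2 * b = a * p1 + 1" "q2 * b = a * q1" "p3 * c = a * p1" "q3 * c = a * q1 + 1"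
        using ex by (simp_all add: mult_ac)
      show "x ^ a = E" "y ^ b = w' * E" "z ^ c = w2' * E"
        unfolding x_def y_def z_def E_def
        by (simp_all only: power_mult_distrib power_mult[symmetric] i ex power_add power_one_right mult_ac)
    qed
    have E0: "E \<noteq> 0" using d w2' by (simp add: E_def)
    have S: "(x, y, z) \<in> S" by (simp add: bp_surface_def E w2'_def algebra_simps)
    define p where "p = chart_x (x, y, z) v"
    have p: "p \<in> X" "p $ 1 = x" "p $ 2 = y" "p $ 3 = z" "p $ 5 = v"
      using cx.ch_in[OF S, of v] nz' by (simp_all add: p_def chart_x_def)
    have ww: "w p = w'" "w2 p = w2'" using E0 by (simp_all add: w_def w2_def p E)
    have "X0 p = T' ^ (b * c)" "Y0 p = T' ^ (a * c)" "Z0 p = T' ^ (a * b)"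
      using d w2' by (simp_all add: X0_def Y0_def Z0_def p ww x_def y_def z_def)
    then have "T p = T' powi (int (b * c) * i) * T' powi (int (a * c) * j) * T' powi (int (a * b) * k)"
      by (simp only: T_def power_int_mult power_int_of_nat)
    also have "\<dots> = T'" using d(3) ijk by (simp flip: power_int_add)
    finally show ?thesis using p nz' ww by (intro bexI[of _ p]) (auto simp: Xs_def)
  qed
  show ?thesis using that[OF W(1) TK xyz surj] .
qed

text \<open>Being prime and not dividing \<open>f\<close>, the coordinate must divide the cofactor
  of \<open>f\<close>. It is then cancelled on the dense locus where the coordinates are
  nonzero.\<close>

lemma cancel_coordinate:
  assumes "f \<in> PF5" "h \<in> PF5" "i = 1 \<or> i = 2 \<or> i = 3" "\<not> dvd_on X (\<lambda>p. p $ i) f"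
    "dvd_on X f (\<lambda>p. p $ i * h p)"
  shows "dvd_on X f h"
proof -
  obtain r where r: "r \<in> PF5" "\<And>p. p \<in> X \<Longrightarrow> p $ i * h p = f p * r p" using assms(5) by (rule dvd_onE) blast
  have "prime_on X (\<lambda>p. p $ i)" using assms(3) prime_x prime_y prime_z coprime by auto
  moreover have "dvd_on X (\<lambda>p. p $ i) (\<lambda>p. f p * r p)"
    by (rule dvd_onI[OF assms(2)]) (simp add: r(2))
  ultimately have "dvd_on X (\<lambda>p. p $ i) r" using assms(1,4) r(1) unfolding prime_on_def by blast
  then obtain r' where r': "r' \<in> PF5" "\<And>p. p \<in> X \<Longrightarrow> r p = p $ i * r' p" by (rule dvd_onE) blast
  have "h p = f p * r' p" if "p \<in> X" for p
  proof (rule X_dense_eq[OF assms(2) function_ring_mult[OF function_ring_polynomial_functions assms(1) r'(1)] _ that])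
    fix p assume p: "p \<in> X" "p $ 1 \<noteq> 0" "p $ 2 \<noteq> 0" "p $ 3 \<noteq> 0"
    then have "p $ i * h p = p $ i * (f p * r' p)" using r(2) r'(2) by (simp add: algebra_simps)
    then show "h p = f p * r' p" using p assms(3) by auto
  qed
  then show ?thesis by (rule dvd_onI[OF r'(1)])
qed

definition coordinate_free :: "(complex ^ 5 \<Rightarrow> complex) \<Rightarrow> bool" where
  "coordinate_free f \<longleftrightarrow> (\<forall>i. i = 1 \<or> i = 2 \<or> i = 3 \<longrightarrow> \<not> dvd_on X (\<lambda>p. p $ i) f)"

lemma cancel_monomial:
  assumes "\<mu> \<in> coord_monomials" "f \<in> PF5" "coordinate_free f" "h \<in> PF5" "dvd_on X f (\<lambda>p. \<mu> p * h p)"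
  shows "dvd_on X f h"
  using assms(1,5)
proof induction
  case (x \<mu>)
  have "(\<lambda>p. \<mu> p * h p) \<in> PF5" by (intro PF_intros coord_monomials_PF x.hyps assms(4))
  moreover have "dvd_on X f (\<lambda>p. p $ 1 * (\<mu> p * h p))" using x.prems by (simp add: mult.assoc)
  ultimately have "dvd_on X f (\<lambda>p. \<mu> p * h p)"
    using assms(3) cancel_coordinate[OF assms(2), of "\<lambda>p. \<mu> p * h p" 1] by (simp add: coordinate_free_def)
  then show ?case by (rule x.IH)
next
  case (y \<mu>)
  have "(\<lambda>p. \<mu> p * h p) \<in> PF5" by (intro PF_intros coord_monomials_PF y.hyps assms(4))
  moreover have "dvd_on X f (\<lambda>p. p $ 2 * (\<mu> p * h p))" using y.prems by (simp add: mult.assoc)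
  ultimately have "dvd_on X f (\<lambda>p. \<mu> p * h p)"
    using assms(3) cancel_coordinate[OF assms(2), of "\<lambda>p. \<mu> p * h p" 2] by (simp add: coordinate_free_def)
  then show ?case by (rule y.IH)
next
  case (z \<mu>)
  have "(\<lambda>p. \<mu> p * h p) \<in> PF5" by (intro PF_intros coord_monomials_PF z.hyps assms(4))
  moreover have "dvd_on X f (\<lambda>p. p $ 3 * (\<mu> p * h p))" using z.prems by (simp add: mult.assoc)
  ultimately have "dvd_on X f (\<lambda>p. \<mu> p * h p)"
    using assms(3) cancel_coordinate[OF assms(2), of "\<lambda>p. \<mu> p * h p" 3] by (simp add: coordinate_free_def)
  then show ?case by (rule z.IH)
qed simp

text \<open>The exponent is the largest for which the power divides \<open>f\<close>; it exists by
  \<open>bounded_x\<close>, \<open>bounded_y\<close> and \<open>bounded_z\<close>.\<close>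

lemma split_coordinate:
  assumes "f \<in> PF5" "p \<in> X" "f p \<noteq> 0" "i = 1 \<or> i = 2 \<or> i = 3"
  obtains k g where "g \<in> PF5" "\<And>p. p \<in> X \<Longrightarrow> f p = p $ i ^ k * g p" "\<not> dvd_on X (\<lambda>p. p $ i) g"
proof -
  have "\<exists>k. \<not> dvd_on X (\<lambda>p. p $ i ^ k) f"
    using bounded_x[OF assms(1) _ assms(2)] bounded_y[OF assms(1) _ assms(2)] bounded_z[OF assms(1) _ assms(2)] assms(3,4)
    by blast
  moreover have "dvd_on X (\<lambda>p. p $ i ^ 0) f" by (rule dvd_onI[OF assms(1)]) simp
  ultimately obtain k where k: "dvd_on X (\<lambda>p. p $ i ^ k) f" "\<not> dvd_on X (\<lambda>p. p $ i ^ Suc k) f"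
    using nat_induct[of "\<lambda>k. dvd_on X (\<lambda>p. p $ i ^ k) f"] by blast
  from k(1) obtain g where g: "g \<in> PF5" "\<And>p. p \<in> X \<Longrightarrow> f p = p $ i ^ k * g p" by (rule dvd_onE) blast
  have "\<not> dvd_on X (\<lambda>p. p $ i) g"
  proof
    assume "dvd_on X (\<lambda>p. p $ i) g"
    then obtain h where h: "h \<in> PF5" "\<And>p. p \<in> X \<Longrightarrow> g p = p $ i * h p" by (rule dvd_onE) blast
    have "dvd_on X (\<lambda>p. p $ i ^ Suc k) f" by (rule dvd_onI[OF h(1)]) (simp add: g(2) h(2))
    then show False using k(2) by simp
  qed
  then show ?thesis using that g by blast
qed

lemma not_dvd_on_cofactor:
  assumes "\<not> dvd_on X u f" "\<And>p. p \<in> X \<Longrightarrow> f p = v p * g p" "v \<in> PF5"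
  shows "\<not> dvd_on X u g"
proof
  assume "dvd_on X u g"
  then obtain h where h: "h \<in> PF5" "\<And>p. p \<in> X \<Longrightarrow> g p = u p * h p" by (rule dvd_onE) blast
  have "dvd_on X u f"
    by (rule dvd_onI[OF function_ring_mult[OF function_ring_polynomial_functions assms(3) h(1)]])
      (simp add: assms(2) h(2))
  then show False using assms(1) by simp
qed

lemma split_monomial:
  assumes "f \<in> PF5" "p \<in> X" "f p \<noteq> 0"
  obtains \<mu> g where "\<mu> \<in> coord_monomials" "g \<in> PF5" "\<And>p. p \<in> X \<Longrightarrow> f p = \<mu> p * g p" "coordinate_free g"
proof -
  obtain k1 g1 where 1: "g1 \<in> PF5" "\<And>p. p \<in> X \<Longrightarrow> f p = p $ 1 ^ k1 * g1 p" "\<not> dvd_on X (\<lambda>p. p $ 1) g1"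
    by (rule split_coordinate[OF assms, of 1]) auto
  have n1: "g1 p \<noteq> 0" using 1(2)[OF assms(2)] assms(3) by auto
  obtain k2 g2 where 2: "g2 \<in> PF5" "\<And>p. p \<in> X \<Longrightarrow> g1 p = p $ 2 ^ k2 * g2 p" "\<not> dvd_on X (\<lambda>p. p $ 2) g2"
    by (rule split_coordinate[OF 1(1) assms(2) n1, of 2]) auto
  have n2: "g2 p \<noteq> 0" using 2(2)[OF assms(2)] n1 by auto
  obtain k3 g3 where 3: "g3 \<in> PF5" "\<And>p. p \<in> X \<Longrightarrow> g2 p = p $ 3 ^ k3 * g3 p" "\<not> dvd_on X (\<lambda>p. p $ 3) g3"
    by (rule split_coordinate[OF 2(1) assms(2) n2, of 3]) auto
  have pw: "(\<lambda>p. p $ 2 ^ k2) \<in> PF5" "(\<lambda>p. p $ 3 ^ k3) \<in> PF5" by (intro PF_intros)+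
  have "\<not> dvd_on X (\<lambda>p. p $ 1) g3"
    by (rule not_dvd_on_cofactor[OF not_dvd_on_cofactor[OF 1(3) 2(2) pw(1)] 3(2) pw(2)])
  moreover have "\<not> dvd_on X (\<lambda>p. p $ 2) g3" by (rule not_dvd_on_cofactor[OF 2(3) 3(2) pw(2)])
  ultimately have "coordinate_free g3" using 3(3) unfolding coordinate_free_def by blast
  moreover have "(\<lambda>p. p $ 1 ^ k1 * (p $ 2 ^ k2 * p $ 3 ^ k3)) \<in> coord_monomials"
    by (intro coord_monomials_mult coord_monomials_power coord_monomials_coord)
  ultimately show ?thesis using 1 2 3 
    by (intro that[of "\<lambda>p. p $ 1 ^ k1 * (p $ 2 ^ k2 * p $ 3 ^ k3)" g3]) (simp_all add: mult_ac)
qed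

end

section \<open>Transfer between the coordinate ring and the polynomial ring in
  \<open>w, T, v\<close>\<close>

locale torus_chart = bp_torsor_coprime +
  fixes w T :: "complex ^ 5 \<Rightarrow> complex" and Xp Yp Zp :: "complex poly poly poly"
  assumes wT: "w \<in> localised PF5 (\<lambda>p. p $ 1 * p $ 2 * p $ 3) Xs" "T \<in> localised PF5 (\<lambda>p. p $ 1 * p $ 2 * p $ 3) Xs"
    and Xp: "\<And>p. p \<in> Xs \<Longrightarrow> ev3 Xp (w p) (T p) (p $ 5) = p $ 1"
    and Yp: "\<And>p. p \<in> Xs \<Longrightarrow> ev3 Yp (w p) (T p) (p $ 5) = p $ 2"
    and Zp: "\<And>p. p \<in> Xs \<Longrightarrow> ev3 Zp (w p) (T p) (p $ 5) = p $ 3"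
    and wT_surj: "\<And>w' T' v. w' \<noteq> 0 \<Longrightarrow> w' \<noteq> - 1 \<Longrightarrow> T' \<noteq> 0 \<Longrightarrow> \<exists>p\<in>Xs. w p = w' \<and> T p = T' \<and> p $ 5 = v"
begin

definition E :: "complex poly poly poly \<Rightarrow> complex ^ 5 \<Rightarrow> complex" where
  "E q p = ev3 q (w p) (T p) (p $ 5)"

lemma E_simps [simp]: "E 1 p = 1" "E 0 p = 0" "E (q * r) p = E q p * E r p" "E (q - r) p = E q p - E r p" "E (q ^ k) p = E q p ^ k"
  by (simp_all add: E_def)

lemma E_coord: "p \<in> Xs \<Longrightarrow> E Xp p = p $ 1" "p \<in> Xs \<Longrightarrow> E Yp p = p $ 2" "p \<in> Xs \<Longrightarrow> E Zp p = p $ 3"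
  by (simp_all add: E_def Xp Yp Zp)

lemma E_zero: "(\<And>p. p \<in> Xs \<Longrightarrow> E q p = 0) \<Longrightarrow> q = 0"
  by (rule ev3_zero) (use wT_surj in \<open>metis E_def\<close>)

lemma E_eq: "(\<And>p. p \<in> Xs \<Longrightarrow> E q p = E r p) \<Longrightarrow> q = r"
  using E_zero[of "q - r"] by simp

lemma monomial_E:
  assumes "\<mu> \<in> coord_monomials"
  obtains M where "\<And>p. p \<in> Xs \<Longrightarrow> E M p = \<mu> p"
proof -
  have "\<exists>M. \<forall>p\<in>Xs. E M p = \<mu> p"
    using assms
  proof induction
    case one
    show ?case by (rule exI[of _ 1]) simp
  next
    case (x \<mu>)
    then obtain M where "\<forall>p\<in>Xs. E M p = \<mu> p" by blast
    then show ?case by (intro exI[of _ "Xp * M"]) (simp add: E_coord)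
  next
    case (y \<mu>)
    then obtain M where "\<forall>p\<in>Xs. E M p = \<mu> p" by blast
    then show ?case by (intro exI[of _ "Yp * M"]) (simp add: E_coord)
  next
    case (z \<mu>)
    then obtain M where "\<forall>p\<in>Xs. E M p = \<mu> p" by blast
    then show ?case by (intro exI[of _ "Zp * M"]) (simp add: E_coord)
  qed
  then show ?thesis using that by blast
qed

text \<open>In the localisation at the coordinates, \<open>f\<close> and \<open>q\<close> differ by
  a quotient of coordinate monomials. Factorisations only need this looser relation, and it avoids
  fractions.\<close>

definition corresponds :: "(complex ^ 5 \<Rightarrow> complex) \<Rightarrow> complex poly poly poly \<Rightarrow> bool" where
  "corresponds f q \<longleftrightarrow> (\<exists>\<mu>\<in>coord_monomials. \<exists>\<nu>\<in>coord_monomials. \<forall>p\<in>Xs. \<mu> p * f p = \<nu> p * E q p)"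

lemma correspondsI:
  "\<mu> \<in> coord_monomials \<Longrightarrow> \<nu> \<in> coord_monomials \<Longrightarrow> (\<And>p. p \<in> Xs \<Longrightarrow> \<mu> p * f p = \<nu> p * E q p) \<Longrightarrow> corresponds f q"
  unfolding corresponds_def by blast

lemma correspondsE:
  assumes "corresponds f q"
  obtains \<mu> \<nu> where "\<mu> \<in> coord_monomials" "\<nu> \<in> coord_monomials" "\<And>p. p \<in> Xs \<Longrightarrow> \<mu> p * f p = \<nu> p * E q p"
  using assms unfolding corresponds_def by blast

lemma monomial_nonzero: "\<mu> \<in> coord_monomials \<Longrightarrow> p \<in> Xs \<Longrightarrow> \<mu> p \<noteq> 0"
  using coord_monomials_nonzero XsD by blast

lemma Xs_eq:
  assumes "f \<in> PF5" "g \<in> PF5" "\<And>p. p \<in> Xs \<Longrightarrow> f p = g p" "p \<in> X"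
  shows "f p = g p"
  using X_dense_eq[OF assms(1,2) _ assms(4)] assms(3) by (simp add: Xs_def)

lemma corresponds_mult:
  assumes "corresponds f q" "corresponds g r" shows "corresponds (\<lambda>p. f p * g p) (q * r)"
proof -
  obtain \<mu> \<nu> where 1: "\<mu> \<in> coord_monomials" "\<nu> \<in> coord_monomials" "\<And>p. p \<in> Xs \<Longrightarrow> \<mu> p * f p = \<nu> p * E q p"
    using correspondsE[OF assms(1)] by blast
  obtain \<mu>' \<nu>' where 2: "\<mu>' \<in> coord_monomials" "\<nu>' \<in> coord_monomials" "\<And>p. p \<in> Xs \<Longrightarrow> \<mu>' p * g p = \<nu>' p * E r p"
    using correspondsE[OF assms(2)] by blast
  show ?thesis
  proof (rule correspondsI[OF coord_monomials_mult[OF 1(1) 2(1)] coord_monomials_mult[OF 1(2) 2(2)]])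
    fix p assume p: "p \<in> Xs"
    have "\<mu> p * \<mu>' p * (f p * g p) = (\<mu> p * f p) * (\<mu>' p * g p)" by simp
    also have "\<dots> = (\<nu> p * E q p) * (\<nu>' p * E r p)" using 1(3) 2(3) p by simp
    finally show "\<mu> p * \<mu>' p * (f p * g p) = \<nu> p * \<nu>' p * E (q * r) p" by simp
  qed
qed

text \<open>A power of \<open>x\<close> removes \<open>u\<close> through the first chart; what
  remains is a polynomial in \<open>x, y, z, v\<close>, and \<open>x, y, z\<close> are polynomials
  in \<open>w\<close> and \<open>T\<close>.\<close>

lemma corresponds_exists:
  assumes "f \<in> PF5" obtains q where "corresponds f q"
proof -
  obtain N P where P: "\<And>q t. fst q \<noteq> 0 \<Longrightarrow> fst q ^ N * f (chart_x q t) = ev4 P q t" using cx.chE[OF assms] by blast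
  have ring: "function_ring (range E)"
  proof (rule function_ringI)
    show "(\<lambda>p. k) \<in> range E" for k by (rule range_eqI[of _ _ "[:[:[:k:]:]:]"]) (simp add: E_def fun_eq_iff)
    fix f g assume "f \<in> range E" "g \<in> range E"
    then obtain q r where fg: "f = E q" "g = E r" by blast
    show "(\<lambda>p. f p + g p) \<in> range E" unfolding fg by (rule range_eqI[of _ _ "q + r"]) (simp add: E_def fun_eq_iff)
    show "(\<lambda>p. f p * g p) \<in> range E" unfolding fg by (rule range_eqI[of _ _ "q * r"]) (simp add: fun_eq_iff)
  qed
  have "(\<lambda>p. p $ 5) \<in> range E" by (rule range_eqI[of _ _ "[:0, 1:]"]) (simp add: E_def fun_eq_iff)
  then have "(\<lambda>p. ev4 P (E Xp p, E Yp p, E Zp p) (p $ 5)) \<in> range E"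
    by (intro ev4_comp[OF ring] pol3_comp[OF ring]) auto
  then obtain q where q: "\<And>p. ev4 P (E Xp p, E Yp p, E Zp p) (p $ 5) = E q p" by (auto simp: fun_eq_iff)
  have "corresponds f q"
  proof (rule correspondsI[OF coord_monomials_power[OF coord_monomials_coord(1), of N] coord_monomials.one])
    fix p assume p: "p \<in> Xs"
    have "chart_x (proj3 p) (p $ 5) = p" using cx.ch_surj[OF XsD(1)[OF p]] XsD(2)[OF p] by (simp add: proj3_def)
    then have "p $ 1 ^ N * f p = ev4 P (proj3 p) (p $ 5)"
      using P[of "proj3 p" "p $ 5"] XsD[OF p] by (simp add: proj3_def)
    then show "p $ 1 ^ N * f p = 1 * E q p" using q[of p] p by (simp add: E_coord proj3_def)
  qed
  then show ?thesis using that by blast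
qed

lemma corresponds_exists':
  obtains f where "f \<in> PF5" "corresponds f q"
proof -
  have PF3: "(\<lambda>p. p $ 1 * p $ 2 * p $ 3) \<in> PF5" by (intro PF_intros)
  note K = function_ring_localised[OF function_ring_polynomial_functions PF3, of Xs]
  have "(\<lambda>p. E q p) \<in> localised PF5 (\<lambda>p. p $ 1 * p $ 2 * p $ 3) Xs"
    unfolding E_def by (intro ev3_comp[OF K] wT localised_superset PF_intros)
  then obtain N f where f: "f \<in> PF5" "\<And>p. p \<in> Xs \<Longrightarrow> (p $ 1 * p $ 2 * p $ 3) ^ N * E q p = f p"
    by (rule localisedE) blast
  have "(\<lambda>p. (p $ 1 * p $ 2 * p $ 3) ^ N) \<in> coord_monomials"
    by (intro coord_monomials_power coord_monomials_mult coord_monomials_coord)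
  from correspondsI[OF coord_monomials.one this, of f q] f show ?thesis using that by simp
qed

lemma corresponds_zero:
  assumes "f \<in> PF5" "corresponds f 0" "p \<in> X" shows "f p = 0"
proof -
  obtain \<mu> \<nu> where 1: "\<mu> \<in> coord_monomials" "\<nu> \<in> coord_monomials" "\<And>p. p \<in> Xs \<Longrightarrow> \<mu> p * f p = \<nu> p * E 0 p"
    using correspondsE[OF assms(2)] by blast
  have "f p = 0" if "p \<in> Xs" for p using 1(3)[OF that] monomial_nonzero[OF 1(1) that] by simp
  then show ?thesis using X_dense[OF assms(1) _ assms(3)] by (simp add: Xs_def)
qed

lemma corresponds_nonzero:
  assumes "corresponds f q" "q \<noteq> 0" obtains p where "p \<in> X" "f p \<noteq> 0"
proof -
  obtain \<mu> \<nu> where 1: "\<mu> \<in> coord_monomials" "\<nu> \<in> coord_monomials" "\<And>p. p \<in> Xs \<Longrightarrow> \<mu> p * f p = \<nu> p * E q p"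
    using correspondsE[OF assms(1)] by blast
  obtain p where p: "p \<in> Xs" "E q p \<noteq> 0" using E_zero assms(2) by blast
  then have "f p \<noteq> 0" using 1(3)[OF p(1)] monomial_nonzero[OF 1(2) p(1)] by auto
  then show ?thesis using that p XsD by blast
qed

lemma X_domain:
  assumes "f \<in> PF5" "g \<in> PF5" "\<And>p. p \<in> X \<Longrightarrow> f p * g p = 0"
  shows "(\<forall>p\<in>X. f p = 0) \<or> (\<forall>p\<in>X. g p = 0)"
proof -
  obtain q where q: "corresponds f q" using corresponds_exists[OF assms(1)] .
  obtain r where r: "corresponds g r" using corresponds_exists[OF assms(2)] .
  have "q * r = 0"
  proof (rule ccontr)
    assume "q * r \<noteq> 0"
    then show False using corresponds_nonzero[OF corresponds_mult[OF q r]] assms(3) by metis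
  qed
  then show ?thesis using corresponds_zero q r assms(1,2) by auto
qed

text \<open>Since \<open>E\<close> is injective, an equality of functions on \<open>Xs\<close>
  becomes an identity of polynomials, where unique factorisation is available.\<close>

lemma corresponds_unique:
  assumes "corresponds f q" "corresponds f q'"
  obtains M M' \<mu> \<mu>' where "\<mu> \<in> coord_monomials" "\<mu>' \<in> coord_monomials" "\<And>p. p \<in> Xs \<Longrightarrow> E M p = \<mu> p"
    "\<And>p. p \<in> Xs \<Longrightarrow> E M' p = \<mu>' p" "M * q = M' * q'"
proof -
  obtain \<mu> \<nu> where 1: "\<mu> \<in> coord_monomials" "\<nu> \<in> coord_monomials" "\<And>p. p \<in> Xs \<Longrightarrow> \<mu> p * f p = \<nu> p * E q p"
    using correspondsE[OF assms(1)] by blast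
  obtain \<mu>' \<nu>' where 2: "\<mu>' \<in> coord_monomials" "\<nu>' \<in> coord_monomials" "\<And>p. p \<in> Xs \<Longrightarrow> \<mu>' p * f p = \<nu>' p * E q' p"
    using correspondsE[OF assms(2)] by blast
  have m: "(\<lambda>p. \<mu>' p * \<nu> p) \<in> coord_monomials" "(\<lambda>p. \<mu> p * \<nu>' p) \<in> coord_monomials"
    by (intro coord_monomials_mult 1 2)+
  obtain M where M: "\<And>p. p \<in> Xs \<Longrightarrow> E M p = \<mu>' p * \<nu> p" using monomial_E[OF m(1)] by blast
  obtain M' where M': "\<And>p. p \<in> Xs \<Longrightarrow> E M' p = \<mu> p * \<nu>' p" using monomial_E[OF m(2)] by blast
  have "M * q = M' * q'"
  proof (rule E_eq)
    fix p assume p: "p \<in> Xs"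
    have "E (M * q) p = \<mu>' p * (\<mu> p * f p)" using p by (simp add: M 1(3))
    also have "\<dots> = \<mu> p * (\<mu>' p * f p)" by simp
    also have "\<dots> = E (M' * q') p" using p by (simp add: M' 2(3))
    finally show "E (M * q) p = E (M' * q') p" .
  qed
  then show ?thesis using that[OF m M M'] by blast
qed

lemma corresponds_monomial:
  assumes "\<mu> \<in> coord_monomials" "\<And>p. p \<in> Xs \<Longrightarrow> E M p = \<mu> p"
  shows "corresponds (\<lambda>p. 1) M"
  by (rule correspondsI[OF assms(1) coord_monomials.one]) (simp add: assms(2))

text \<open>Divisibility in the polynomial ring gives divisibility up to a coordinate monomial, and
  \<open>cancel_monomial\<close> removes the monomial because no coordinate divides
  \<open>f\<close>.\<close>

lemma dvd_of_dvd:
  assumes "f \<in> PF5" "g \<in> PF5" "coordinate_free f" "corresponds f q" "corresponds g (q * r)"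
  shows "dvd_on X f g"
proof -
  obtain h where h: "h \<in> PF5" "corresponds h r" using corresponds_exists'[of r] by blast
  obtain \<mu> \<nu> where 1: "\<mu> \<in> coord_monomials" "\<nu> \<in> coord_monomials"
    "\<And>p. p \<in> Xs \<Longrightarrow> \<mu> p * (f p * h p) = \<nu> p * E (q * r) p"
    using correspondsE[OF corresponds_mult[OF assms(4) h(2)]] by blast
  obtain \<mu>' \<nu>' where 2: "\<mu>' \<in> coord_monomials" "\<nu>' \<in> coord_monomials" "\<And>p. p \<in> Xs \<Longrightarrow> \<mu>' p * g p = \<nu>' p * E (q * r) p"
    using correspondsE[OF assms(5)] by blast
  have m: "(\<lambda>p. \<mu>' p * \<nu> p) \<in> coord_monomials" by (intro coord_monomials_mult 1 2)
  have "(\<lambda>p. \<mu> p * \<nu>' p * h p) \<in> PF5" by (intro PF_intros coord_monomials_PF 1 2 h)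
  moreover have "\<mu>' p * \<nu> p * g p = f p * (\<mu> p * \<nu>' p * h p)" if "p \<in> X" for p
  proof (rule Xs_eq[OF _ _ _ that])
    show "(\<lambda>p. \<mu>' p * \<nu> p * g p) \<in> PF5" "(\<lambda>p. f p * (\<mu> p * \<nu>' p * h p)) \<in> PF5"
      by (intro PF_intros coord_monomials_PF 1 2 h assms)+
    fix p assume p: "p \<in> Xs"
    have "\<mu>' p * \<nu> p * g p = \<nu> p * (\<mu>' p * g p)" by simp
    also have "\<dots> = \<nu>' p * (\<nu> p * E (q * r) p)" using 2(3)[OF p] by simp
    also have "\<dots> = f p * (\<mu> p * \<nu>' p * h p)" unfolding 1(3)[OF p, symmetric] by simp
    finally show "\<mu>' p * \<nu> p * g p = f p * (\<mu> p * \<nu>' p * h p)" .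
  qed
  ultimately have "dvd_on X f (\<lambda>p. \<mu>' p * \<nu> p * g p)" by (rule dvd_onI)
  then show ?thesis by (rule cancel_monomial[OF m assms(1,3,2)])
qed

text \<open>The descent step of Nagata's criterion: primality survives the return from the
  localisation once all coordinate factors have been removed.\<close>

lemma prime_of_prime_elem:
  assumes "f \<in> PF5" "coordinate_free f" "corresponds f q" "prime_elem q"
  shows "prime_on X f"
  unfolding prime_on_def
proof (intro ballI impI)
  fix g h assume gh: "g \<in> PF5" "h \<in> PF5" "dvd_on X f (\<lambda>p. g p * h p)"
  obtain r where r: "r \<in> PF5" "\<And>p. p \<in> X \<Longrightarrow> g p * h p = f p * r p" using gh(3) by (rule dvd_onE) blast
  obtain G where G: "corresponds g G" using corresponds_exists[OF gh(1)] .
  obtain H where H: "corresponds h H" using corresponds_exists[OF gh(2)] .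
  obtain R where R: "corresponds r R" using corresponds_exists[OF r(1)] .
  have "corresponds (\<lambda>p. f p * r p) (G * H)"
  proof -
    obtain \<mu> \<nu> where 1: "\<mu> \<in> coord_monomials" "\<nu> \<in> coord_monomials"
      "\<And>p. p \<in> Xs \<Longrightarrow> \<mu> p * (g p * h p) = \<nu> p * E (G * H) p"
      using correspondsE[OF corresponds_mult[OF G H]] by blast
    show ?thesis by (rule correspondsI[OF 1(1,2)]) (metis 1(3) r(2) XsD(1))
  qed
  from corresponds_unique[OF this corresponds_mult[OF assms(3) R]]
  obtain M M' \<mu> where M: "\<mu> \<in> coord_monomials" "\<And>p. p \<in> Xs \<Longrightarrow> E M p = \<mu> p" "M * (G * H) = M' * (q * R)"
    by metis
  have "q dvd M * (G * H)" unfolding M(3) by simp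
  then consider "q dvd M" | "q dvd G" | "q dvd H" using assms(4) by (auto simp: prime_elem_dvd_mult_iff)
  then show "dvd_on X f g \<or> dvd_on X f h"
  proof cases
    \<comment> \<open>Here \<open>q\<close> divides a coordinate monomial, which is invertible in
      the localisation. Hence \<open>f\<close> divides one and so divides everything.\<close>
    case 1
    then obtain s where "M = q * s" by (rule dvdE)
    then have "dvd_on X f (\<lambda>p. 1)"
      using corresponds_monomial[OF M(1,2)] assms by (intro dvd_of_dvd[of _ _ q s]) (auto intro: PF_intros)
    then obtain e where e: "e \<in> PF5" "\<And>p. p \<in> X \<Longrightarrow> 1 = f p * e p" by (rule dvd_onE) blast
    have "dvd_on X f g"
      by (rule dvd_onI[OF function_ring_mult[OF function_ring_polynomial_functions e(1) gh(1)]])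
        (simp add: e(2)[symmetric] flip: mult.assoc)
    then show ?thesis by simp
  next
    case 2
    then show ?thesis using dvd_of_dvd[OF assms(1) gh(1) assms(2,3)] G by (auto elim!: dvdE)
  next
    case 3
    then show ?thesis using dvd_of_dvd[OF assms(1) gh(2) assms(2,3)] H by (auto elim!: dvdE)
  qed
qed

lemma prime_product_monomial:
  assumes "\<mu> \<in> coord_monomials" "prime_product_on X g" "f \<in> PF5" "g \<in> PF5" "\<And>p. p \<in> X \<Longrightarrow> f p = \<mu> p * g p"
  shows "prime_product_on X f"
proof -
  have step: "prime_product_on X (\<lambda>p. p $ i * (\<mu> p * g p))"
    if "prime_product_on X (\<lambda>p. \<mu> p * g p)" "i = 1 \<or> i = 2 \<or> i = 3" "\<mu> \<in> coord_monomials" for i \<mu>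
  proof (rule prime_product_on.factor[OF _ _ that(1)])
    show "(\<lambda>p. p $ i) \<in> PF5" "(\<lambda>p. p $ i * (\<mu> p * g p)) \<in> PF5"
      by (intro PF_intros assms(4) coord_monomials_PF that(3))+
    show "prime_on X (\<lambda>p. p $ i)"
      using that(2) prime_x prime_y prime_z coprime by auto
  qed simp
  have "prime_product_on X (\<lambda>p. \<mu> p * g p)"
    using assms(1) by induction (use assms(2) step in \<open>auto simp: mult.assoc\<close>)
  \<comment> \<open>\<open>f\<close> equals the product only on the variety, so the last
    introduction rule is reapplied to \<open>f\<close> itself.\<close>
  then show ?thesis
  proof cases
    case unit
    then obtain h where "h \<in> PF5" "\<And>p. p \<in> X \<Longrightarrow> 1 = \<mu> p * g p * h p" by (elim dvd_onE) blast
    then show ?thesis using assms(3,5) by (intro prime_product_on.unit dvd_onI) auto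
  next
    case (factor \<pi> g')
    then show ?thesis using assms(3,5) by (intro prime_product_on.factor[of \<pi> X g' f]) auto
  qed
qed

text \<open>Induction along a prime factorisation in the polynomial ring, a unique factorisation
  domain by Gauss. The claim ranges over all \<open>f\<close> corresponding to \<open>q\<close>,
  since the cofactor met in the inductive step is only known through its correspondence.\<close>

lemma prime_product_exists:
  assumes "f \<in> PF5" "p \<in> X" "f p \<noteq> 0" shows "prime_product_on X f"
proof -
  have "\<forall>f\<in>PF5. corresponds f q \<longrightarrow> (\<exists>p\<in>X. f p \<noteq> 0) \<longrightarrow> prime_product_on X f" for q
  proof (induction q rule: prime_divisors_induct)
    case zero
    then show ?case using corresponds_zero by blast
  next
    case (unit q)
    show ?case
    proof (intro ballI impI)
      fix f assume f: "f \<in> PF5" "corresponds f q" "\<exists>p\<in>X. f p \<noteq> 0"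
      then obtain \<mu> g where g: "\<mu> \<in> coord_monomials" "g \<in> PF5" "\<And>p. p \<in> X \<Longrightarrow> f p = \<mu> p * g p" "coordinate_free g"
        using split_monomial[OF f(1)] by metis
      have gq: "corresponds g q"
      proof -
        obtain \<mu>' \<nu>' where 2: "\<mu>' \<in> coord_monomials" "\<nu>' \<in> coord_monomials" "\<And>p. p \<in> Xs \<Longrightarrow> \<mu>' p * f p = \<nu>' p * E q p"
          using correspondsE[OF f(2)] by blast
        show ?thesis by (rule correspondsI[OF coord_monomials_mult[OF 2(1) g(1)] 2(2)])
          (simp add: XsD(1) mult.assoc flip: 2(3) g(3))
      qed
      obtain r where "1 = q * r" using unit by (rule dvdE)
      then have "corresponds (\<lambda>p. 1) (q * r)"
        by (intro correspondsI[OF coord_monomials.one coord_monomials.one]) (metis E_simps(1))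
      then have "dvd_on X g (\<lambda>p. 1)" using g gq by (intro dvd_of_dvd[of _ _ q r]) (auto intro: PF_intros)
      then have "prime_product_on X g" by (rule prime_product_on.unit[OF g(2)])
      then show "prime_product_on X f" using g f by (intro prime_product_monomial[of \<mu> g f])
    qed
  next
    case (factor q r)
    then have q: "prime_elem q" by simp
    \<comment> \<open>A function corresponding to the prime \<open>q\<close> is stripped of
      coordinate factors; the rest is prime by \<open>prime_of_prime_elem\<close> and divides
      \<open>f\<close> by \<open>dvd_of_dvd\<close>.\<close>
    obtain f0 where f0: "f0 \<in> PF5" "corresponds f0 q" using corresponds_exists'[of q] by blast
    obtain p0 where "p0 \<in> X" "f0 p0 \<noteq> 0" using corresponds_nonzero[OF f0(2)] q by (metis prime_elem_not_zeroI)
    then obtain \<mu>0 f1 where f1: "\<mu>0 \<in> coord_monomials" "f1 \<in> PF5" "\<And>p. p \<in> X \<Longrightarrow> f0 p = \<mu>0 p * f1 p" "coordinate_free f1"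
      using split_monomial[OF f0(1)] by metis
    have f1q: "corresponds f1 q"
    proof -
      obtain \<mu>' \<nu>' where 2: "\<mu>' \<in> coord_monomials" "\<nu>' \<in> coord_monomials" "\<And>p. p \<in> Xs \<Longrightarrow> \<mu>' p * f0 p = \<nu>' p * E q p"
        using correspondsE[OF f0(2)] by blast
      show ?thesis by (rule correspondsI[OF coord_monomials_mult[OF 2(1) f1(1)] 2(2)])
        (simp add: XsD(1) mult.assoc flip: 2(3) f1(3))
    qed
    show ?case
    proof (intro ballI impI)
      fix f assume f: "f \<in> PF5" "corresponds f (q * r)" "\<exists>p\<in>X. f p \<noteq> 0"
      have "dvd_on X f1 f" by (rule dvd_of_dvd[OF f1(2) f(1) f1(4) f1q f(2)])
      then obtain g where g: "g \<in> PF5" "\<And>p. p \<in> X \<Longrightarrow> f p = f1 p * g p" by (rule dvd_onE) blast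
      obtain G where G: "corresponds g G" using corresponds_exists[OF g(1)] .
      have "corresponds f (q * G)"
      proof -
        obtain \<mu> \<nu> where 1: "\<mu> \<in> coord_monomials" "\<nu> \<in> coord_monomials"
          "\<And>p. p \<in> Xs \<Longrightarrow> \<mu> p * (f1 p * g p) = \<nu> p * E (q * G) p"
          using correspondsE[OF corresponds_mult[OF f1q G]] by blast
        show ?thesis by (rule correspondsI[OF 1(1,2)]) (metis 1(3) g(2) XsD(1))
      qed
      from corresponds_unique[OF this f(2)]
      obtain M M' \<mu> \<mu>' where M: "\<mu> \<in> coord_monomials" "\<mu>' \<in> coord_monomials" "\<And>p. p \<in> Xs \<Longrightarrow> E M p = \<mu> p"
        "\<And>p. p \<in> Xs \<Longrightarrow> E M' p = \<mu>' p" "M * (q * G) = M' * (q * r)" by metis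
      \<comment> \<open>Cancelling \<open>q\<close> identifies the cofactor \<open>g\<close> with
        \<open>r\<close> up to coordinate monomials, which admits the induction hypothesis.\<close>
      have "q * (M * G) = q * (M' * r)" using M(5) by (simp add: mult_ac)
      then have MG: "M * G = M' * r" using q by (metis mult_cancel_left prime_elem_not_zeroI)
      have "corresponds g r"
      proof -
        obtain \<alpha> \<beta> where ab: "\<alpha> \<in> coord_monomials" "\<beta> \<in> coord_monomials" "\<And>p. p \<in> Xs \<Longrightarrow> \<alpha> p * g p = \<beta> p * E G p"
          using correspondsE[OF G] by blast
        show ?thesis
        proof (rule correspondsI[OF coord_monomials_mult[OF M(1) ab(1)] coord_monomials_mult[OF ab(2) M(2)]])
          fix p assume p: "p \<in> Xs"
          have "\<mu> p * \<alpha> p * g p = \<beta> p * E (M * G) p" using ab(3)[OF p] M(3)[OF p] by (simp add: mult_ac)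
          then show "\<mu> p * \<alpha> p * g p = \<beta> p * \<mu>' p * E r p" unfolding MG using M(4)[OF p] by (simp add: mult_ac)
        qed
      qed
      moreover have "\<exists>p\<in>X. g p \<noteq> 0" using f(3) g(2) by auto
      ultimately have "prime_product_on X g" using factor g(1) by blast
      then show "prime_product_on X f"
        using prime_of_prime_elem[OF f1(2,4) f1q q] f1(2) f(1) g(2) by (intro prime_product_on.factor[of f1 X g f])
    qed
  qed
  then show ?thesis using corresponds_exists[OF assms(1)] assms by metis
qed

end

section \<open>From prime factorisations to factorial domains\<close>

lemma (in comm_monoid) foldr_mult_commute:
  assumes "set fs \<subseteq> carrier G" "x \<in> carrier G" "u \<in> carrier G"
  shows "foldr (\<otimes>) fs (x \<otimes> u) = x \<otimes> foldr (\<otimes>) fs u"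
proof -
  have "foldr (\<otimes>) fs u \<in> carrier G \<and> foldr (\<otimes>) fs (x \<otimes> u) = x \<otimes> foldr (\<otimes>) fs u"
    using assms by (induction fs) (auto simp: m_lcomm)
  then show ?thesis by blast
qed

text \<open>An irreducible element is associated with the first prime of its factorisation and is
  therefore prime; uniqueness follows from this primeness condition. Units are collected as the
  starting value of the fold.\<close>

lemma (in comm_monoid_cancel) factorial_monoid_if_primes:
  assumes ex: "\<And>a. a \<in> carrier G \<Longrightarrow> \<exists>fs u. set fs \<subseteq> carrier G \<and> (\<forall>p\<in>set fs. Divisibility.prime G p) \<and>
    u \<in> Units G \<and> a = foldr (\<otimes>) fs u"
  shows "factorial_monoid G"
proof (rule factorial_monoidI)
  have fold: "foldr (\<otimes>) fs u = foldr (\<otimes>) fs \<one> \<otimes> u" "foldr (\<otimes>) fs u \<in> carrier G" "foldr (\<otimes>) fs \<one> \<in> carrier G"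
    if "set fs \<subseteq> carrier G" "u \<in> carrier G" for fs u
    using that by (induction fs) (auto simp: m_assoc)
  fix a assume a: "a \<in> carrier G" "a \<notin> Units G"
  obtain fs u where fs: "set fs \<subseteq> carrier G" "\<forall>p\<in>set fs. Divisibility.prime G p" "u \<in> Units G" "a = foldr (\<otimes>) fs u"
    using ex[OF a(1)] by blast
  have "u \<in> carrier G" using fs(3) by (rule Units_closed)
  then have "foldr (\<otimes>) fs \<one> \<sim> a"
    using fold[OF fs(1), of u] fs(3,4) by (intro associated_sym[OF associatedI2[of u]]) auto
  then have "wfactors G fs a" using fs(2) prime_irreducible unfolding wfactors_def by blast
  then show "\<exists>fs. set fs \<subseteq> carrier G \<and> wfactors G fs a" using fs(1) by blast
next
  have "primeness_condition_monoid G"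
  proof
    fix a assume a: "a \<in> carrier G" "Divisibility.irreducible G a"
    obtain fs u where fs: "set fs \<subseteq> carrier G" "\<forall>p\<in>set fs. Divisibility.prime G p" "u \<in> Units G" "a = foldr (\<otimes>) fs u"
      using ex[OF a(1)] by blast
    show "Divisibility.prime G a"
    proof (cases fs)
      case Nil
      then show ?thesis using a(2) fs(3,4) by (simp add: Divisibility.irreducible_def)
    next
      case (Cons p ps)
      have carr: "foldr (\<otimes>) ps u \<in> carrier G"
      proof -
        have "set ps \<subseteq> carrier G" "u \<in> carrier G" using fs(1,3) Cons by auto
        then show ?thesis by (induction ps) auto
      qed
      have p: "p \<in> carrier G" "Divisibility.prime G p" using fs Cons by auto
      have "p divides a" using fs(4) Cons carr unfolding factor_def by auto
      moreover have "a divides p"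
        using a(2) p \<open>p divides a\<close> unfolding Divisibility.irreducible_def properfactor_def Divisibility.prime_def by blast
      ultimately have "p \<sim> a" unfolding associated_def by blast
      then show ?thesis using prime_cong p a(1) by blast
    qed
  qed
  then show "essentially_equal G fs fs'"
    if "a \<in> carrier G" "set fs \<subseteq> carrier G" "set fs' \<subseteq> carrier G" "wfactors G fs a" "wfactors G fs' a" for a fs fs'
    using primeness_condition_monoid.wfactors_unique[OF _ that(4,5,1,2,3)] by blast
qed

lemma restrict_eq_iff: "restrict f V = restrict g V \<longleftrightarrow> (\<forall>p\<in>V. f p = g p)"
  by (auto simp: restrict_def fun_eq_iff)

lemma factorial_variety_if_prime_products:
  assumes "V \<noteq> {}"
    and dom: "\<And>f g. f \<in> polynomial_functions \<Longrightarrow> g \<in> polynomial_functions \<Longrightarrow> (\<And>p. p \<in> V \<Longrightarrow> f p * g p = 0) \<Longrightarrow>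
      (\<forall>p\<in>V. f p = 0) \<or> (\<forall>p\<in>V. g p = 0)"
    and pp: "\<And>f p. f \<in> polynomial_functions \<Longrightarrow> p \<in> V \<Longrightarrow> f p \<noteq> 0 \<Longrightarrow> prime_product_on V f"
  shows "factorial_variety V"
proof -
  let ?R = "coordinate_ring V" and ?M = "mult_of (coordinate_ring V)"
  have car: "carrier ?R = (\<lambda>f. restrict f V) ` polynomial_functions"
    by (simp add: coordinate_ring_def regular_functions_def)
  have zero: "\<zero>\<^bsub>?R\<^esub> = restrict (\<lambda>p. 0) V" and one: "\<one>\<^bsub>?R\<^esub> = restrict (\<lambda>p. 1) V"
    by (simp_all add: coordinate_ring_def)
  have mul: "restrict f V \<otimes>\<^bsub>?R\<^esub> restrict g V = restrict (\<lambda>p. f p * g p) V" for f g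
    by (simp add: coordinate_ring_def restrict_eq_iff)
  have "domain ?R"
  proof (rule domain.intro[OF coordinate_ring_cring], unfold_locales)
    show "\<one>\<^bsub>?R\<^esub> \<noteq> \<zero>\<^bsub>?R\<^esub>" using assms(1) by (auto simp: zero one restrict_eq_iff)
    fix r s assume rs: "r \<otimes>\<^bsub>?R\<^esub> s = \<zero>\<^bsub>?R\<^esub>" "r \<in> carrier ?R" "s \<in> carrier ?R"
    obtain f g where fg: "f \<in> polynomial_functions" "r = restrict f V" "g \<in> polynomial_functions" "s = restrict g V"
      using rs(2,3) by (auto simp: car)
    have "(\<forall>p\<in>V. f p = 0) \<or> (\<forall>p\<in>V. g p = 0)"
      using rs(1) by (intro dom fg) (simp add: fg mul zero restrict_eq_iff)
    then show "r = \<zero>\<^bsub>?R\<^esub> \<or> s = \<zero>\<^bsub>?R\<^esub>" by (simp add: fg zero restrict_eq_iff)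
  qed
  then interpret R: domain ?R .
  have carM: "r \<in> carrier ?M \<longleftrightarrow> (\<exists>f\<in>polynomial_functions. r = restrict f V \<and> (\<exists>p\<in>V. f p \<noteq> 0))" for r
    by (auto simp: car zero restrict_eq_iff)
  \<comment> \<open>Nonvanishing of \<open>g\<close> matters: the multiplicative monoid omits zero,
    so the quotient must be shown to be nonzero too.\<close>
  have div: "restrict f V divides\<^bsub>?M\<^esub> restrict g V \<longleftrightarrow> dvd_on V f g"
    if g: "\<exists>p\<in>V. g p \<noteq> 0" for f g
  proof
    assume "restrict f V divides\<^bsub>?M\<^esub> restrict g V"
    then show "dvd_on V f g"
      by (auto simp: factor_def car mul restrict_eq_iff dvd_on_def)
  next
    assume "dvd_on V f g"
    then obtain h where h: "h \<in> polynomial_functions" "\<And>p. p \<in> V \<Longrightarrow> g p = f p * h p" by (rule dvd_onE) blast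
    have "\<exists>p\<in>V. h p \<noteq> 0" using g h(2) by force
    then have "restrict h V \<in> carrier ?M" using h(1) carM by blast
    moreover have "restrict g V = restrict f V \<otimes>\<^bsub>?M\<^esub> restrict h V" using h(2) by (simp add: mul restrict_eq_iff)
    ultimately show "restrict f V divides\<^bsub>?M\<^esub> restrict g V" unfolding factor_def by blast
  qed
  have one': "\<exists>p\<in>V. (1::complex) \<noteq> 0" using assms(1) by auto
  have units_iff: "restrict f V \<in> Units ?M \<longleftrightarrow> dvd_on V f (\<lambda>p. 1)" if "restrict f V \<in> carrier ?M" for f
    using R.mult_of.Unit_eq_dividesone[OF that] div[OF one'] by (simp add: one)
  have prime: "Divisibility.prime ?M (restrict \<pi> V)"
    if \<pi>: "restrict \<pi> V \<in> carrier ?M" "\<pi> \<in> polynomial_functions" "prime_on V \<pi>" "restrict \<pi> V \<notin> Units ?M" for \<pi>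
    unfolding Divisibility.prime_def
  proof (intro conjI ballI impI)
    show "restrict \<pi> V \<notin> Units ?M" by (rule \<pi>(4))
    fix r s assume rs: "r \<in> carrier ?M" "s \<in> carrier ?M" "restrict \<pi> V divides\<^bsub>?M\<^esub> r \<otimes>\<^bsub>?M\<^esub> s"
    obtain f where f: "f \<in> polynomial_functions" "r = restrict f V" "\<exists>p\<in>V. f p \<noteq> 0" using rs(1) carM by blast
    obtain g where g: "g \<in> polynomial_functions" "s = restrict g V" "\<exists>p\<in>V. g p \<noteq> 0" using rs(2) carM by blast
    have "\<exists>p\<in>V. f p * g p \<noteq> 0" using dom[OF f(1) g(1)] f(3) g(3) by blast
    then have "dvd_on V \<pi> (\<lambda>p. f p * g p)" using rs(3) div by (simp add: f g mul)
    then have "dvd_on V \<pi> f \<or> dvd_on V \<pi> g" using \<pi>(3) f(1) g(1) unfolding prime_on_def by blast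
    then show "restrict \<pi> V divides\<^bsub>?M\<^esub> r \<or> restrict \<pi> V divides\<^bsub>?M\<^esub> s"
      unfolding f(2) g(2) using div f(3) g(3) by blast
  qed
  have "factorial_monoid ?M"
  proof (rule R.mult_of.factorial_monoid_if_primes)
    fix r assume "r \<in> carrier ?M"
    then obtain f where f: "f \<in> polynomial_functions" "r = restrict f V" "\<exists>p\<in>V. f p \<noteq> 0" using carM by blast
    then have "prime_product_on V f" using pp by blast
    then have "\<exists>fs u. set fs \<subseteq> carrier ?M \<and> (\<forall>p\<in>set fs. Divisibility.prime ?M p) \<and> u \<in> Units ?M \<and>
        restrict f V = foldr (\<otimes>\<^bsub>?M\<^esub>) fs u"
      using f(3)
    proof induction
      case (unit f)
      then have "restrict f V \<in> carrier ?M" using carM by blast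
      then have "restrict f V \<in> Units ?M" using unit units_iff by blast
      then show ?case 
        by (intro exI[of _ "[]"] exI[of _ "restrict f V"])
          (simp only: foldr.simps id_apply list.set empty_subsetI ball_empty simp_thms)
    next
      case (factor \<pi> g f)
      have nz: "\<exists>p\<in>V. \<pi> p \<noteq> 0" "\<exists>p\<in>V. g p \<noteq> 0" using factor by auto
      then obtain fs u where fs: "set fs \<subseteq> carrier ?M" "\<forall>p\<in>set fs. Divisibility.prime ?M p" "u \<in> Units ?M"
          "restrict g V = foldr (\<otimes>\<^bsub>?M\<^esub>) fs u"
        using factor.IH by blast
      have \<pi>: "restrict \<pi> V \<in> carrier ?M" using nz factor carM by blast
      have f: "restrict f V = restrict \<pi> V \<otimes>\<^bsub>?M\<^esub> restrict g V" using factor by (simp add: mul restrict_eq_iff)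
      show ?case
      proof (cases "restrict \<pi> V \<in> Units ?M")
        case False
        then show ?thesis
          using fs \<pi> prime[OF \<pi>] factor f by (intro exI[of _ "restrict \<pi> V # fs"] exI[of _ u]) auto
      next
        \<comment> \<open>Units satisfying \<open>prime_on\<close> are no primes of the monoid; they
          are absorbed into the unit \<open>u\<close>.\<close>
        case True
        have "foldr (\<otimes>\<^bsub>?M\<^esub>) fs (restrict \<pi> V \<otimes>\<^bsub>?M\<^esub> u) = restrict f V"
          using R.mult_of.foldr_mult_commute[OF fs(1) \<pi>, of u] R.mult_of.Units_closed[OF fs(3)] f fs(4) by simp
        then show ?thesis
          using fs R.mult_of.Units_m_closed[OF True fs(3)]
          by (intro exI[of _ fs] exI[of _ "restrict \<pi> V \<otimes>\<^bsub>?M\<^esub> u"]) simp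
      qed
    qed
    then show "\<exists>fs u. set fs \<subseteq> carrier ?M \<and> (\<forall>p\<in>set fs. Divisibility.prime ?M p) \<and> u \<in> Units ?M \<and>
        r = foldr (\<otimes>\<^bsub>?R\<^esub>) fs u"
      by (simp add: f(2))
  qed
  then show ?thesis
    unfolding factorial_variety_def factorial_domain_def using R.domain_axioms by blast
qed

context bp_torsor_coprime
begin

lemma torus_chart_exists: "\<exists>w T Xp Yp Zp. torus_chart a b c n m w T Xp Yp Zp"
proof (rule torus_chart)
  fix w T Xp Yp Zp
  assume *: "w \<in> localised PF5 (\<lambda>p. p $ 1 * p $ 2 * p $ 3) Xs" "T \<in> localised PF5 (\<lambda>p. p $ 1 * p $ 2 * p $ 3) Xs"
    "\<And>p. p \<in> Xs \<Longrightarrow> ev3 Xp (w p) (T p) (p $ 5) = p $ 1" "\<And>p. p \<in> Xs \<Longrightarrow> ev3 Yp (w p) (T p) (p $ 5) = p $ 2"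
    "\<And>p. p \<in> Xs \<Longrightarrow> ev3 Zp (w p) (T p) (p $ 5) = p $ 3"
    "\<And>w' T' v. w' \<noteq> 0 \<Longrightarrow> w' \<noteq> - 1 \<Longrightarrow> T' \<noteq> 0 \<Longrightarrow> \<exists>p\<in>Xs. w p = w' \<and> T p = T' \<and> p $ 5 = v"
  have "torus_chart a b c n m w T Xp Yp Zp" by unfold_locales (fact *)+
  then show ?thesis by blast
qed

lemma X_domain:
  assumes "f \<in> PF5" "g \<in> PF5" "\<And>p. p \<in> X \<Longrightarrow> f p * g p = 0"
  shows "(\<forall>p\<in>X. f p = 0) \<or> (\<forall>p\<in>X. g p = 0)"
  using torus_chart_exists torus_chart.X_domain[OF _ assms] by blast

lemma X_prime_product:
  assumes "f \<in> PF5" "p \<in> X" "f p \<noteq> 0" shows "prime_product_on X f"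
  using torus_chart_exists torus_chart.prime_product_exists[OF _ assms] by blast

lemma X_nonempty: "X \<noteq> {}"
proof -
  obtain \<omega> :: complex where "\<omega> ^ c = - 1" using power_neg_one_exists[OF pos(3)] by blast
  then have "mk5 1 0 \<omega> 1 0 \<in> X" using pos by (simp add: X_variety_iff bp_surface_def power_0_left)
  then show ?thesis by blast
qed

theorem X_factorial: "factorial_variety X"
  by (rule factorial_variety_if_prime_products[OF X_nonempty]) (use X_domain X_prime_product in blast)+

end

section \<open>Stable isomorphism\<close>

definition pt5 :: "complex ^ (5 + 1) \<Rightarrow> complex ^ 5" where "pt5 z = (\<chi> i. z $ Inl i)"
definition join6 :: "complex ^ 5 \<Rightarrow> complex \<Rightarrow> complex ^ (5 + 1)" where
  "join6 p t = (\<chi> j. case j of Inl i \<Rightarrow> p $ i | Inr _ \<Rightarrow> t)"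

lemma pt5_join6 [simp]: "pt5 (join6 p t) = p" "join6 p t $ Inr 1 = t"
  by (simp_all add: pt5_def join6_def vec_eq_iff)

lemma join6_pt5 [simp]: "join6 (pt5 z) (z $ Inr 1) = z"
  unfolding vec_eq_iff
proof
  fix i :: "5 + 1"
  show "join6 (pt5 z) (z $ Inr 1) $ i = z $ i"
  proof (cases i)
    case (Inr j)
    have "j = 1" by (rule num1_eq1)
    then show ?thesis by (simp only: Inr join6_def vec_lambda_beta sum.case)
  qed (simp add: join6_def pt5_def)
qed

lemma variety_prod_line: "z \<in> V \<times>\<^sub>v\<^sub>a\<^sub>r affine_line \<longleftrightarrow> pt5 z \<in> V"
  by (simp add: variety_prod_def affine_line_def pt5_def)

lemma pt5_comp: "f \<in> PF5 \<Longrightarrow> (\<lambda>z. f (pt5 z)) \<in> polynomial_functions"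
  by (rule polynomial_functions_comp[OF function_ring_polynomial_functions]) (simp_all add: pt5_def PF_intros)

text \<open>The product of two torsors over the punctured surface, one of them trivialised on the other:
  \<open>(u\<^sub>0, v\<^sub>0)\<close> is a section over \<open>X\<^sub>n\<^sub>,\<^sub>m\<close> of the torsor with exponents \<open>n', m'\<close>.\<close>

definition switch :: "(complex ^ 5 \<Rightarrow> complex) \<Rightarrow> (complex ^ 5 \<Rightarrow> complex) \<Rightarrow> (complex ^ 5 \<Rightarrow> complex) \<Rightarrow>
    (complex ^ 5 \<Rightarrow> complex) \<Rightarrow> nat \<Rightarrow> nat \<Rightarrow> complex ^ (5 + 1) \<Rightarrow> complex ^ (5 + 1)" where
  "switch u0 v0 u0' v0' n' m' z = (let p = pt5 z; t = z $ Inr 1;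
      p' = mk5 (p $ 1) (p $ 2) (p $ 3) (u0 p + p $ 2 ^ n' * t) (v0 p + p $ 1 ^ m' * t)
    in join6 p' (u0' p' * p $ 5 - v0' p' * p $ 4))"

lemma switch_polynomial:
  assumes "u0 \<in> PF5" "v0 \<in> PF5" "u0' \<in> PF5" "v0' \<in> PF5"
  shows "(\<lambda>z. switch u0 v0 u0' v0' n' m' z $ j) \<in> polynomial_functions"
proof -
  have F: "function_ring (polynomial_functions :: (complex ^ (5 + 1) \<Rightarrow> complex) set)"
    by (rule function_ring_polynomial_functions)
  have co: "(\<lambda>z. pt5 z $ i) \<in> polynomial_functions" for i
    by (rule pt5_comp) (rule PF_intros)
  have t: "(\<lambda>z :: complex ^ (5 + 1). z $ Inr 1) \<in> polynomial_functions" by (rule PF_intros)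
  have U: "(\<lambda>z. u0 (pt5 z) + pt5 z $ 2 ^ n' * z $ Inr 1) \<in> polynomial_functions"
    "(\<lambda>z. v0 (pt5 z) + pt5 z $ 1 ^ m' * z $ Inr 1) \<in> polynomial_functions"
    by (intro function_ring_intros[OF F] pt5_comp assms co t)+
  have P: "(\<lambda>z. f (mk5 (pt5 z $ 1) (pt5 z $ 2) (pt5 z $ 3) (u0 (pt5 z) + pt5 z $ 2 ^ n' * z $ Inr 1)
      (v0 (pt5 z) + pt5 z $ 1 ^ m' * z $ Inr 1))) \<in> polynomial_functions" if "f \<in> PF5" for f
    by (rule mk5_comp[OF F co co co U that])
  show ?thesis
  proof (cases j)
    case (Inl i)
    show ?thesis using P[OF polynomial_functions.coord[of i]] by (simp add: switch_def Let_def join6_def Inl)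
  next
    case (Inr k)
    have "(\<lambda>z. u0' (mk5 (pt5 z $ 1) (pt5 z $ 2) (pt5 z $ 3) (u0 (pt5 z) + pt5 z $ 2 ^ n' * z $ Inr 1)
      (v0 (pt5 z) + pt5 z $ 1 ^ m' * z $ Inr 1)) * pt5 z $ 5 -
      v0' (mk5 (pt5 z $ 1) (pt5 z $ 2) (pt5 z $ 3) (u0 (pt5 z) + pt5 z $ 2 ^ n' * z $ Inr 1)
      (v0 (pt5 z) + pt5 z $ 1 ^ m' * z $ Inr 1)) * pt5 z $ 4) \<in> polynomial_functions"
      by (intro function_ring_diff[OF F] function_ring_mult[OF F] P assms co)
    then show ?thesis by (simp add: switch_def Let_def join6_def Inr)
  qed
qed

text \<open>A point of the first product encodes two points in fibres over the same base point, the
  second measured from a section. The map measures the first one from a section over the other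
  factor instead, which is visibly reversible.\<close>

lemma switch_inverse:
  assumes "u0 \<in> PF5" "v0 \<in> PF5" "u0' \<in> PF5" "v0' \<in> PF5"
    and s: "\<And>p. p \<in> X_variety a b c n m \<Longrightarrow> p $ 1 ^ m' * u0 p - p $ 2 ^ n' * v0 p = 1"
    and s': "\<And>p. p \<in> X_variety a b c n' m' \<Longrightarrow> p $ 1 ^ m * u0' p - p $ 2 ^ n * v0' p = 1"
    and z: "pt5 z \<in> X_variety a b c n m"
  shows "pt5 (switch u0 v0 u0' v0' n' m' z) \<in> X_variety a b c n' m'"
    and "switch u0' v0' u0 v0 n m (switch u0 v0 u0' v0' n' m' z) = z"
proof -
  define p where "p = pt5 z"
  define t where "t = z $ Inr 1"
  define p' where "p' = mk5 (p $ 1) (p $ 2) (p $ 3) (u0 p + p $ 2 ^ n' * t) (v0 p + p $ 1 ^ m' * t)"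
  \<comment> \<open>The parameter \<open>s\<close> moves the section \<open>(u0', v0')\<close> to
    \<open>(u, v)\<close>; it is their determinant, because the linear form
    \<open>x^m u - y^n v\<close> equals one on both.\<close>
  define s where "s = u0' p' * p $ 5 - v0' p' * p $ 4"
  have zz: "z = join6 p t" by (simp add: p_def t_def)
  have sw: "switch u0 v0 u0' v0' n' m' z = join6 p' s"
    by (simp add: switch_def Let_def p_def t_def p'_def s_def)
  have p: "p \<in> X_variety a b c n m" using z by (simp add: p_def)
  have e0: "p $ 1 ^ m' * u0 p - p $ 2 ^ n' * v0 p = 1" by (rule assms(5)[OF p])
  have e: "p $ 1 ^ m * p $ 4 - p $ 2 ^ n * p $ 5 = 1" using p by (simp add: X_variety_iff)
  have p': "p' \<in> X_variety a b c n' m'"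
    using p e0 by (simp add: X_variety_iff p'_def proj3_def algebra_simps)
  then show "pt5 (switch u0 v0 u0' v0' n' m' z) \<in> X_variety a b c n' m'" by (simp add: sw)
  have e1: "p $ 1 ^ m * u0' p' - p $ 2 ^ n * v0' p' = 1" using s'[OF p'] by (simp add: p'_def)
  have "u0' p' + p $ 2 ^ n * s = p $ 4"
  proof -
    have "u0' p' + p $ 2 ^ n * s = u0' p' * (1 + p $ 2 ^ n * p $ 5) - p $ 2 ^ n * v0' p' * p $ 4"
      by (simp add: s_def algebra_simps)
    also have "1 + p $ 2 ^ n * p $ 5 = p $ 1 ^ m * p $ 4" using e by (simp add: algebra_simps)
    also have "u0' p' * (p $ 1 ^ m * p $ 4) - p $ 2 ^ n * v0' p' * p $ 4 =
        (p $ 1 ^ m * u0' p' - p $ 2 ^ n * v0' p') * p $ 4" by (simp add: algebra_simps)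
    finally show ?thesis by (simp add: e1)
  qed
  moreover have "v0' p' + p $ 1 ^ m * s = p $ 5"
  proof -
    have "v0' p' + p $ 1 ^ m * s = p $ 1 ^ m * u0' p' * p $ 5 - v0' p' * (p $ 1 ^ m * p $ 4 - 1)"
      by (simp add: s_def algebra_simps)
    also have "p $ 1 ^ m * p $ 4 - 1 = p $ 2 ^ n * p $ 5" using e by (simp add: algebra_simps)
    also have "p $ 1 ^ m * u0' p' * p $ 5 - v0' p' * (p $ 2 ^ n * p $ 5) =
        (p $ 1 ^ m * u0' p' - p $ 2 ^ n * v0' p') * p $ 5" by (simp add: algebra_simps)
    finally show ?thesis by (simp add: e1)
  qed
  moreover have "u0 p * p' $ 5 - v0 p * p' $ 4 = t"
  proof -
    have "u0 p * p' $ 5 - v0 p * p' $ 4 = (p $ 1 ^ m' * u0 p - p $ 2 ^ n' * v0 p) * t"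
      by (simp add: p'_def algebra_simps)
    then show ?thesis by (simp add: e0)
  qed
  moreover have "mk5 (p' $ 1) (p' $ 2) (p' $ 3) (p $ 4) (p $ 5) = p"
    by (simp add: p'_def)
  ultimately have "switch u0' v0' u0 v0 n m (join6 p' s) = join6 p t"
    unfolding switch_def Let_def by (simp add: p'_def)
  then show "switch u0' v0' u0 v0 n m (switch u0 v0 u0' v0' n' m' z) = z" unfolding sw by (simp add: zz)
qed

text \<open>\<open>x\<close> and \<open>y\<close> generate the unit ideal on the affine threefold,
  hence so do any powers of them. The torsor with other exponents thus acquires a section after
  pullback.\<close>

lemma (in bp_torsor) section_exists:
  obtains u0 v0 where "u0 \<in> PF5" "v0 \<in> PF5" "\<And>p. p \<in> X \<Longrightarrow> p $ 1 ^ m' * u0 p - p $ 2 ^ n' * v0 p = 1"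
proof -
  obtain e e' where e: "e \<in> PF5" "e' \<in> PF5" "\<And>p. p \<in> X \<Longrightarrow> p $ 1 ^ m' * e p + p $ 2 ^ n' * e' p = 1"
    using comaximal_on_powers[OF _ _ comaximal_xy, of m' n'] polynomial_functions.coord
    unfolding comaximal_on_def by blast
  have "(\<lambda>p. - e' p) \<in> PF5" by (intro PF_intros e)
  then show ?thesis using that[of e "\<lambda>p. - e' p"] e by simp
qed

lemma stably_isomorphic:
  assumes "bp_torsor a b c n m" "bp_torsor a b c n' m'"
  shows "X_variety a b c n m \<times>\<^sub>v\<^sub>a\<^sub>r affine_line \<cong>\<^sub>v\<^sub>a\<^sub>r X_variety a b c n' m' \<times>\<^sub>v\<^sub>a\<^sub>r affine_line"
proof -
  obtain u0 v0 where 1: "u0 \<in> PF5" "v0 \<in> PF5"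
      "\<And>p. p \<in> X_variety a b c n m \<Longrightarrow> p $ 1 ^ m' * u0 p - p $ 2 ^ n' * v0 p = 1"
    by (rule bp_torsor.section_exists[OF assms(1)]) blast
  obtain u0' v0' where 2: "u0' \<in> PF5" "v0' \<in> PF5"
      "\<And>p. p \<in> X_variety a b c n' m' \<Longrightarrow> p $ 1 ^ m * u0' p - p $ 2 ^ n * v0' p = 1"
    by (rule bp_torsor.section_exists[OF assms(2)]) blast
  note inv = switch_inverse[OF 1(1,2) 2(1,2) 1(3) 2(3)] and inv' = switch_inverse[OF 2(1,2) 1(1,2) 2(3) 1(3)]
  have "morphism (X_variety a b c n m \<times>\<^sub>v\<^sub>a\<^sub>r affine_line) (X_variety a b c n' m' \<times>\<^sub>v\<^sub>a\<^sub>r affine_line) (switch u0 v0 u0' v0' n' m')"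
    unfolding morphism_def regular_functions_def
    using inv(1) switch_polynomial[OF 1(1,2) 2(1,2)] by (auto simp: variety_prod_line)
  moreover have "morphism (X_variety a b c n' m' \<times>\<^sub>v\<^sub>a\<^sub>r affine_line) (X_variety a b c n m \<times>\<^sub>v\<^sub>a\<^sub>r affine_line) (switch u0' v0' u0 v0 n m)"
    unfolding morphism_def regular_functions_def
    using inv'(1) switch_polynomial[OF 2(1,2) 1(1,2)] by (auto simp: variety_prod_line)
  ultimately show ?thesis
    unfolding isomorphic_varieties_def using inv(2) inv'(2) by (metis variety_prod_line)
qed

section \<open>Isomorphisms\<close>

text \<open>The action of the multiplicative group that makes the surface weighted homogeneous of
  degree \<open>abc\<close>. At \<open>s = 0\<close> it contracts everything to the singular
  point.\<close>

definition scale3 :: "nat \<Rightarrow> nat \<Rightarrow> nat \<Rightarrow> complex \<Rightarrow> complex \<times> complex \<times> complex \<Rightarrow> complex \<times> complex \<times> complex" where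
  "scale3 a b c s q = (s ^ (b * c) * fst q, s ^ (a * c) * fst (snd q), s ^ (a * b) * snd (snd q))"

lemma scale3_in: "q \<in> bp_surface a b c \<Longrightarrow> scale3 a b c s q \<in> bp_surface a b c"
proof -
  assume q: "q \<in> bp_surface a b c"
  have "(s ^ (b * c) * x) ^ a + (s ^ (a * c) * y) ^ b + (s ^ (a * b) * z) ^ c = s ^ (a * b * c) * (x ^ a + y ^ b + z ^ c)" for x y z :: complex
    by (simp add: power_mult_distrib algebra_simps flip: power_mult)
  then show ?thesis using q by (auto simp: scale3_def bp_surface_def)
qed

lemma pol3_scale: "f \<in> pol3 \<Longrightarrow> \<exists>p. \<forall>s. poly p s = f (scale3 a b c s q)"
proof -
  assume f: "f \<in> pol3"
  have "(\<lambda>s. s ^ k * w) \<in> range poly" for k and w :: complex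
    by (rule range_eqI[of _ _ "monom w k"]) (simp add: fun_eq_iff poly_monom)
  then have "(\<lambda>s. f (s ^ (b * c) * fst q, s ^ (a * c) * fst (snd q), s ^ (a * b) * snd (snd q))) \<in> range poly"
    by (intro pol3_comp[OF function_ring_poly _ _ _ f])
  then show ?thesis unfolding scale3_def by (auto simp: fun_eq_iff)
qed

text \<open>The coefficient of \<open>s^D\<close> along an orbit is the component of
  \<open>f\<close> of weight \<open>D\<close>, and only one monomial has that weight. The order of
  quantifiers is the point: \<open>k\<close> does not depend on \<open>q\<close>.\<close>

lemma weight_component:
  assumes "f \<in> pol3"
    and mono: "\<And>i j l. b * c * i + a * c * j + a * b * l = D \<longleftrightarrow> i = i0 \<and> j = j0 \<and> l = l0"
  obtains k where "\<And>q p. (\<And>s. poly p s = f (scale3 a b c s q)) \<Longrightarrow>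
    coeff p D = k * (fst q ^ i0 * fst (snd q) ^ j0 * snd (snd q) ^ l0)"
proof -
  \<comment> \<open>The claim is strengthened to all monomial multiples of \<open>f\<close>, so that
    it passes through the Horner form of nested polynomials.\<close>
  define Q where "Q f \<longleftrightarrow> (\<forall>i j l. \<exists>k. \<forall>q. \<exists>p. (\<forall>s. poly p s = fst (scale3 a b c s q) ^ i * fst (snd (scale3 a b c s q)) ^ j *
      snd (snd (scale3 a b c s q)) ^ l * f (scale3 a b c s q)) \<and>
      coeff p D = k * (fst q ^ i0 * fst (snd q) ^ j0 * snd (snd q) ^ l0))" for f
  have const: "Q (\<lambda>q. w)" for w
    unfolding Q_def
  proof (intro allI)
    fix i j l
    let ?d = "b * c * i + a * c * j + a * b * l"
    have "(\<forall>s. poly (monom (w * (fst q ^ i * fst (snd q) ^ j * snd (snd q) ^ l)) ?d) s = fst (scale3 a b c s q) ^ i *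
       fst (snd (scale3 a b c s q)) ^ j * snd (snd (scale3 a b c s q)) ^ l * w) \<and>
      coeff (monom (w * (fst q ^ i * fst (snd q) ^ j * snd (snd q) ^ l)) ?d) D =
        (if ?d = D then w else 0) * (fst q ^ i0 * fst (snd q) ^ j0 * snd (snd q) ^ l0)" for q
      using mono[of i j l]
      by (auto simp: poly_monom scale3_def power_mult_distrib power_add power_mult mult_ac)
    then show "\<exists>k. \<forall>q. \<exists>p. (\<forall>s. poly p s = fst (scale3 a b c s q) ^ i * fst (snd (scale3 a b c s q)) ^ j *
      snd (snd (scale3 a b c s q)) ^ l * w) \<and>
      coeff p D = k * (fst q ^ i0 * fst (snd q) ^ j0 * snd (snd q) ^ l0)" by blast
  qed
  have add: "Q (\<lambda>q. f q + g q)" if fg: "Q f" "Q g" for f g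
    unfolding Q_def
  proof (intro allI)
    fix i j l
    let ?m = "\<lambda>s q. fst (scale3 a b c s q) ^ i * fst (snd (scale3 a b c s q)) ^ j * snd (snd (scale3 a b c s q)) ^ l"
    let ?e = "\<lambda>q :: complex \<times> complex \<times> complex. fst q ^ i0 * fst (snd q) ^ j0 * snd (snd q) ^ l0"
    obtain k1 where 1: "\<And>q. \<exists>p. (\<forall>s. poly p s = ?m s q * f (scale3 a b c s q)) \<and> coeff p D = k1 * ?e q"
      using fg(1) unfolding Q_def by metis
    obtain k2 where 2: "\<And>q. \<exists>p. (\<forall>s. poly p s = ?m s q * g (scale3 a b c s q)) \<and> coeff p D = k2 * ?e q"
      using fg(2) unfolding Q_def by metis
    have "\<exists>p. (\<forall>s. poly p s = ?m s q * (f (scale3 a b c s q) + g (scale3 a b c s q))) \<and> coeff p D = (k1 + k2) * ?e q" for q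
    proof -
      obtain p1 p2 where "\<forall>s. poly p1 s = ?m s q * f (scale3 a b c s q)" "coeff p1 D = k1 * ?e q"
        "\<forall>s. poly p2 s = ?m s q * g (scale3 a b c s q)" "coeff p2 D = k2 * ?e q" using 1[of q] 2[of q] by blast
      then show ?thesis by (intro exI[of _ "p1 + p2"]) (simp add: distrib_left distrib_right)
    qed
    then show "\<exists>k. \<forall>q. \<exists>p. (\<forall>s. poly p s = ?m s q * (f (scale3 a b c s q) + g (scale3 a b c s q))) \<and> coeff p D = k * ?e q"
      by blast
  qed
  have mult: "Q (\<lambda>q. fst q * f q)" "Q (\<lambda>q. fst (snd q) * f q)" "Q (\<lambda>q. snd (snd q) * f q)" if f: "Q f" for f
  proof -
    have P: "\<exists>k. \<forall>q. \<exists>p. (\<forall>s. poly p s = fst (scale3 a b c s q) ^ i * fst (snd (scale3 a b c s q)) ^ j *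
      snd (snd (scale3 a b c s q)) ^ l * f (scale3 a b c s q)) \<and>
      coeff p D = k * (fst q ^ i0 * fst (snd q) ^ j0 * snd (snd q) ^ l0)" for i j l
      using f unfolding Q_def by blast
    show "Q (\<lambda>q. fst q * f q)" unfolding Q_def using P[of "Suc _" _ _] by (simp add: mult_ac)
    show "Q (\<lambda>q. fst (snd q) * f q)" unfolding Q_def using P[of _ "Suc _" _] by (simp add: mult_ac)
    show "Q (\<lambda>q. snd (snd q) * f q)" unfolding Q_def using P[of _ _ "Suc _"] by (simp add: mult_ac)
  qed
  have Q1: "Q (\<lambda>q. poly r (fst q))" for r
    by (induction r) (auto intro: const add mult)
  have Q2: "Q (\<lambda>q. ev2 R (fst q) (fst (snd q)))" for R
    by (induction R) (auto intro: const Q1 add mult)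
  have Q3: "Q (\<lambda>q. ev3 P (fst q) (fst (snd q)) (snd (snd q)))" for P
    by (induction P) (auto intro: const Q2 add mult)
  obtain P where "\<And>x y z. f (x, y, z) = ev3 P x y z" using pol3E[OF assms(1)] by blast
  then have "f = (\<lambda>q. ev3 P (fst q) (fst (snd q)) (snd (snd q)))" by (auto simp: fun_eq_iff)
  then have "Q f" using Q3 by simp
  then have "\<exists>k. \<forall>q. \<exists>p. (\<forall>s. poly p s = f (scale3 a b c s q)) \<and> coeff p D = k * (fst q ^ i0 * fst (snd q) ^ j0 * snd (snd q) ^ l0)"
    unfolding Q_def by (drule_tac spec[of _ 0]) (drule spec[of _ 0], drule spec[of _ 0], simp)
  then obtain k where k: "\<And>q. \<exists>p. (\<forall>s. poly p s = f (scale3 a b c s q)) \<and>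
      coeff p D = k * (fst q ^ i0 * fst (snd q) ^ j0 * snd (snd q) ^ l0)" by blast
  show ?thesis
  proof (rule that[of k])
    fix q p assume p: "\<And>s. poly p s = f (scale3 a b c s q)"
    obtain p' where p': "\<forall>s. poly p' s = f (scale3 a b c s q)" "coeff p' D = k * (fst q ^ i0 * fst (snd q) ^ j0 * snd (snd q) ^ l0)"
      using k[of q] by blast
    have "p = p'" using p p'(1) by (simp flip: poly_eq_poly_eq_iff add: fun_eq_iff)
    then show "coeff p D = k * (fst q ^ i0 * fst (snd q) ^ j0 * snd (snd q) ^ l0)" using p'(2) by simp
  qed
qed

text \<open>With \<open>i = 0\<close> the number \<open>a\<close> would divide \<open>bc\<close>,
  which coprimality and \<open>a \<ge> 2\<close> exclude; then \<open>i = 1\<close> already exhausts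
  the weight.\<close>

lemma weight_unique:
  fixes a b c :: nat
  assumes "coprime a b" "coprime a c" "2 \<le> a" "0 < b" "0 < c"
  shows "b * c * i + a * c * j + a * b * l = b * c \<longleftrightarrow> i = 1 \<and> j = 0 \<and> l = 0"
proof
  assume e: "b * c * i + a * c * j + a * b * l = b * c"
  have "i \<noteq> 0"
  proof
    assume "i = 0"
    then have "b * c = a * (c * j + b * l)" using e by (simp add: algebra_simps)
    then have "a dvd b * c" by simp
    then have "a dvd c" using assms(1) by (simp add: coprime_dvd_mult_right_iff)
    then have "a dvd 1" using assms(2) by (metis coprime_common_divisor dvd_refl)
    then show False using assms(3) by simp
  qed
  then obtain i' where "i = Suc i'" by (meson not0_implies_Suc)
  then show "i = 1 \<and> j = 0 \<and> l = 0" using e assms by simp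
qed simp

lemma monomial_of_power_eq:
  fixes f :: "complex poly"
  assumes "f ^ a = monom \<alpha> M" "f \<noteq> 0" "0 < a"
  obtains \<beta> i where "f = monom \<beta> i" "i * a = M" "\<beta> \<noteq> 0"
proof -
  obtain i p where p: "f = monom 1 i * p" "poly p 0 \<noteq> 0" using monom_factor[OF assms(2)] by blast
  have "\<alpha> \<noteq> 0" using assms by auto
  have "poly p s \<noteq> 0" for s
  proof
    assume s: "poly p s = 0"
    then have "s \<noteq> 0" using p(2) by auto
    moreover have "poly f s ^ a = \<alpha> * s ^ M" using arg_cong[OF assms(1), of "\<lambda>p. poly p s"] by (simp add: poly_monom)
    ultimately show False using s p(1) assms(3) \<open>\<alpha> \<noteq> 0\<close> by (simp add: power_0_left)
  qed
  then have "constant (poly p)" using fundamental_theorem_of_algebra by blast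
  then obtain \<beta> where "p = [:\<beta>:]" by (metis constant_degree degree_eq_zeroE)
  then have f: "f = monom \<beta> i" using p by (simp add: mult_monom flip: monom_0)
  moreover have \<beta>: "\<beta> \<noteq> 0" using f assms(2) by auto
  moreover have "i * a = M"
  proof -
    have "degree (f ^ a) = i * a" using f \<beta> by (simp add: degree_power_eq degree_monom_eq)
    then show ?thesis using assms(1) \<open>\<alpha> \<noteq> 0\<close> by (simp add: degree_monom_eq)
  qed
  ultimately show ?thesis using that by blast
qed

section \<open>Fibres, fibre translations and the class of the cocycle\<close>

context bp_torsor
begin

text \<open>On the surface \<open>x = y = 0\<close> forces \<open>z = 0\<close>, so the right side
  is the punctured surface, covered by the two charts.\<close>

lemma proj3_image: "proj3 ` X = {q \<in> S. fst q \<noteq> 0 \<or> fst (snd q) \<noteq> 0}"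
proof
  show "proj3 ` X \<subseteq> {q \<in> S. fst q \<noteq> 0 \<or> fst (snd q) \<noteq> 0}"
  proof
    fix q assume "q \<in> proj3 ` X"
    then obtain p where "p \<in> X" "q = proj3 p" by blast
    then show "q \<in> {q \<in> S. fst q \<noteq> 0 \<or> fst (snd q) \<noteq> 0}"
      using xy_nonzero[of p] cx.proj_in[of p] by (simp add: proj3_def)
  qed
  show "{q \<in> S. fst q \<noteq> 0 \<or> fst (snd q) \<noteq> 0} \<subseteq> proj3 ` X"
    using cx.ch_in cx.ch_proj cy.ch_in cy.ch_proj by (smt (verit) image_eqI mem_Collect_eq subsetI)
qed

lemma shift_shift: "shift (shift p s) t = shift p (s + t)"
  by (simp add: shift_def vec5_eq_iff algebra_simps)

lemma shift_0 [simp]: "shift p 0 = p"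
  by (simp add: shift_def)

lemma proj3_shift [simp]: "proj3 (shift p t) = proj3 p"
  by (simp add: shift_def proj3_def)

lemma shift_inj: "p \<in> X \<Longrightarrow> shift p s = shift p t \<Longrightarrow> s = t"
  using xy_nonzero[of p] by (auto simp: shift_def vec5_eq_iff)

text \<open>The displacement is a determinant: replacing \<open>(u, v)\<close> by
  \<open>(u, v) + t (y^n, x^m)\<close> changes its value by \<open>t (x^m u - y^n v) = t\<close>. In
  this form it is visibly polynomial.\<close>

lemma same_fiber:
  assumes "p \<in> X" "p' \<in> X" "proj3 p = proj3 p'"
  shows "p' = shift p (p $ 4 * p' $ 5 - p $ 5 * p' $ 4)"
proof -
  let ?x = "p $ 1" and ?y = "p $ 2" and ?t = "p $ 4 * p' $ 5 - p $ 5 * p' $ 4"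
  have xyz: "p' $ 1 = ?x" "p' $ 2 = ?y" "p' $ 3 = p $ 3" using assms(3) by (simp_all add: proj3_def)
  have e: "?y ^ n * p $ 5 = ?x ^ m * p $ 4 - 1" "?y ^ n * p' $ 5 = ?x ^ m * p' $ 4 - 1"
    using assms(1,2) xyz by (simp_all add: X_variety_iff algebra_simps)
  have "p $ 4 + ?y ^ n * ?t = p $ 4 + p $ 4 * (?y ^ n * p' $ 5) - (?y ^ n * p $ 5) * p' $ 4" by (simp add: algebra_simps)
  also have "\<dots> = p' $ 4" unfolding e by (simp add: algebra_simps)
  finally have 4: "p $ 4 + ?y ^ n * ?t = p' $ 4" .
  have "p $ 5 + ?x ^ m * ?t = p $ 5 + (?x ^ m * p $ 4) * p' $ 5 - p $ 5 * (?x ^ m * p' $ 4)" by (simp add: algebra_simps)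
  also have "\<dots> = p $ 5 + (?y ^ n * p $ 5 + 1) * p' $ 5 - p $ 5 * (?y ^ n * p' $ 5 + 1)" using e by simp
  also have "\<dots> = p' $ 5" by (simp add: algebra_simps)
  finally have 5: "p $ 5 + ?x ^ m * ?t = p' $ 5" .
  show ?thesis using 4 5 xyz by (simp add: shift_def vec5_eq_iff)
qed

text \<open>The values of a global function on the two zero sections would exhibit
  \<open>k x^i y^j / (x^m y^n)\<close> as a Cech coboundary. Clearing denominators puts a monomial
  with both exponents below \<open>N\<close> into \<open>(x^N, y^N)\<close>, so \<open>k\<close>
  vanishes.\<close>

lemma chart_difference:
  assumes f: "f \<in> PF5" and ij: "i < m" "j < n"
    and diff: "\<And>x y z. (x, y, z) \<in> S \<Longrightarrow> x \<noteq> 0 \<Longrightarrow> y \<noteq> 0 \<Longrightarrow>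
      f (chart_x (x, y, z) 0) - f (chart_y (x, y, z) 0) = k * x ^ i * y ^ j / (x ^ m * y ^ n)"
  shows "k = 0"
proof -
  obtain N1 P where P: "\<And>q t. fst q \<noteq> 0 \<Longrightarrow> fst q ^ N1 * f (chart_x q t) = ev4 P q t"
    using cx.chE[OF f] by blast
  obtain N2 Q where Q: "\<And>q t. fst (snd q) \<noteq> 0 \<Longrightarrow> fst (snd q) ^ N2 * f (chart_y q t) = ev4 Q q t"
    using cy.chE[OF f] by blast
  \<comment> \<open>The summands \<open>m\<close> and \<open>n\<close> keep the subtractions
    \<open>N - m\<close> and \<open>N - n\<close> below free of truncation.\<close>
  define N where "N = N1 + N2 + m + n"
  define G where "G q = fst q ^ (N - N1) * ev4 P q 0" for q
  define H where "H q = fst (snd q) ^ (N - N2) * ev4 Q q 0" for q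
  have GH: "G \<in> pol3" "H \<in> pol3"
    unfolding G_def H_def by (intro pol3_intros chart_pol3)+
  have G: "G q = fst q ^ N * f (chart_x q 0)" if "fst q \<noteq> 0" for q
    using P[OF that, of 0] by (simp add: G_def N_def power_add mult_ac)
  have H: "H q = fst (snd q) ^ N * f (chart_y q 0)" if "fst (snd q) \<noteq> 0" for q
    using Q[OF that, of 0] by (simp add: H_def N_def power_add mult_ac)
  show ?thesis
  proof (rule bp_monomial_not_in[OF pos(2,3) GH])
    show "N - m + i < N" "N - n + j < N" using ij by (simp_all add: N_def)
    fix x y z assume q: "(x, y, z) \<in> S" "x \<noteq> 0" "y \<noteq> 0"
    have "y ^ N * G (x, y, z) - x ^ N * H (x, y, z) = x ^ N * y ^ N * (f (chart_x (x, y, z) 0) - f (chart_y (x, y, z) 0))"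
      using q by (simp add: G H algebra_simps)
    also have "\<dots> = k * (x ^ N / x ^ m * x ^ i) * (y ^ N / y ^ n * y ^ j)" using diff[OF q] by (simp add: mult_ac)
    also have "\<dots> = k * x ^ (N - m + i) * y ^ (N - n + j)"
      using q by (simp add: power_add power_diff N_def)
    finally show "y ^ N * G (x, y, z) - x ^ N * H (x, y, z) = k * x ^ (N - m + i) * y ^ (N - n + j)" .
  qed
qed

end

section \<open>The automorphism of the surface induced by an isomorphism, and its effect on
  fibres\<close>

locale torsor_iso = src: bp_torsor_coprime a b c n m + tgt: bp_torsor_coprime a b c n' m'
  for a b c n m n' m' :: nat +
  fixes \<phi> \<psi> :: "complex ^ 5 \<Rightarrow> complex ^ 5"
  assumes hyperbolic: "1 / real a + 1 / real b + 1 / real c < 1"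
    and mor: "morphism (X_variety a b c n m) (X_variety a b c n' m') \<phi>"
      "morphism (X_variety a b c n' m') (X_variety a b c n m) \<psi>"
    and inverse: "\<And>p. p \<in> X_variety a b c n m \<Longrightarrow> \<psi> (\<phi> p) = p" "\<And>p. p \<in> X_variety a b c n' m' \<Longrightarrow> \<phi> (\<psi> p) = p"
begin

abbreviation (input) X where "X \<equiv> X_variety a b c n m"
abbreviation (input) X' where "X' \<equiv> X_variety a b c n' m'"
abbreviation (input) S where "S \<equiv> bp_surface a b c"

lemma swap: "torsor_iso a b c n' m' n m \<psi> \<phi>"
  by unfold_locales (use hyperbolic mor inverse in auto)

lemma ge2: "2 \<le> a" "2 \<le> b" "2 \<le> c"
proof -
  have "2 \<le> d" if "0 < d" "1 / real d < 1" for d :: nat using that by (cases "d = 1") auto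
  moreover have "1 / real a < 1" "1 / real b < 1" "1 / real c < 1"
    using hyperbolic src.pos by (smt (verit) divide_pos_pos of_nat_0_less_iff zero_less_one)+
  ultimately show "2 \<le> a" "2 \<le> b" "2 \<le> c" using src.pos by blast+
qed

lemma \<phi>_in: "p \<in> X \<Longrightarrow> \<phi> p \<in> X'"
  using mor unfolding morphism_def by blast

lemma \<phi>_component:
  obtains f where "f \<in> PF5" "\<And>p. p \<in> X \<Longrightarrow> f p = \<phi> p $ i"
proof -
  have "restrict (\<lambda>x. \<phi> x $ i) X \<in> (\<lambda>f. restrict f X) ` PF5"
    using mor(1) unfolding morphism_def regular_functions_def by blast
  then obtain f where "f \<in> PF5" "restrict (\<lambda>x. \<phi> x $ i) X = restrict f X" by blast
  then show ?thesis using that[of f] by (simp add: restrict_eq_iff)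
qed

lemma shift_poly: "f \<in> PF5 \<Longrightarrow> \<exists>P. \<forall>t. poly P t = f (src.shift p t)"
proof -
  assume f: "f \<in> PF5"
  have K: "(\<lambda>t. k) \<in> range poly" "(\<lambda>t. k + l * t) \<in> range poly" for k l :: complex
    by (rule range_eqI[of _ _ "[:k:]"], simp add: fun_eq_iff)
      (rule range_eqI[of _ _ "[:k, l:]"], simp add: fun_eq_iff)
  have "(\<lambda>t. f (src.shift p t)) \<in> range poly"
    unfolding src.shift_def by (rule mk5_comp[OF function_ring_poly K(1) K(1) K(1) K(2) K(2) f])
  then show ?thesis by (auto simp: fun_eq_iff)
qed

text \<open>The image of a fibre is a polynomial curve in the punctured surface, hence a point by Mason's theorem.\<close>

lemma \<phi>_fiber:
  assumes "p \<in> X" shows "proj3 (\<phi> (src.shift p t)) = proj3 (\<phi> p)"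
proof -
  have "\<exists>P. \<forall>t. poly P t = \<phi> (src.shift p t) $ i" for i
  proof -
    obtain f where f: "f \<in> PF5" "\<And>p. p \<in> X \<Longrightarrow> f p = \<phi> p $ i" by (rule \<phi>_component[of i]) blast
    then show ?thesis using shift_poly[OF f(1), of p] src.shift_in[OF assms] by metis
  qed
  then obtain P where P: "\<And>i t. poly (P i) t = \<phi> (src.shift p t) $ i" by metis
  have in': "\<phi> (src.shift p t) \<in> X'" for t using \<phi>_in src.shift_in[OF assms] by blast
  have "poly (P 1 ^ a + P 2 ^ b + P 3 ^ c) t = 0" for t
    using in'[of t] by (simp add: P X_variety_iff bp_surface_def proj3_def)
  then have eq: "P 1 ^ a + P 2 ^ b + P 3 ^ c = 0" using poly_all_0_iff_0 by blast
  have no: "\<not> (poly (P 1) t = 0 \<and> poly (P 2) t = 0)" for t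
    using tgt.xy_nonzero[OF in'[of t]] by (simp add: P)
  obtain M \<alpha> \<beta> \<gamma> where M: "P 1 ^ a = monom \<alpha> M" "P 2 ^ b = monom \<beta> M" "P 3 ^ c = monom \<gamma> M"
    using mason_monomial[OF src.pos(1-3) hyperbolic eq] no by blast
  \<comment> \<open>A positive exponent would lead the curve through the singular point at parameter
    zero, which the projection of the target avoids.\<close>
  have "M = 0"
  proof (rule ccontr)
    assume "M \<noteq> 0"
    then have "poly (P 1) 0 ^ a = 0" "poly (P 2) 0 ^ b = 0"
      using arg_cong[OF M(1), of "\<lambda>p. poly p 0"] arg_cong[OF M(2), of "\<lambda>p. poly p 0"] by (simp_all add: poly_monom)
    then show False using no[of 0] by simp
  qed
  have const: "poly p t = poly p 0" if "p ^ k = monom \<alpha> M" "0 < k" for p k \<alpha>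
  proof -
    have "degree (p ^ k) = 0" using that(1) \<open>M = 0\<close> by (simp add: monom_0)
    then have "degree p = 0" using that(2) by (cases "p = 0") (auto simp: degree_power_eq)
    then obtain z where "p = [:z:]" using degree_eq_zeroE by blast
    then show ?thesis by simp
  qed
  have "\<phi> (src.shift p t) $ 1 = \<phi> p $ 1" "\<phi> (src.shift p t) $ 2 = \<phi> p $ 2" "\<phi> (src.shift p t) $ 3 = \<phi> p $ 3"
    using const[OF M(1)] const[OF M(2)] const[OF M(3)] src.pos by (simp_all add: P)
  then show ?thesis by (simp add: proj3_def)
qed

text \<open>Constancy on fibres turns the first three components into invariant functions, which
  come from polynomials on the whole surface.\<close>

lemma \<phi>_descends:
  obtains F1 F2 F3 where "F1 \<in> pol3" "F2 \<in> pol3" "F3 \<in> pol3"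
    "\<And>p. p \<in> X \<Longrightarrow> proj3 (\<phi> p) = (F1 (proj3 p), F2 (proj3 p), F3 (proj3 p))"
proof -
  have "\<exists>F\<in>pol3. \<forall>p\<in>X. \<phi> p $ i = F (proj3 p)" if "i = 1 \<or> i = 2 \<or> i = 3" for i
  proof -
    obtain f where f: "f \<in> PF5" "\<And>p. p \<in> X \<Longrightarrow> f p = \<phi> p $ i" by (rule \<phi>_component[of i]) blast
    have "f (src.shift p t) = f p" if p: "p \<in> X" for p t
      using \<phi>_fiber[OF p, of t] \<open>i = 1 \<or> i = 2 \<or> i = 3\<close> by (auto simp: proj3_def f(2) p src.shift_in)
    then obtain F where "F \<in> pol3" "\<And>p. p \<in> X \<Longrightarrow> f p = F (proj3 p)" using src.shift_invariant[OF f(1)] by blast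
    then show ?thesis using f(2) by auto
  qed
  from this[of 1] this[of 2] this[of 3] show ?thesis using that unfolding proj3_def by force
qed

text \<open>Irreducibility in the form of a generic point: the product of finitely many nonzero
  functions is nonzero.\<close>

lemma X_domain_list:
  assumes "\<And>f. f \<in> set fs \<Longrightarrow> f \<in> PF5" "\<And>f. f \<in> set fs \<Longrightarrow> \<exists>p\<in>X. f p \<noteq> 0"
  shows "\<exists>p\<in>X. \<forall>f\<in>set fs. f p \<noteq> 0"
proof -
  have "\<exists>g\<in>PF5. (\<exists>p\<in>X. g p \<noteq> 0) \<and> (\<forall>p. g p \<noteq> 0 \<longrightarrow> (\<forall>f\<in>set fs. f p \<noteq> 0))"
    using assms
  proof (induction fs)
    case Nil
    have "(\<lambda>p. 1) \<in> PF5" by (intro PF_intros)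
    then show ?case using src.X_nonempty by (intro bexI[of _ "\<lambda>p. 1"]) auto
  next
    case (Cons f fs)
    then obtain g where g: "g \<in> PF5" "\<exists>p\<in>X. g p \<noteq> 0" "\<forall>p. g p \<noteq> 0 \<longrightarrow> (\<forall>f\<in>set fs. f p \<noteq> 0)" by auto
    have f: "f \<in> PF5" "\<exists>p\<in>X. f p \<noteq> 0" using Cons.prems by auto
    have "(\<lambda>p. f p * g p) \<in> PF5" by (intro PF_intros f g)
    moreover have "\<exists>p\<in>X. f p * g p \<noteq> 0" using src.X_domain[OF f(1) g(1)] f(2) g(2) by blast
    ultimately show ?case using g(3) by (intro bexI[of _ "\<lambda>p. f p * g p"]) auto
  qed
  then show ?thesis by blast
qed

text \<open>Stabilisers are trivial because the weights have a Bezout relation with value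
  one.\<close>

lemma scale_inj:
  assumes "x \<noteq> 0" "y \<noteq> 0" "z \<noteq> 0" "s \<noteq> 0" "scale3 a b c s (x, y, z) = (x, y, z)"
  shows "s = 1"
proof -
  obtain i j k :: int where ijk: "int (b * c) * i + int (a * c) * j + int (a * b) * k = 1"
    by (rule src.degree_one_monomial)
  have s: "s ^ (b * c) = 1" "s ^ (a * c) = 1" "s ^ (a * b) = 1"
    using assms by (simp_all add: scale3_def)
  have "s = s powi (int (b * c) * i + int (a * c) * j + int (a * b) * k)" using ijk by simp
  also have "\<dots> = (s powi int (b * c)) powi i * (s powi int (a * c)) powi j * (s powi int (a * b)) powi k"
    using assms(4) by (simp only: power_int_add power_int_mult simp_thms)
  also have "\<dots> = 1" unfolding power_int_of_nat s by simp
  finally show ?thesis .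
qed

text \<open>A curve \<open>s \<mapsto> s \<cdot> q\<close> meets the singular point only at \<open>s = 0\<close>, so Mason's theorem makes its image an
  orbit \<open>s \<mapsto> s\<^sup>e \<cdot> \<sigma> q\<close>, and \<open>e = 1\<close> by injectivity. Hence \<open>\<sigma>\<close> is homogeneous, and the only
  monomials of the degrees of \<open>x, y, z\<close> are \<open>x, y, z\<close>.\<close>

lemma generic_homogeneous:
  assumes F: "F1 \<in> pol3" "F2 \<in> pol3" "F3 \<in> pol3"
    "\<And>p. p \<in> X \<Longrightarrow> proj3 (\<phi> p) = (F1 (proj3 p), F2 (proj3 p), F3 (proj3 p))"
    and p: "p \<in> X" "p $ 1 \<noteq> 0" "p $ 2 \<noteq> 0" "p $ 3 \<noteq> 0" "\<phi> p $ 1 \<noteq> 0" "\<phi> p $ 2 \<noteq> 0" "\<phi> p $ 3 \<noteq> 0"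
  shows "F1 (scale3 a b c s (proj3 p)) = s ^ (b * c) * \<phi> p $ 1"
    "F2 (scale3 a b c s (proj3 p)) = s ^ (a * c) * \<phi> p $ 2"
    "F3 (scale3 a b c s (proj3 p)) = s ^ (a * b) * \<phi> p $ 3"
proof -
  interpret sw: torsor_iso a b c n' m' n m \<psi> \<phi> by (rule swap)
  obtain G1 G2 G3 where G: "\<And>p. p \<in> X' \<Longrightarrow> proj3 (\<psi> p) = (G1 (proj3 p), G2 (proj3 p), G3 (proj3 p))"
    by (rule sw.\<phi>_descends) (rule that)
  let ?q = "proj3 p"
  have q: "?q \<in> S" "fst ?q \<noteq> 0" using src.cx.proj_in[OF p(1)] p by (auto simp: proj3_def)
  define \<sigma> where "\<sigma> r = (F1 r, F2 r, F3 r)" for r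
  have \<sigma>_inj: "r = r'" if "r \<in> proj3 ` X" "r' \<in> proj3 ` X" "\<sigma> r = \<sigma> r'" for r r'
  proof -
    obtain t t' where t: "t \<in> X" "r = proj3 t" "t' \<in> X" "r' = proj3 t'" using \<open>r \<in> proj3 ` X\<close> \<open>r' \<in> proj3 ` X\<close> by blast
    then have e: "proj3 (\<phi> t) = proj3 (\<phi> t')" using that(3) F(4) by (simp add: \<sigma>_def)
    have "proj3 (\<psi> (\<phi> t)) = proj3 (\<psi> (\<phi> t'))" using G[OF \<phi>_in[OF t(1)]] G[OF \<phi>_in[OF t(3)]] e by simp
    then show ?thesis using inverse(1) t by simp
  qed
  have \<sigma>_in: "\<sigma> r \<in> proj3 ` X'" if "r \<in> proj3 ` X" for r
    using that F(4) \<phi>_in by (force simp: \<sigma>_def)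
  have sc: "scale3 a b c s ?q \<in> proj3 ` X" if "s \<noteq> 0" for s
    using scale3_in[OF q(1)] q(2) that by (auto simp: src.proj3_image scale3_def)
  obtain f1 where f1: "\<And>s. poly f1 s = F1 (scale3 a b c s ?q)" using pol3_scale[OF F(1)] by blast
  obtain f2 where f2: "\<And>s. poly f2 s = F2 (scale3 a b c s ?q)" using pol3_scale[OF F(2)] by blast
  obtain f3 where f3: "\<And>s. poly f3 s = F3 (scale3 a b c s ?q)" using pol3_scale[OF F(3)] by blast
  have ev: "\<sigma> (scale3 a b c s ?q) = (poly f1 s, poly f2 s, poly f3 s)" for s by (simp add: \<sigma>_def f1 f2 f3)
  have im: "(poly f1 s, poly f2 s, poly f3 s) \<in> {q \<in> S. fst q \<noteq> 0 \<or> fst (snd q) \<noteq> 0}" if "s \<noteq> 0" for s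
    using \<sigma>_in[OF sc[OF that]] unfolding ev tgt.proj3_image .
  have "poly (f1 ^ a + f2 ^ b + f3 ^ c) s = 0" if "s \<in> {s. s \<noteq> 0}" for s
    using im[of s] that by (simp add: bp_surface_def)
  then have eq: "f1 ^ a + f2 ^ b + f3 ^ c = 0" by (rule poly_zero_infinite[OF infinite_nonzero_complex])
  have "\<exists>M \<alpha> \<beta> \<gamma>. f1 ^ a = monom \<alpha> M \<and> f2 ^ b = monom \<beta> M \<and> f3 ^ c = monom \<gamma> M"
  proof (rule mason_monomial[OF src.pos(1-3) hyperbolic eq])
    show False if "s \<noteq> 0" "poly f1 s = 0" "poly f2 s = 0" for s using im[OF that(1)] that by simp
  qed
  then obtain M \<alpha> \<beta> \<gamma> where M: "f1 ^ a = monom \<alpha> M" "f2 ^ b = monom \<beta> M" "f3 ^ c = monom \<gamma> M"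
    by blast
  have one: "scale3 a b c 1 ?q = ?q" by (simp add: scale3_def)
  have "(F1 ?q, F2 ?q, F3 ?q) = proj3 (\<phi> p)" using F(4)[OF p(1)] by simp
  then have at1: "poly f1 1 = \<phi> p $ 1" "poly f2 1 = \<phi> p $ 2" "poly f3 1 = \<phi> p $ 3"
    unfolding f1 f2 f3 one by (simp_all add: proj3_def)
  then have nz: "f1 \<noteq> 0" "f2 \<noteq> 0" "f3 \<noteq> 0" using p by auto
  obtain \<beta>1 i1 where m1: "f1 = monom \<beta>1 i1" "i1 * a = M" using monomial_of_power_eq[OF M(1) nz(1)] src.pos by metis
  obtain \<beta>2 i2 where m2: "f2 = monom \<beta>2 i2" "i2 * b = M" using monomial_of_power_eq[OF M(2) nz(2)] src.pos by metis
  obtain \<beta>3 i3 where m3: "f3 = monom \<beta>3 i3" "i3 * c = M" using monomial_of_power_eq[OF M(3) nz(3)] src.pos by metis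
  \<comment> \<open>Each of the pairwise coprime exponents divides the common degree
    \<open>M\<close>, which makes the curve a power reparametrisation of an orbit.\<close>
  have "a * b * c dvd M"
  proof -
    have "a dvd M" "b dvd M" "c dvd M" using m1(2) m2(2) m3(2) by (metis dvd_triv_right)+
    then show ?thesis using src.coprime by (simp add: divides_mult)
  qed
  then obtain e where e: "M = a * b * c * e" by (rule dvdE)
  have i: "i1 = b * c * e" "i2 = a * c * e" "i3 = a * b * e"
    using m1(2) m2(2) m3(2) src.pos unfolding e by (simp_all add: mult_ac)
  have f: "poly f1 s = \<phi> p $ 1 * s ^ (b * c * e)" "poly f2 s = \<phi> p $ 2 * s ^ (a * c * e)" "poly f3 s = \<phi> p $ 3 * s ^ (a * b * e)" for s
    using at1 by (simp_all add: m1 m2 m3 i poly_monom)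
  \<comment> \<open>An \<open>e\<close>-th root of unity does not move the image point, so
    injectivity on the base and triviality of stabilisers force it to be one. This rules out both
    \<open>e = 0\<close> and \<open>e \<ge> 2\<close>.\<close>
  have stab: "s = 1" if "s \<noteq> 0" "s ^ e = 1" for s :: complex
  proof -
    have "\<sigma> (scale3 a b c s ?q) = \<sigma> (scale3 a b c 1 ?q)"
      unfolding ev f by (simp only: mult.commute[of _ e] power_mult that(2)) simp
    then have "scale3 a b c s ?q = scale3 a b c 1 ?q" using \<sigma>_inj sc that(1) by auto
    then have "scale3 a b c s ?q = ?q" using one by simp
    then show ?thesis using scale_inj[OF p(2-4) that(1)] by (simp add: proj3_def)
  qed
  have "e = 1"
  proof (rule ccontr)
    assume "e \<noteq> 1"
    then consider "e = 0" | "2 \<le> e" by linarith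
    then show False
    proof cases
      case 1
      then show False using stab[of 2] by simp
    next
      case 2
      then have "card {z :: complex. z ^ e = 1} = e" using card_nth_roots[of 1 e] by simp
      moreover have "z = 1" if "z ^ e = 1" for z :: complex
        by (rule stab[OF _ that]) (use that 2 in \<open>auto simp: power_0_left\<close>)
      then have "{z :: complex. z ^ e = 1} \<subseteq> {1}" by blast
      then have "card {z :: complex. z ^ e = 1} \<le> card {1 :: complex}" by (intro card_mono) simp_all
      ultimately show False using 2 by simp
    qed
  qed
  then show "F1 (scale3 a b c s ?q) = s ^ (b * c) * \<phi> p $ 1" "F2 (scale3 a b c s ?q) = s ^ (a * c) * \<phi> p $ 2"
    "F3 (scale3 a b c s ?q) = s ^ (a * b) * \<phi> p $ 3"
    using f[of s] by (simp_all add: f1 f2 f3)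
qed

text \<open>Homogeneity is only known at points where no coordinate of \<open>p\<close> or of
  \<open>\<phi> p\<close> vanishes among the first three. Such points are generic, so the resulting
  monomial identities spread over the irreducible threefold.\<close>

lemma \<phi>_diagonal:
  obtains \<mu>1 \<mu>2 \<mu>3 where "\<mu>1 \<noteq> 0" "\<mu>2 \<noteq> 0" "\<And>p. p \<in> X \<Longrightarrow> proj3 (\<phi> p) = (\<mu>1 * p $ 1, \<mu>2 * p $ 2, \<mu>3 * p $ 3)"
proof -
  obtain F1 F2 F3 where F: "F1 \<in> pol3" "F2 \<in> pol3" "F3 \<in> pol3"
    "\<And>p. p \<in> X \<Longrightarrow> proj3 (\<phi> p) = (F1 (proj3 p), F2 (proj3 p), F3 (proj3 p))" by (rule \<phi>_descends) (rule that)
  have "\<exists>f\<in>PF5. \<forall>p\<in>X. f p = \<phi> p $ i" for i by (rule \<phi>_component[of i]) blast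
  then obtain f where f: "\<And>i. f i \<in> PF5" "\<And>i p. p \<in> X \<Longrightarrow> f i p = \<phi> p $ i" by metis
  \<comment> \<open>The point over \<open>(1, 1, z)\<close> with \<open>z^c = -2\<close> and fibre
    coordinates \<open>(1, 0)\<close> lies on both varieties, whatever the exponents.\<close>
  have coord: "\<exists>p\<in>X'. p $ i \<noteq> 0" "\<exists>p\<in>X. p $ i \<noteq> 0" if "i = 1 \<or> i = 2 \<or> i = 3" for i
  proof -
    have "(1, 1, z) \<in> S" if "z ^ c = - 2" for z using that by (simp add: bp_surface_def)
    moreover have "{z :: complex. z ^ c = -2} \<noteq> {}" using card_nth_roots[of "-2" c] src.pos by force
    then obtain z :: complex where z: "z ^ c = - 2" by blast
    moreover have "z \<noteq> 0" using z src.pos by (auto simp: power_0_left)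
    ultimately have "mk5 1 1 z 1 0 \<in> X'" "mk5 1 1 z 1 0 \<in> X" "mk5 1 1 z 1 0 $ i \<noteq> 0"
      using that by (auto simp: X_variety_iff)
    then show "\<exists>p\<in>X'. p $ i \<noteq> 0" "\<exists>p\<in>X. p $ i \<noteq> 0" by blast+
  qed
  have nz: "\<exists>p\<in>X. f i p \<noteq> 0" if "i = 1 \<or> i = 2 \<or> i = 3" for i
  proof -
    interpret sw: torsor_iso a b c n' m' n m \<psi> \<phi> by (rule swap)
    obtain p where "p \<in> X'" "p $ i \<noteq> 0" using coord(1)[OF \<open>i = 1 \<or> i = 2 \<or> i = 3\<close>] by blast
    then show ?thesis using f(2) sw.\<phi>_in inverse(2) by (intro bexI[of _ "\<psi> p"]) auto
  qed
  \<comment> \<open>A counterexample \<open>h\<close> would be nonzero at a point where the six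
    coordinate functions are nonzero too.\<close>
  have generic: "\<forall>p\<in>X. h p = 0" if h: "h \<in> PF5" and hz: "\<And>p. p \<in> X \<Longrightarrow> p $ 1 \<noteq> 0 \<Longrightarrow> p $ 2 \<noteq> 0 \<Longrightarrow> p $ 3 \<noteq> 0 \<Longrightarrow>
      \<phi> p $ 1 \<noteq> 0 \<Longrightarrow> \<phi> p $ 2 \<noteq> 0 \<Longrightarrow> \<phi> p $ 3 \<noteq> 0 \<Longrightarrow> h p = 0" for h
  proof (rule ccontr)
    assume "\<not> (\<forall>p\<in>X. h p = 0)"
    then have "\<exists>p\<in>X. \<forall>f\<in>set [h, \<lambda>p. p $ 1, \<lambda>p. p $ 2, \<lambda>p. p $ 3, f 1, f 2, f 3]. f p \<noteq> 0"
      using h f(1) coord(2) nz by (intro X_domain_list) (auto intro: PF_intros)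
    then show False using hz f(2) by auto
  qed
  note pos = src.pos and cop = src.coprime
  have w1: "b * c * i + a * c * j + a * b * l = b * c \<longleftrightarrow> i = 1 \<and> j = 0 \<and> l = 0" for i j l
    using weight_unique[OF cop(1,2) ge2(1) pos(2,3)] .
  have w2: "b * c * i + a * c * j + a * b * l = a * c \<longleftrightarrow> i = 0 \<and> j = 1 \<and> l = 0" for i j l
    using weight_unique[of b a c j i l] cop ge2(2) pos by (simp add: coprime_commute algebra_simps conj_ac)
  have w3: "b * c * i + a * c * j + a * b * l = a * b \<longleftrightarrow> i = 0 \<and> j = 0 \<and> l = 1" for i j l
    using weight_unique[of c a b l i j] cop ge2(3) pos by (simp add: coprime_commute algebra_simps conj_ac)
  have diag: "\<exists>k. \<forall>p\<in>X. \<phi> p $ i = k * (p $ 1 ^ i0 * p $ 2 ^ j0 * p $ 3 ^ l0)"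
    if Fi: "F \<in> pol3" "\<And>i j l. b * c * i + a * c * j + a * b * l = D \<longleftrightarrow> i = i0 \<and> j = j0 \<and> l = l0"
      "\<And>p s. p \<in> X \<Longrightarrow> p $ 1 \<noteq> 0 \<Longrightarrow> p $ 2 \<noteq> 0 \<Longrightarrow> p $ 3 \<noteq> 0 \<Longrightarrow> \<phi> p $ 1 \<noteq> 0 \<Longrightarrow> \<phi> p $ 2 \<noteq> 0 \<Longrightarrow> \<phi> p $ 3 \<noteq> 0 \<Longrightarrow>
        F (scale3 a b c s (proj3 p)) = s ^ D * \<phi> p $ i" for F D i0 j0 l0 i
  proof -
    obtain k where k: "\<And>q p. (\<And>s. poly p s = F (scale3 a b c s q)) \<Longrightarrow>
        coeff p D = k * (fst q ^ i0 * fst (snd q) ^ j0 * snd (snd q) ^ l0)"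
      using weight_component[OF Fi(1,2)] by blast
    have "\<forall>p\<in>X. f i p - k * (p $ 1 ^ i0 * p $ 2 ^ j0 * p $ 3 ^ l0) = 0"
    proof (rule generic)
      show "(\<lambda>p. f i p - k * (p $ 1 ^ i0 * p $ 2 ^ j0 * p $ 3 ^ l0)) \<in> PF5" by (intro PF_intros f)
      fix p assume p: "p \<in> X" "p $ 1 \<noteq> 0" "p $ 2 \<noteq> 0" "p $ 3 \<noteq> 0" "\<phi> p $ 1 \<noteq> 0" "\<phi> p $ 2 \<noteq> 0" "\<phi> p $ 3 \<noteq> 0"
      have "poly (monom (\<phi> p $ i) D) s = F (scale3 a b c s (proj3 p))" for s
        using Fi(3)[OF p, of s] by (simp add: poly_monom)
      then have "coeff (monom (\<phi> p $ i) D) D = k * (fst (proj3 p) ^ i0 * fst (snd (proj3 p)) ^ j0 * snd (snd (proj3 p)) ^ l0)"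
        by (rule k)
      then show "f i p - k * (p $ 1 ^ i0 * p $ 2 ^ j0 * p $ 3 ^ l0) = 0" using f(2)[OF p(1)] by (simp add: proj3_def)
    qed
    then show ?thesis using f(2) by (intro exI[of _ k]) auto
  qed
  note gh = generic_homogeneous[OF F]
  obtain \<mu>1 where 1: "\<And>p. p \<in> X \<Longrightarrow> \<phi> p $ 1 = \<mu>1 * p $ 1" using diag[OF F(1) w1 gh(1)] by auto
  obtain \<mu>2 where 2: "\<And>p. p \<in> X \<Longrightarrow> \<phi> p $ 2 = \<mu>2 * p $ 2" using diag[OF F(2) w2 gh(2)] by auto
  obtain \<mu>3 where 3: "\<And>p. p \<in> X \<Longrightarrow> \<phi> p $ 3 = \<mu>3 * p $ 3" using diag[OF F(3) w3 gh(3)] by auto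
  have "\<mu>1 \<noteq> 0" "\<mu>2 \<noteq> 0" using nz[of 1] nz[of 2] f(2) 1 2 by auto
  then show ?thesis using that[of \<mu>1 \<mu>2 \<mu>3] 1 2 3 by (simp add: proj3_def)
qed

text \<open>The determinant of \<open>same_fiber\<close>, here measuring the displacement in the
  target fibre caused by the displacement \<open>t\<close> in the source.\<close>

definition \<tau> :: "complex ^ 5 \<Rightarrow> complex \<Rightarrow> complex" where
  "\<tau> p t = \<phi> p $ 4 * \<phi> (src.shift p t) $ 5 - \<phi> p $ 5 * \<phi> (src.shift p t) $ 4"

lemma \<phi>_shift: "p \<in> X \<Longrightarrow> \<phi> (src.shift p t) = tgt.shift (\<phi> p) (\<tau> p t)"
  unfolding \<tau>_def using \<phi>_fiber[of p t] by (intro tgt.same_fiber) (auto simp: \<phi>_in src.shift_in)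

lemma \<tau>_poly:
  assumes "p \<in> X" shows "\<exists>P. \<forall>t. poly P t = \<tau> p t"
proof -
  obtain f4 where f4: "f4 \<in> PF5" "\<And>p. p \<in> X \<Longrightarrow> f4 p = \<phi> p $ 4" by (rule \<phi>_component[of 4]) blast
  obtain f5 where f5: "f5 \<in> PF5" "\<And>p. p \<in> X \<Longrightarrow> f5 p = \<phi> p $ 5" by (rule \<phi>_component[of 5]) blast
  obtain P4 P5 where "\<forall>t. poly P4 t = f4 (src.shift p t)" "\<forall>t. poly P5 t = f5 (src.shift p t)"
    using shift_poly f4(1) f5(1) by metis
  then show ?thesis
    using f4(2) f5(2) src.shift_in[OF assms]
    by (intro exI[of _ "smult (\<phi> p $ 4) P5 - smult (\<phi> p $ 5) P4"]) (simp add: \<tau>_def)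
qed

lemma \<tau>_inverse:
  assumes "p \<in> X" shows "torsor_iso.\<tau> n' m' \<psi> (\<phi> p) (\<tau> p t) = t"
proof -
  interpret sw: torsor_iso a b c n' m' n m \<psi> \<phi> by (rule swap)
  have "src.shift p t = \<psi> (\<phi> (src.shift p t))" using inverse(1) src.shift_in[OF assms] by simp
  also have "\<dots> = src.shift p (sw.\<tau> (\<phi> p) (\<tau> p t))"
    using \<phi>_shift[OF assms] sw.\<phi>_shift[OF \<phi>_in[OF assms]] inverse(1)[OF assms] by simp
  finally show ?thesis using src.shift_inj[OF assms] by metis
qed

text \<open>On a fibre, \<open>\<tau>\<close> and its counterpart for \<open>\<psi>\<close> are
  polynomials composing to the identity. The degrees multiply to one, so both are affine, and
  \<open>\<tau>\<close> sends zero to zero.\<close>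

lemma \<tau>_scalar:
  assumes "p \<in> X" shows "\<tau> p t = \<tau> p 1 * t"
proof -
  interpret sw: torsor_iso a b c n' m' n m \<psi> \<phi> by (rule swap)
  obtain P where P: "\<And>t. poly P t = \<tau> p t" using \<tau>_poly[OF assms] by blast
  obtain Q where Q: "\<And>t. poly Q t = sw.\<tau> (\<phi> p) t" using sw.\<tau>_poly[OF \<phi>_in[OF assms]] by blast
  have "poly (pcompose Q P) t = poly [:0, 1:] t" for t
    using \<tau>_inverse[OF assms, of t] by (simp add: poly_pcompose P Q)
  then have "pcompose Q P = [:0, 1:]" by (simp flip: poly_eq_poly_eq_iff add: fun_eq_iff)
  then have "degree Q * degree P = 1" by (metis degree_pcompose degree_pCons_eq_if one_pCons degree_1 One_nat_def zero_neq_one)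
  then have "degree P = 1" by simp
  then obtain u v where uv: "P = [:u, v:]" using degree1_coeffs by blast
  have "\<tau> p 0 = 0" by (simp add: \<tau>_def)
  then have "u = 0" using P[of 0] uv by simp
  then show ?thesis using P[of t] P[of 1] uv by (simp add: mult.commute)
qed

text \<open>The slope of a linear map does not depend on the base point chosen in the fibre, so it
  is an invariant function.\<close>

lemma \<tau>_descends:
  obtains K where "K \<in> pol3" "\<And>p. p \<in> X \<Longrightarrow> \<tau> p 1 = K (proj3 p)"
proof -
  obtain f4 where f4: "f4 \<in> PF5" "\<And>p. p \<in> X \<Longrightarrow> f4 p = \<phi> p $ 4" by (rule \<phi>_component[of 4]) blast
  obtain f5 where f5: "f5 \<in> PF5" "\<And>p. p \<in> X \<Longrightarrow> f5 p = \<phi> p $ 5" by (rule \<phi>_component[of 5]) blast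
  define k where "k p = f4 p * f5 (src.shift p 1) - f5 p * f4 (src.shift p 1)" for p
  have sh: "(\<lambda>p. f (src.shift p 1)) \<in> PF5" if "f \<in> PF5" for f
    unfolding src.shift_def
    by (rule mk5_comp[OF function_ring_polynomial_functions _ _ _ _ _ that]; intro PF_intros)
  have "k \<in> PF5" unfolding k_def by (intro PF_intros f4(1) f5(1) sh)
  moreover have k: "k p = \<tau> p 1" if "p \<in> X" for p
    using that src.shift_in[OF that] by (simp add: k_def \<tau>_def f4(2) f5(2))
  have "\<tau> (src.shift p s) 1 = \<tau> p 1" if p: "p \<in> X" for p s
  proof -
    \<comment> \<open>Shifting by \<open>s + 1\<close> at once or in two stages gives two
      expressions for the same point, from which the slope at the shifted base point is read
      off.\<close>
    have "tgt.shift (\<phi> p) (\<tau> p 1 * (s + 1)) = \<phi> (src.shift p (s + 1))"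
      using \<phi>_shift[OF p] \<tau>_scalar[OF p] by metis
    also have "\<dots> = \<phi> (src.shift (src.shift p s) 1)" by (simp add: src.shift_shift)
    also have "\<dots> = tgt.shift (tgt.shift (\<phi> p) (\<tau> p 1 * s)) (\<tau> (src.shift p s) 1)"
      using \<phi>_shift[OF src.shift_in[OF p]] \<phi>_shift[OF p] \<tau>_scalar[OF p] by metis
    also have "\<dots> = tgt.shift (\<phi> p) (\<tau> p 1 * s + \<tau> (src.shift p s) 1)" by (simp add: tgt.shift_shift)
    finally have "\<tau> p 1 * (s + 1) = \<tau> p 1 * s + \<tau> (src.shift p s) 1"
      by (rule tgt.shift_inj[OF \<phi>_in[OF p]])
    then show ?thesis by (simp add: algebra_simps)
  qed
  then have "k (src.shift p s) = k p" if "p \<in> X" for p s using that k src.shift_in by simp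
  ultimately obtain K where "K \<in> pol3" "\<And>p. p \<in> X \<Longrightarrow> k p = K (proj3 p)"
    using src.shift_invariant by blast
  then show ?thesis using that k by simp
qed

text \<open>Along each orbit closure the fibre scalings of \<open>\<phi>\<close> and of its inverse are polynomials in \<open>s\<close> with
  product one, so their common value is the one at the singular point.\<close>

lemma \<tau>_constant:
  obtains \<kappa> where "\<kappa> \<noteq> 0" "\<And>p t. p \<in> X \<Longrightarrow> \<tau> p t = \<kappa> * t"
proof -
  interpret sw: torsor_iso a b c n' m' n m \<psi> \<phi> by (rule swap)
  obtain K where K: "K \<in> pol3" "\<And>p. p \<in> X \<Longrightarrow> \<tau> p 1 = K (proj3 p)" by (rule \<tau>_descends) (rule that)
  obtain K' where K': "K' \<in> pol3" "\<And>p. p \<in> X' \<Longrightarrow> sw.\<tau> p 1 = K' (proj3 p)" by (rule sw.\<tau>_descends) (rule that)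
  obtain \<mu>1 \<mu>2 \<mu>3 where d: "\<mu>1 \<noteq> 0" "\<mu>2 \<noteq> 0" "\<And>p. p \<in> X \<Longrightarrow> proj3 (\<phi> p) = (\<mu>1 * p $ 1, \<mu>2 * p $ 2, \<mu>3 * p $ 3)"
    by (rule \<phi>_diagonal) (rule that)
  have one: "sw.\<tau> (\<phi> p) 1 * \<tau> p 1 = 1" if "p \<in> X" for p
    using \<tau>_inverse[OF that, of 1] sw.\<tau>_scalar[OF \<phi>_in[OF that], of "\<tau> p 1"] by simp
  have const: "\<tau> p 1 = K (0, 0, 0)" if p: "p \<in> X" for p
  proof -
    let ?q = "proj3 p" and ?r = "proj3 (\<phi> p)"
    have q: "?q \<in> S" "fst ?q \<noteq> 0 \<or> fst (snd ?q) \<noteq> 0"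
      using src.cx.proj_in[OF p] src.xy_nonzero[OF p] by (auto simp: proj3_def)
    obtain k where k: "\<And>s. poly k s = K (scale3 a b c s ?q)" using pol3_scale[OF K(1)] by blast
    obtain k' where k': "\<And>s. poly k' s = K' (scale3 a b c s ?r)" using pol3_scale[OF K'(1)] by blast
    have "poly (k' * k - 1) s = 0" if s: "s \<in> {s. s \<noteq> 0}" for s
    proof -
      have "scale3 a b c s ?q \<in> proj3 ` X"
        using scale3_in[OF q(1)] q(2) s by (auto simp: src.proj3_image scale3_def)
      then obtain t where t: "t \<in> X" "proj3 t = scale3 a b c s ?q" by auto
      have "proj3 (\<phi> t) = scale3 a b c s ?r"
        using d(3)[OF t(1)] d(3)[OF p] t(2) by (simp add: scale3_def proj3_def)
      then show ?thesis using one[OF t(1)] K(2)[OF t(1)] K'(2)[OF \<phi>_in[OF t(1)]] t(2) by (simp add: k k')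
    qed
    then have kk: "k' * k - 1 = 0" by (rule poly_zero_infinite[OF infinite_nonzero_complex])
    then have "k dvd 1" by (metis dvd_triv_right eq_iff_diff_eq_0)
    then obtain z where z: "k = [:z:]" by (metis degree_eq_zeroE is_unit_iff_degree dvd_0_left one_neq_zero)
    have "K ?q = poly k 1" by (simp add: k scale3_def)
    also have "\<dots> = poly k 0" by (simp add: z)
    also have "\<dots> = K (0, 0, 0)" using src.pos by (simp add: k scale3_def power_0_left)
    finally show ?thesis using K(2)[OF p] by simp
  qed
  show ?thesis
  proof (rule that)
    obtain p where "p \<in> X" using X_domain_list[of "[]"] by auto
    then show "K (0, 0, 0) \<noteq> 0" using one const by fastforce
    show "\<tau> p t = K (0, 0, 0) * t" if "p \<in> X" for p t
      using \<tau>_scalar[OF that, of t] const[OF that] by simp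
  qed
qed

text \<open>The two zero sections differ by \<open>1 / (x^m y^n)\<close>, so their images differ by
  \<open>\<kappa>\<close> times this along the target fibre direction
  \<open>((\<mu>2 y)^n', (\<mu>1 x)^m')\<close>. Each fibre component of \<open>\<phi>\<close> is a
  global function, so multiplying the source cocycle by \<open>y^n'\<close> or by
  \<open>x^m'\<close> gives a coboundary; by \<open>chart_difference\<close> this needs
  \<open>n \<le> n'\<close> and \<open>m \<le> m'\<close>.\<close>

lemma exponents_le: "m \<le> m'" "n \<le> n'"
proof -
  obtain \<mu>1 \<mu>2 \<mu>3 where d: "\<mu>1 \<noteq> 0" "\<mu>2 \<noteq> 0" "\<And>p. p \<in> X \<Longrightarrow> proj3 (\<phi> p) = (\<mu>1 * p $ 1, \<mu>2 * p $ 2, \<mu>3 * p $ 3)"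
    by (rule \<phi>_diagonal) (rule that)
  obtain \<kappa> where \<kappa>: "\<kappa> \<noteq> 0" "\<And>p t. p \<in> X \<Longrightarrow> \<tau> p t = \<kappa> * t" by (rule \<tau>_constant) (rule that)
  obtain f4 where f4: "f4 \<in> PF5" "\<And>p. p \<in> X \<Longrightarrow> f4 p = \<phi> p $ 4" by (rule \<phi>_component[of 4]) blast
  obtain f5 where f5: "f5 \<in> PF5" "\<And>p. p \<in> X \<Longrightarrow> f5 p = \<phi> p $ 5" by (rule \<phi>_component[of 5]) blast
  have diff: "f4 (src.chart_x (x, y, z) 0) - f4 (src.chart_y (x, y, z) 0) = \<kappa> * \<mu>2 ^ n' * x ^ 0 * y ^ n' / (x ^ m * y ^ n)"
      "f5 (src.chart_x (x, y, z) 0) - f5 (src.chart_y (x, y, z) 0) = \<kappa> * \<mu>1 ^ m' * x ^ m' * y ^ 0 / (x ^ m * y ^ n)"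
    if q: "(x, y, z) \<in> S" "x \<noteq> 0" "y \<noteq> 0" for x y z
  proof -
    let ?p = "src.chart_y (x, y, z) 0" and ?t = "1 / (x ^ m * y ^ n)"
    have p: "?p \<in> X" "proj3 ?p = (x, y, z)" using src.cy.ch_in[OF q(1)] src.cy.ch_proj q by auto
    have e: "src.chart_x (x, y, z) 0 = src.shift ?p ?t" using src.chart_x_chart_y[OF q] .
    have "\<phi> (src.chart_x (x, y, z) 0) = tgt.shift (\<phi> ?p) (\<kappa> * ?t)"
      unfolding e \<phi>_shift[OF p(1)] \<kappa>(2)[OF p(1)] ..
    moreover have "\<phi> ?p $ 1 = \<mu>1 * x" "\<phi> ?p $ 2 = \<mu>2 * y" using d(3)[OF p(1)] p(2) by (simp_all add: proj3_def)
    moreover have "f4 (src.chart_x (x, y, z) 0) = \<phi> (src.chart_x (x, y, z) 0) $ 4"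
      "f5 (src.chart_x (x, y, z) 0) = \<phi> (src.chart_x (x, y, z) 0) $ 5"
      unfolding e using f4(2) f5(2) src.shift_in[OF p(1)] by simp_all
    ultimately show "f4 (src.chart_x (x, y, z) 0) - f4 ?p = \<kappa> * \<mu>2 ^ n' * x ^ 0 * y ^ n' / (x ^ m * y ^ n)"
      "f5 (src.chart_x (x, y, z) 0) - f5 ?p = \<kappa> * \<mu>1 ^ m' * x ^ m' * y ^ 0 / (x ^ m * y ^ n)"
      using f4(2)[OF p(1)] f5(2)[OF p(1)] by (simp_all add: tgt.shift_def power_mult_distrib mult_ac)
  qed
  show "m \<le> m'"
  proof (rule ccontr)
    assume "\<not> m \<le> m'"
    then have "\<kappa> * \<mu>1 ^ m' = 0" using src.chart_difference[OF f5(1) _ src.pos(4) diff(2)] by simp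
    then show False using \<kappa>(1) d(1) by simp
  qed
  show "n \<le> n'"
  proof (rule ccontr)
    assume "\<not> n \<le> n'"
    then have "\<kappa> * \<mu>2 ^ n' = 0" using src.chart_difference[OF f4(1) src.pos(5) _ diff(1)] by simp
    then show False using \<kappa>(1) d(2) by simp
  qed
qed

end

theorem mainTheorem1:
  fixes a b c :: nat
  assumes "0 < a" and "0 < b" and "0 < c"
    and "coprime a b" and "coprime a c" and "coprime b c"
    and "1 / real a + 1 / real b + 1 / real c < 1"
  shows "(\<forall>m n. 0 < m \<longrightarrow> 0 < n \<longrightarrow> factorial_variety (X_variety a b c n m)) \<and>
    (\<forall>m n m' n'. 0 < m \<longrightarrow> 0 < n \<longrightarrow> 0 < m' \<longrightarrow> 0 < n' \<longrightarrow>
      X_variety a b c n m \<times>\<^sub>v\<^sub>a\<^sub>r affine_line \<cong>\<^sub>v\<^sub>a\<^sub>r X_variety a b c n' m' \<times>\<^sub>v\<^sub>a\<^sub>r affine_line) \<and>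
    (\<forall>m n m' n'. 0 < m \<longrightarrow> 0 < n \<longrightarrow> 0 < m' \<longrightarrow> 0 < n' \<longrightarrow>
      X_variety a b c n m \<cong>\<^sub>v\<^sub>a\<^sub>r X_variety a b c n' m' \<longrightarrow> (m, n) = (m', n'))"
proof -
  have torsor: "bp_torsor_coprime a b c n m" if "0 < m" "0 < n" for m n
    using that assms by unfold_locales
  have "(m, n) = (m', n')"
    if mn: "0 < m" "0 < n" "0 < m'" "0 < n'" and iso: "X_variety a b c n m \<cong>\<^sub>v\<^sub>a\<^sub>r X_variety a b c n' m'" for m n m' n'
  proof -
    obtain \<phi> \<psi> where "morphism (X_variety a b c n m) (X_variety a b c n' m') \<phi>"
      "morphism (X_variety a b c n' m') (X_variety a b c n m) \<psi>"
      "\<forall>x\<in>X_variety a b c n m. \<psi> (\<phi> x) = x" "\<forall>y\<in>X_variety a b c n' m'. \<phi> (\<psi> y) = y"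
      using iso unfolding isomorphic_varieties_def by blast
    then have "torsor_iso a b c n m n' m' \<phi> \<psi>"
      using torsor[OF mn(1,2)] torsor[OF mn(3,4)] assms(7)
      unfolding torsor_iso_def torsor_iso_axioms_def by blast
    then interpret torsor_iso a b c n m n' m' \<phi> \<psi> .
    have "m \<le> m'" "n \<le> n'" "m' \<le> m" "n' \<le> n"
      using exponents_le torsor_iso.exponents_le[OF swap] by blast+
    then show ?thesis by simp
  qed
  moreover have "factorial_variety (X_variety a b c n m)" if "0 < m" "0 < n" for m n
    using bp_torsor_coprime.X_factorial[OF torsor[OF that]] .
  moreover have "X_variety a b c n m \<times>\<^sub>v\<^sub>a\<^sub>r affine_line \<cong>\<^sub>v\<^sub>a\<^sub>r X_variety a b c n' m' \<times>\<^sub>v\<^sub>a\<^sub>r affine_line"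
    if "0 < m" "0 < n" "0 < m'" "0 < n'" for m n m' n'
    using that torsor by (intro stably_isomorphic) (auto simp: bp_torsor_coprime_def)
  ultimately show ?thesis by blast
qed

end
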